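(* Let $s,n\in\mathbb{N}$ be powers of $3$ with $n\ge9s$, $\sigma>0$, $\delta\in(0,1)$. Observations are $y_t=x_t+\sigma\xi_t$, $|t|\le 2n$, with $\xi_t$ i.i.d. standard complex Gaussian $\mathbb{C}\mathcal{N}(0,1)$. Consider testing $\mathscr{H}_{0,n}=\{x\in\mathbb{C}(\mathbb{Z}):\|x\|_{2n,2}=0\}$ against $\mathscr{H}_{s,n}(\mathsf{r})=\{x\in\mathscr{X}_s:\|x\|_{2n,2}\ge\mathsf{r}\}$, where $$\mathsf{r}^2\ge\mathsf{r}_0^2:=128\mathsf{c}_\star^2\sigma^2\Big(6s+3s\log(2n+1)+\log(9e^3s)\log\big(6\log_3(n/s)\,\delta^{-1}\big)\Big)\log(9e^4s)\log_3(n/s),\quad\mathsf{c}_\star=2.16\pi^2+6.$$ Let $\widehat T_n(y)=\|y\|_{2n,2}^2-\|y-\widehat x^{\mathsf{full}}\|_{2n,2}^2$. The test that rejects $\mathscr{H}_{0,n}$ when $\widehat T_n(y)>\tfrac58\mathsf{r}_0^2$ satisfies: for every $x\in\mathscr{H}_{0,n}$ it rejects with probability at most $\delta$, and for every $x\in\mathscr{H}_{s,n}(\mathsf{r})$ it fails to reject with probability at most $\delta$.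
   Context: $\mathbb{C}(\mathbb{Z})$: two-sided complex sequences; $\mathbb{C}_p(\mathbb{Z})$: those with $x_t=0$ for $|t|>p$. $(\Delta x)_t=x_{t-1}$. $\mathscr{X}_s$ is the union over $(w_1,\dots,w_s)\in\mathbb{C}^s$ of $\{x:\mathsf{f}(\Delta)x=0\}$ with $\mathsf{f}(z)=\prod_k(1-w_kz)$. Convolution $(u*v)_t=\sum_\tau u_\tau v_{t-\tau}$; $\|u\|_{p,2}=(\sum_{|t|\le p}|u_t|^2)^{1/2}$; DFT $(\mathcal{F}_p[u])_k=(2p+1)^{-1/2}\sum_{|\tau|\le p}\exp(-i2\pi k\tau/(2p+1))u_\tau$, $k=0,\dots,2p$. The estimate $\widehat x^{\mathsf{full}}$: let $\widehat\varphi^{(0)}\in\mathbb{C}_n(\mathbb{Z})$ minimize $\|\varphi*y-y\|_{n,2}$ subject to $\max\{\|\mathcal{F}_n[\varphi]\|_1,18s\|\mathcal{F}_n[\varphi]\|_\infty\}\le18\mathsf{c}_\star s/\sqrt{2n+1}$, and $\widehat x^{\mathsf{full}}_t=(\widehat\varphi^{(0)}*y)_t$ for $|t|\le n$. With $K=\log_3(n/(9s))$, $n_k=n3^{-k}$, $h_k=2n-2n_k$, $I^{(k,+)}=(h_k-n_k,h_k+n_k]$, $I^{(k,-)}=[-h_k-n_k,-h_k+n_k)$ ($k=1,\dots,K$), let $\widehat\varphi^{(k,\pm)}\in\mathbb{C}_{n_k}(\mathbb{Z})$ minimize $\|\Delta^{\mp h_k}[\varphi*y-y]\|_{n_k,2}$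 (where $(\Delta^{-h}u)_t=u_{t+h}$) subject to $\max\{\|\mathcal{F}_{n_k}[\varphi]\|_1,18s\|\mathcal{F}_{n_k}[\varphi]\|_\infty\}\le18\mathsf{c}_\star s/\sqrt{2n_k+1}$, and $\widehat x^{\mathsf{full}}_t=(\widehat\varphi^{(k,\pm)}*y)_t$ for integer $t\in I^{(k,\pm)}$; finally $\widehat x^{\mathsf{full}}_t=y_t$ for $2n-9s<|t|\le2n$. *)

theory Defs
  imports "HOL-Probability.Probability"
begin

definition cstar :: real where
  "cstar = 2.16 * pi ^ 2 + 6"

definition supp_in :: "nat \<Rightarrow> (int \<Rightarrow> complex) \<Rightarrow> bool" where
  "supp_in p u \<longleftrightarrow> (\<forall>t. \<bar>t\<bar> > int p \<longrightarrow> u t = 0)"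

definition conv :: "(int \<Rightarrow> complex) \<Rightarrow> (int \<Rightarrow> complex) \<Rightarrow> int \<Rightarrow> complex" where
  "conv u v t = infsum (\<lambda>\<tau>. u \<tau> * v (t - \<tau>)) UNIV"

definition norm2 :: "nat \<Rightarrow> (int \<Rightarrow> complex) \<Rightarrow> real" where
  "norm2 p u = sqrt (\<Sum>t\<in>{- int p..int p}. (cmod (u t))\<^sup>2)"

definition dft :: "nat \<Rightarrow> (int \<Rightarrow> complex) \<Rightarrow> nat \<Rightarrow> complex" where
  "dft p u k = complex_of_real (1 / sqrt (real (2 * p + 1))) *
     (\<Sum>\<tau>\<in>{- int p..int p}.
        exp (- \<i> * complex_of_real (2 * pi * real k * real_of_int \<tau> / real (2 * p + 1))) * u \<tau>)"

definition dft_l1 :: "nat \<Rightarrow> (int \<Rightarrow> complex) \<Rightarrow> real" where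
  "dft_l1 p u = (\<Sum>k\<in>{0..2 * p}. cmod (dft p u k))"

definition dft_linf :: "nat \<Rightarrow> (int \<Rightarrow> complex) \<Rightarrow> real" where
  "dft_linf p u = Max ((\<lambda>k. cmod (dft p u k)) ` {0..2 * p})"

definition feasible :: "nat \<Rightarrow> nat \<Rightarrow> (int \<Rightarrow> complex) \<Rightarrow> bool" where
  "feasible s p \<phi> \<longleftrightarrow> supp_in p \<phi> \<and>
     max (dft_l1 p \<phi>) (18 * real s * dft_linf p \<phi>) \<le> 18 * cstar * real s / sqrt (real (2 * p + 1))"

definition resid :: "(int \<Rightarrow> complex) \<Rightarrow> (int \<Rightarrow> complex) \<Rightarrow> int \<Rightarrow> complex" where
  "resid \<phi> y t = conv \<phi> y t - y t"

definition Kidx :: "nat \<Rightarrow> nat \<Rightarrow> nat" where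
  "Kidx n s = nat \<lfloor>log 3 (real n / (9 * real s))\<rfloor>"

definition nk :: "nat \<Rightarrow> nat \<Rightarrow> nat" where
  "nk n k = n div 3 ^ k"

definition hk :: "nat \<Rightarrow> nat \<Rightarrow> int" where
  "hk n k = 2 * int n - 2 * int (nk n k)"

definition Ipos :: "nat \<Rightarrow> nat \<Rightarrow> int set" where
  "Ipos n k = {hk n k - int (nk n k) <.. hk n k + int (nk n k)}"

definition Ineg :: "nat \<Rightarrow> nat \<Rightarrow> int set" where
  "Ineg n k = {- hk n k - int (nk n k) ..< - hk n k + int (nk n k)}"

definition is_min0 :: "nat \<Rightarrow> nat \<Rightarrow> (int \<Rightarrow> complex) \<Rightarrow> (int \<Rightarrow> complex) \<Rightarrow> bool" where
  "is_min0 n s y \<phi> \<longleftrightarrow> feasible s n \<phi> \<and>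
     (\<forall>\<psi>. feasible s n \<psi> \<longrightarrow> norm2 n (resid \<phi> y) \<le> norm2 n (resid \<psi> y))"

definition is_mink :: "nat \<Rightarrow> nat \<Rightarrow> nat \<Rightarrow> bool \<Rightarrow> (int \<Rightarrow> complex) \<Rightarrow> (int \<Rightarrow> complex) \<Rightarrow> bool" where
  "is_mink n s k pos y \<phi> \<longleftrightarrow>
     (let p = nk n k; h = (if pos then hk n k else - hk n k) in
       feasible s p \<phi> \<and>
       (\<forall>\<psi>. feasible s p \<psi> \<longrightarrow>
          norm2 p (\<lambda>t. resid \<phi> y (t + h)) \<le> norm2 p (\<lambda>t. resid \<psi> y (t + h))))"

text \<open>The estimate x^full, given the chosen minimizers Phi0 y, Phip k y, Phim k y.\<close>
definition xfull :: "nat \<Rightarrow> nat \<Rightarrow> ((int \<Rightarrow> complex) \<Rightarrow> (int \<Rightarrow> complex))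
    \<Rightarrow> (nat \<Rightarrow> (int \<Rightarrow> complex) \<Rightarrow> (int \<Rightarrow> complex))
    \<Rightarrow> (nat \<Rightarrow> (int \<Rightarrow> complex) \<Rightarrow> (int \<Rightarrow> complex))
    \<Rightarrow> (int \<Rightarrow> complex) \<Rightarrow> int \<Rightarrow> complex" where
  "xfull n s \<Phi>0 \<Phi>p \<Phi>m y t =
     (if \<bar>t\<bar> \<le> int n then conv (\<Phi>0 y) y t
      else if 2 * int n - 9 * int s < \<bar>t\<bar> then y t
      else if (\<exists>k\<in>{1..Kidx n s}. t \<in> Ipos n k)
        then conv (\<Phi>p (SOME k. k \<in> {1..Kidx n s} \<and> t \<in> Ipos n k) y) y t
      else if (\<exists>k\<in>{1..Kidx n s}. t \<in> Ineg n k)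
        then conv (\<Phi>m (SOME k. k \<in> {1..Kidx n s} \<and> t \<in> Ineg n k) y) y t
      else 0)"

definition Tstat :: "nat \<Rightarrow> nat \<Rightarrow> ((int \<Rightarrow> complex) \<Rightarrow> (int \<Rightarrow> complex))
    \<Rightarrow> (nat \<Rightarrow> (int \<Rightarrow> complex) \<Rightarrow> (int \<Rightarrow> complex))
    \<Rightarrow> (nat \<Rightarrow> (int \<Rightarrow> complex) \<Rightarrow> (int \<Rightarrow> complex))
    \<Rightarrow> (int \<Rightarrow> complex) \<Rightarrow> real" where
  "Tstat n s \<Phi>0 \<Phi>p \<Phi>m y =
     (norm2 (2 * n) y)\<^sup>2 - (norm2 (2 * n) (\<lambda>t. y t - xfull n s \<Phi>0 \<Phi>p \<Phi>m y t))\<^sup>2"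

definition r0sq :: "nat \<Rightarrow> nat \<Rightarrow> real \<Rightarrow> real \<Rightarrow> real" where
  "r0sq n s \<sigma> \<delta> = 128 * cstar\<^sup>2 * \<sigma>\<^sup>2 *
     (6 * real s + 3 * real s * ln (real (2 * n + 1))
      + ln (9 * exp 3 * real s) * ln (6 * log 3 (real n / real s) / \<delta>))
     * ln (9 * exp 4 * real s) * log 3 (real n / real s)"

text \<open>X_s: x with f(Delta) x = 0, f(z) = prod_k (1 - w_k z), (Delta x)_t = x_{t-1}.\<close>
definition factor_op :: "complex \<Rightarrow> (int \<Rightarrow> complex) \<Rightarrow> int \<Rightarrow> complex" where
  "factor_op w x t = x t - w * x (t - 1)"

definition in_Xs :: "nat \<Rightarrow> (int \<Rightarrow> complex) \<Rightarrow> bool" where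
  "in_Xs s x \<longleftrightarrow> (\<exists>ws. length ws = s \<and> foldr factor_op ws x = (\<lambda>_. 0))"

definition cgauss_density :: "complex \<Rightarrow> ennreal" where
  "cgauss_density z = ennreal (exp (- (cmod z)\<^sup>2) / pi)"

text \<open>Outer probability bound: the (possibly non-measurable) event is contained in
  a measurable event of probability at most d.\<close>
definition outer_prob_le :: "'a measure \<Rightarrow> ('a \<Rightarrow> bool) \<Rightarrow> real \<Rightarrow> bool" where
  "outer_prob_le M P d \<longleftrightarrow>
     (\<exists>A\<in>sets M. {\<omega>\<in>space M. P \<omega>} \<subseteq> A \<and> measure M A \<le> d)"

end

theory Submission
  imports Defs
begin

text \<open>Every window of \<open>x \<in> X\<^sub>s\<close> lies in a space of dimension at most \<open>s\<close>. Averaging the rows of the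
  orthogonal projection onto that space along diagonals produces a reproducing filter with frequency
  response in \<open>[0, 1]\<close> and \<open>\<ell>\<^sub>1\<close>-norm of order \<open>s\<close>, hence a feasible one. Under the alternative the
  estimate is at least as good on each window as this fixed filter, whose residual is pure noise, so
  only quadratic forms in the noise with deterministic coefficients have to be controlled.

  Under the null hypothesis the statistic on a window is at most \<open>2 Re \<langle>y, \<phi> * y\<rangle>\<close> for a data-dependent
  feasible \<open>\<phi>\<close>. Diagonalising the convolution by a DFT of length \<open>4p + 1\<close> and bounding the response of
  \<open>\<phi>\<close> on the finer grid by Dirichlet kernels makes this linear in the moduli of the spectrum of \<open>\<phi>\<close>. The
  supremum over feasible \<open>\<phi>\<close> is then attained at spectra with \<open>18s\<close> nonzero entries, and a union bound
  over the supports costs only \<open>18 s ln (2n + 1)\<close> in the exponent.\<close>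

section \<open>Discrete Fourier transform and convolution\<close>

text \<open>The noise energy over \<open>4n + 1\<close> points is of order \<sigma>^2 n, which the
  threshold does not dominate when n is large compared with s. It therefore has to cancel instead of
  being estimated: under the null only the gain |y|^2 - |y - \<phi> * y|^2 occurs, and under the
  alternative the residual on a block is compared with the noise energy of that same block, with
  coefficient one. A filter selected from the data admits no tail bound for fixed coefficients.
  Feasibility constrains only the moduli of its spectrum, so the phases are discarded before any
  probability enters. With \<Lambda> = log_3(n/s) there are 2\<Lambda> - 3 blocks. At most three
  events per block and one more, each of probability \<open>exp (- L)\<close>, stay below 6\<Lambda>
  events; this is the 6 under the logarithm in r_0^2. The threshold 5/8 is 7/8 - 1/4: an eighth of
  |x|^2 is given up to the cross term of signal and noise, and a quarter of r_0^2 to the remaining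
  errors.\<close>

definition dchar :: "nat \<Rightarrow> nat \<Rightarrow> int \<Rightarrow> complex" where
  "dchar D j t = cis (2 * pi * real j * real_of_int t / real D)"

text \<open>The number \<open>D\<close> of frequencies is independent of the support length:
  \<open>D = 2p + 1\<close> is the DFT of the constraints up to normalisation,
  \<open>D = 4p + 1\<close> the grid on which convolution is diagonal.\<close>

definition fhat :: "nat \<Rightarrow> nat \<Rightarrow> (int \<Rightarrow> complex) \<Rightarrow> nat \<Rightarrow> complex" where
  "fhat D p u j = (\<Sum>\<tau>\<in>{- int p..int p}. cnj (dchar D j \<tau>) * u \<tau>)"

lemma norm_dchar [simp]: "cmod (dchar D j t) = 1"
  by (simp add: dchar_def)

lemma dchar_diff: "dchar D j (t - u) = dchar D j t * cnj (dchar D j u)"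
  by (simp add: dchar_def cis_mult cis_cnj diff_divide_distrib right_diff_distrib)

lemma dchar_mult_cnj [simp]: "dchar D j t * cnj (dchar D j t) = 1"
  by (simp add: complex_norm_square[symmetric])

lemma sum_dchar:
  assumes "D > 0"
  shows "(\<Sum>j<D. dchar D j t) = (if int D dvd t then of_nat D else 0)"
proof -
  define z where "z = cis (2 * pi * real_of_int t / real D)"
  have pow: "dchar D j t = z ^ j" for j
    unfolding dchar_def z_def Complex.DeMoivre by (simp add: mult_ac)
  have zD: "z ^ D = 1"
    using assms by (simp add: z_def Complex.DeMoivre)
  have z1: "z = 1 \<longleftrightarrow> int D dvd t"
  proof
    assume "z = 1"
    then have "exp (\<i> * complex_of_real (2 * pi * real_of_int t / real D)) = 1"
      by (simp add: z_def cis_conv_exp)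
    then obtain n :: int where "2 * pi * real_of_int t / real D = real_of_int (2 * n) * pi"
      unfolding exp_eq_1 by auto
    then have "real_of_int t = real_of_int (n * int D)"
      using assms by (simp add: field_simps)
    then show "int D dvd t"
      by (metis dvd_triv_right of_int_eq_iff)
  next
    assume "int D dvd t"
    then obtain q where "t = int D * q" by (elim dvdE)
    then have "2 * pi * real_of_int t / real D = 2 * pi * real_of_int q"
      using assms by simp
    then show "z = 1" by (simp only: z_def cis_multiple_2pi[OF Ints_of_int])
  qed
  show ?thesis
    using z1 zD by (cases "z = 1") (simp_all add: pow geometric_sum)
qed

lemma int_dvd_iff_zero:
  assumes "\<bar>d\<bar> < int D"
  shows "int D dvd d \<longleftrightarrow> d = 0"
  using assms dvd_imp_le_int[of d "int D"] by auto

lemma sum_dchar_window: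
  assumes "j < D" "j' < D"
  shows "(\<Sum>t\<in>{c..<c + int D}. dchar D j t * cnj (dchar D j' t)) = (if j = j' then of_nat D else 0)"
proof -
  define d where "d = int j - int j'"
  define w where "w = cis (2 * pi * real_of_int d * real_of_int c / real D)"
  have D: "D > 0" using assms by simp
  have "(\<Sum>t\<in>{c..<c + int D}. dchar D j t * cnj (dchar D j' t))
      = (\<Sum>i<D. dchar D j (c + int i) * cnj (dchar D j' (c + int i)))"
    by (rule sum.reindex_bij_witness[of _ "\<lambda>i. c + int i" "\<lambda>t. nat (t - c)"]) auto
  \<comment> \<open>The kernel is symmetric in time and frequency, so the offset \<open>i\<close>
    becomes a frequency and \<open>sum_dchar\<close> applies. The phase \<open>w\<close> comes from
    starting at \<open>c\<close> and equals 1 when the two frequencies agree.\<close>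
  also have "\<dots> = (\<Sum>i<D. w * dchar D i d)"
    by (intro sum.cong refl)
       (simp add: dchar_def w_def d_def cis_mult cis_cnj diff_divide_distrib[symmetric]
          add_divide_distrib[symmetric] algebra_simps)
  also have "\<dots> = w * (if int D dvd d then of_nat D else 0)"
    by (simp add: sum_distrib_left[symmetric] sum_dchar[OF D])
  also have "int D dvd d \<longleftrightarrow> j = j'"
    using int_dvd_iff_zero[of d D] assms by (auto simp: d_def)
  also have "w * (if j = j' then of_nat D else 0) = (if j = j' then of_nat D else 0)"
    by (simp add: w_def d_def)
  finally show ?thesis .
qed

lemma sum_rotate:
  "(\<Sum>a\<in>A. \<Sum>b\<in>B. \<Sum>c\<in>C. f a b c) = (\<Sum>b\<in>B. \<Sum>c\<in>C. \<Sum>a\<in>A. f a b c)"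
  by (subst sum.swap) (intro sum.cong refl sum.swap)

text \<open>Expanding the square leaves only the diagonal. The kernel is abstract because the
  identity serves both sequences summed over frequencies and combinations of characters summed over
  time.\<close>

lemma parseval_of_orthogonal:
  fixes K :: "'b \<Rightarrow> 'a \<Rightarrow> complex" and N :: nat
  assumes "finite A" "finite B"
    and orth: "\<And>b b'. b \<in> B \<Longrightarrow> b' \<in> B \<Longrightarrow>
      (\<Sum>a\<in>A. K b a * cnj (K b' a)) = (if b = b' then of_nat N else 0)"
  shows "(\<Sum>a\<in>A. (cmod (\<Sum>b\<in>B. g b * K b a))\<^sup>2) = real N * (\<Sum>b\<in>B. (cmod (g b))\<^sup>2)"
proof -
  have "complex_of_real (\<Sum>a\<in>A. (cmod (\<Sum>b\<in>B. g b * K b a))\<^sup>2)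
      = (\<Sum>a\<in>A. (\<Sum>b\<in>B. g b * K b a) * (\<Sum>b'\<in>B. cnj (g b') * cnj (K b' a)))"
    unfolding of_real_sum complex_norm_square cnj_sum complex_cnj_mult ..
  also have "\<dots> = (\<Sum>a\<in>A. \<Sum>b\<in>B. \<Sum>b'\<in>B. g b * cnj (g b') * (K b a * cnj (K b' a)))"
    by (simp add: sum_product mult_ac)
  also have "\<dots> = (\<Sum>b\<in>B. \<Sum>b'\<in>B. \<Sum>a\<in>A. g b * cnj (g b') * (K b a * cnj (K b' a)))"
    by (rule sum_rotate)
  also have "\<dots> = (\<Sum>b\<in>B. \<Sum>b'\<in>B. g b * cnj (g b') * (if b = b' then of_nat N else 0))"
    by (intro sum.cong refl) (simp add: sum_distrib_left[symmetric] orth)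
  also have "\<dots> = (\<Sum>b\<in>B. g b * cnj (g b) * of_nat N)"
    using assms(2) by (simp add: if_distrib[of "(*) _"] sum.delta cong: if_cong)
  also have "\<dots> = complex_of_real (real N * (\<Sum>b\<in>B. (cmod (g b))\<^sup>2))"
    unfolding of_real_mult of_real_sum complex_norm_square by (simp add: sum_distrib_left mult_ac)
  finally show ?thesis
    using of_real_eq_iff by blast
qed

lemma parseval_coeffs:
  assumes "D > 0" "finite W"
    and W: "\<And>t t'. t \<in> W \<Longrightarrow> t' \<in> W \<Longrightarrow> int D dvd t - t' \<Longrightarrow> t = t'"
  shows "(\<Sum>j<D. (cmod (\<Sum>t\<in>W. x t * cnj (dchar D j t)))\<^sup>2) = real D * (\<Sum>t\<in>W. (cmod (x t))\<^sup>2)"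
proof (rule parseval_of_orthogonal)
  fix t t' assume t: "t \<in> W" "t' \<in> W"
  have "(\<Sum>j<D. cnj (dchar D j t) * cnj (cnj (dchar D j t'))) = (\<Sum>j<D. dchar D j (t' - t))"
    by (simp add: dchar_diff mult_ac)
  also have "\<dots> = (if t = t' then of_nat D else 0)"
    using W[OF t(2,1)] by (auto simp: sum_dchar[OF assms(1)])
  finally show "(\<Sum>j<D. cnj (dchar D j t) * cnj (cnj (dchar D j t'))) = (if t = t' then of_nat D else 0)" .
qed (use assms in auto)

lemma parseval_window:
  "(\<Sum>t\<in>{c..<c + int D}. (cmod (\<Sum>j<D. g j * dchar D j t))\<^sup>2) = real D * (\<Sum>j<D. (cmod (g j))\<^sup>2)"
  by (rule parseval_of_orthogonal) (auto simp: sum_dchar_window)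

lemma bessel_window:
  assumes "T \<subseteq> {c..<c + int D}" "D > 0"
  shows "(\<Sum>t\<in>T. (cmod (\<Sum>j<D. g j * (dchar D j t / sqrt (real D))))\<^sup>2) \<le> (\<Sum>j<D. (cmod (g j))\<^sup>2)"
proof -
  have "(\<Sum>t\<in>T. (cmod (\<Sum>j<D. g j * (dchar D j t / sqrt (real D))))\<^sup>2)
      = (\<Sum>t\<in>T. (cmod (\<Sum>j<D. g j * dchar D j t))\<^sup>2) / real D"
    by (simp add: sum_divide_distrib[symmetric] norm_divide power_divide)
  also have "\<dots> \<le> (\<Sum>t\<in>{c..<c + int D}. (cmod (\<Sum>j<D. g j * dchar D j t))\<^sup>2) / real D"
    by (intro divide_right_mono sum_mono2) (use assms in auto)
  also have "\<dots> = (\<Sum>j<D. (cmod (g j))\<^sup>2)"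
    using assms by (simp add: parseval_window)
  finally show ?thesis .
qed

text \<open>Conjugation reduces it to \<open>bessel_window\<close>. In this form it is the
  contraction hypothesis of the noise bounds for the coefficients of a windowed DFT.\<close>

lemma bessel_window_cnj:
  assumes "T \<subseteq> {c..<c + int D}" "D > 0"
  shows "(\<Sum>t\<in>T. (cmod (\<Sum>j<D. g j * (cnj (dchar D j t) / sqrt (real D))))\<^sup>2) \<le> (\<Sum>j<D. (cmod (g j))\<^sup>2)"
proof -
  have "cmod (\<Sum>j<D. g j * (cnj (dchar D j t) / sqrt (real D)))
      = cmod (\<Sum>j<D. cnj (g j) * (dchar D j t / sqrt (real D)))" for t
    using complex_mod_cnj[of "\<Sum>j<D. cnj (g j) * (dchar D j t / sqrt (real D))"] by (simp add: cnj_sum)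
  then show ?thesis using bessel_window[OF assms, of "\<lambda>j. cnj (g j)"] by simp
qed

section \<open>Windowed convolution and its diagonalisation\<close>

lemma conv_finite:
  assumes "supp_in p u"
  shows "conv u v t = (\<Sum>\<tau>\<in>{- int p..int p}. u \<tau> * v (t - \<tau>))"
proof -
  have "conv u v t = infsum (\<lambda>\<tau>. u \<tau> * v (t - \<tau>)) {- int p..int p}"
    unfolding conv_def using assms
    by (intro infsum_cong_neutral) (auto simp: supp_in_def abs_le_iff)
  then show ?thesis by simp
qed

lemma dft_conv_fhat: "dft p u k = complex_of_real (1 / sqrt (real (2 * p + 1))) * fhat (2 * p + 1) p u k"
  by (simp add: dft_def fhat_def dchar_def cis_conv_exp exp_cnj)

text \<open>With this normalisation the transform of a sequence on at most \<open>D\<close>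
  consecutive points is a contraction, so no power of \<open>D\<close> enters the tail
  bounds.\<close>

definition wdft :: "nat \<Rightarrow> int set \<Rightarrow> (int \<Rightarrow> complex) \<Rightarrow> nat \<Rightarrow> complex" where
  "wdft D W v j = (\<Sum>t\<in>W. cnj (dchar D j t) / sqrt (real D) * v t)"

text \<open>On a window of length \<open>2p + 1\<close> the convolution only sees \<open>4p + 1\<close> consecutive samples, so it
  agrees with a circular convolution of that length, which the DFT diagonalises.\<close>
lemma conv_window_spectral:
  assumes "supp_in p u" and D: "D = 4 * p + 1" and t: "t \<in> {h - int p..h + int p}"
  shows "conv u v t = (\<Sum>j<D. fhat D p u j * wdft D {h - 2 * int p..h + 2 * int p} v j * (dchar D j t / sqrt (real D)))"
proof -
  let ?P = "{- int p..int p}" and ?U = "{h - 2 * int p..h + 2 * int p}"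
  have D0: "D > 0" using D by simp
  have sq: "complex_of_real (sqrt (real D)) * complex_of_real (sqrt (real D)) = of_nat D"
    by (metis of_real_mult of_real_of_nat_eq real_sqrt_mult_self abs_of_nat)
  have "(\<Sum>j<D. fhat D p u j * wdft D ?U v j * (dchar D j t / sqrt (real D)))
      = (\<Sum>j<D. \<Sum>\<tau>\<in>?P. \<Sum>w\<in>?U. u \<tau> * v w * dchar D j (t - \<tau> - w) / of_nat D)"
    unfolding fhat_def wdft_def sum_product sum_distrib_right
    by (intro sum.cong refl)
       (simp add: dchar_diff sum_distrib_left sum_distrib_right sum_divide_distrib mult_ac flip: sq)
  also have "\<dots> = (\<Sum>\<tau>\<in>?P. \<Sum>w\<in>?U. \<Sum>j<D. u \<tau> * v w * dchar D j (t - \<tau> - w) / of_nat D)"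
    by (rule sum_rotate)
  also have "\<dots> = (\<Sum>\<tau>\<in>?P. \<Sum>w\<in>?U. u \<tau> * v w * (if int D dvd t - \<tau> - w then 1 else 0))"
    using D0 by (intro sum.cong refl)
      (simp add: sum_distrib_left[symmetric] sum_divide_distrib[symmetric] sum_dchar)
  also have "\<dots> = (\<Sum>\<tau>\<in>?P. \<Sum>w\<in>?U. if w = t - \<tau> then u \<tau> * v w else 0)"
  proof (intro sum.cong refl)
    fix \<tau> w assume "\<tau> \<in> ?P" "w \<in> ?U"
    then have "\<bar>t - \<tau> - w\<bar> < int D" using t D by auto
    then have "int D dvd t - \<tau> - w \<longleftrightarrow> w = t - \<tau>"
      by (auto simp: int_dvd_iff_zero)
    then show "u \<tau> * v w * (if int D dvd t - \<tau> - w then 1 else 0) = (if w = t - \<tau> then u \<tau> * v w else 0)"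
      by simp
  qed
  also have "\<dots> = (\<Sum>\<tau>\<in>?P. u \<tau> * v (t - \<tau>))"
    by (intro sum.cong refl) (use t in \<open>auto simp: sum.delta'\<close>)
  finally show ?thesis using conv_finite[OF assms(1)] by simp
qed

section \<open>Quadratic forms in complex Gaussian noise\<close>

lemma measurable_cgauss_density [measurable]: "cgauss_density \<in> borel_measurable borel"
  unfolding cgauss_density_def by measurable

lemma nn_integral_lborel_translate:
  fixes c :: "'a::euclidean_space"
  assumes [measurable]: "f \<in> borel_measurable borel"
  shows "(\<integral>\<^sup>+x. f (c + x) \<partial>lborel) = (\<integral>\<^sup>+x. f x \<partial>lborel)"
proof -
  have "(\<integral>\<^sup>+x. f x \<partial>lborel) = (\<integral>\<^sup>+x. f x \<partial>(distr lborel borel ((+) c)))"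
    by (simp add: lborel_distr_plus)
  also have "\<dots> = (\<integral>\<^sup>+x. f (c + x) \<partial>lborel)"
    by (subst nn_integral_distr) auto
  finally show ?thesis ..
qed

text \<open>Completing the square moves the centre of the density to \<open>cnj v\<close>. The total
  mass is a hypothesis because it is later read off from the existence of one noise variable with
  this density.\<close>

lemma nn_integral_cgauss_exp_linear:
  assumes norm: "(\<integral>\<^sup>+z. cgauss_density z \<partial>lborel) = 1"
  shows "(\<integral>\<^sup>+z. cgauss_density z * ennreal (exp (2 * Re (v * z))) \<partial>lborel) = ennreal (exp ((cmod v)\<^sup>2))"
proof -
  have "cgauss_density z * ennreal (exp (2 * Re (v * z))) = ennreal (exp ((cmod v)\<^sup>2)) * cgauss_density (- cnj v + z)" for z
  proof -
    have "- (cmod z)\<^sup>2 + 2 * Re (v * z) = (cmod v)\<^sup>2 - (cmod (- cnj v + z))\<^sup>2"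
      by (simp add: cmod_power2) (simp add: power2_eq_square algebra_simps)
    then have "exp (- (cmod z)\<^sup>2) * exp (2 * Re (v * z)) = exp ((cmod v)\<^sup>2) * exp (- (cmod (- cnj v + z))\<^sup>2)"
      by (simp add: mult_exp_exp)
    then show ?thesis
      by (simp add: cgauss_density_def ennreal_mult[symmetric])
  qed
  then show ?thesis
    using nn_integral_lborel_translate[OF measurable_cgauss_density, of "- cnj v"] norm
    by (simp add: nn_integral_cmult)
qed

text \<open>Rescaling the complex plane by \<open>c\<close> multiplies area by c^2, and this factor
  is the value 1/(1 - d).\<close>

lemma nn_integral_cgauss_exp_square:
  assumes norm: "(\<integral>\<^sup>+z. cgauss_density z \<partial>lborel) = 1" and d: "d < 1"
  shows "(\<integral>\<^sup>+z. cgauss_density z * ennreal (exp (d * (cmod z)\<^sup>2)) \<partial>lborel) = ennreal (1 / (1 - d))"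
proof -
  define c where "c = 1 / sqrt (1 - d)"
  have c: "c \<noteq> 0" and c2: "c\<^sup>2 = 1 / (1 - d)"
    using d by (auto simp: c_def power_divide)
  have "(\<integral>\<^sup>+z. cgauss_density z * ennreal (exp (d * (cmod z)\<^sup>2)) \<partial>lborel)
     = (\<integral>\<^sup>+z. ennreal (exp (- ((1 - d) * (cmod z)\<^sup>2)) / pi) \<partial>(lborel :: complex measure))"
    by (intro nn_integral_cong)
       (simp add: cgauss_density_def ennreal_mult[symmetric] mult_exp_exp left_diff_distrib)
  also have "\<dots> = (\<integral>\<^sup>+z. ennreal (c\<^sup>2) * ennreal (exp (- ((1 - d) * (cmod (c *\<^sub>R z))\<^sup>2)) / pi) \<partial>(lborel :: complex measure))"
    by (subst lborel_affine[OF c, of 0]) (simp add: nn_integral_density nn_integral_distr)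
  also have "\<dots> = (\<integral>\<^sup>+z. ennreal (c\<^sup>2) * cgauss_density z \<partial>lborel)"
    using d by (intro nn_integral_cong) (simp add: cgauss_density_def power_mult_distrib c2)
  also have "\<dots> = ennreal (1 / (1 - d))"
    by (simp add: nn_integral_cmult norm c2)
  finally show ?thesis .
qed

locale cgauss_family = prob_space M for M :: "'a measure" +
  fixes \<xi> :: "'a \<Rightarrow> 'b \<Rightarrow> complex" and U :: "'b set"
  assumes finite_U: "finite U" and U_nonempty: "U \<noteq> {}"
    and indep: "indep_vars (\<lambda>_. borel) (\<lambda>t \<omega>. \<xi> \<omega> t) U"
    and dist: "t \<in> U \<Longrightarrow> distributed M lborel (\<lambda>\<omega>. \<xi> \<omega> t) cgauss_density"
begin

lemma cgauss_normalized: "(\<integral>\<^sup>+z. cgauss_density z \<partial>lborel) = 1"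
proof -
  obtain t where "t \<in> U" using U_nonempty by auto
  from distributed_nn_integral[OF dist[OF this], of "\<lambda>_. 1"] show ?thesis
    by (simp add: emeasure_space_1)
qed

lemma measurable_noise: "t \<in> U \<Longrightarrow> (\<lambda>\<omega>. \<xi> \<omega> t) \<in> borel_measurable M"
  using distributed_measurable[OF dist] by simp

lemma nn_integral_exp_linear:
  assumes "T \<subseteq> U"
  shows "(\<integral>\<^sup>+\<omega>. ennreal (exp (2 * Re (\<Sum>t\<in>T. v t * \<xi> \<omega> t))) \<partial>M) = ennreal (exp (\<Sum>t\<in>T. (cmod (v t))\<^sup>2))"
proof -
  have T: "finite T" using assms finite_U finite_subset by auto
  have "(\<integral>\<^sup>+\<omega>. ennreal (exp (2 * Re (\<Sum>t\<in>T. v t * \<xi> \<omega> t))) \<partial>M)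
      = (\<integral>\<^sup>+\<omega>. (\<Prod>t\<in>T. ennreal (exp (2 * Re (v t * \<xi> \<omega> t)))) \<partial>M)"
    using T by (intro nn_integral_cong) (simp add: exp_sum[symmetric] sum_distrib_left prod_ennreal)
  also have "\<dots> = (\<Prod>t\<in>T. \<integral>\<^sup>+\<omega>. ennreal (exp (2 * Re (v t * \<xi> \<omega> t))) \<partial>M)"
  proof (rule indep_vars_nn_integral[OF T])
    show "indep_vars (\<lambda>_. borel) (\<lambda>t \<omega>. ennreal (exp (2 * Re (v t * \<xi> \<omega> t)))) T"
      by (rule indep_vars_compose2[OF indep_vars_subset[OF indep assms], where Y = "\<lambda>t z. ennreal (exp (2 * Re (v t * z)))"]) measurable
  qed simp
  also have "\<dots> = (\<Prod>t\<in>T. ennreal (exp ((cmod (v t))\<^sup>2)))"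
  proof (intro prod.cong refl)
    fix t assume "t \<in> T"
    then have "(\<integral>\<^sup>+\<omega>. ennreal (exp (2 * Re (v t * \<xi> \<omega> t))) \<partial>M)
       = (\<integral>\<^sup>+z. cgauss_density z * ennreal (exp (2 * Re (v t * z))) \<partial>lborel)"
      using assms by (intro distributed_nn_integral[symmetric, OF dist]) auto
    then show "(\<integral>\<^sup>+\<omega>. ennreal (exp (2 * Re (v t * \<xi> \<omega> t))) \<partial>M) = ennreal (exp ((cmod (v t))\<^sup>2))"
      unfolding nn_integral_cgauss_exp_linear[OF cgauss_normalized] .
  qed
  also have "\<dots> = ennreal (exp (\<Sum>t\<in>T. (cmod (v t))\<^sup>2))"
    using T by (simp add: exp_sum prod_ennreal)
  finally show ?thesis .
qed

text \<open>A square in the exponent is the average of linear exponents over an auxiliary Gaussian \<open>g\<close>;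
  integrating the noise out first moves the quadratic form onto \<open>g\<close>, where it is diagonal.\<close>
lemma nn_integral_exp_quadratic:
  fixes d :: "'c \<Rightarrow> real" and F :: "'c \<Rightarrow> 'b \<Rightarrow> complex"
  assumes "T \<subseteq> U" and K: "finite K" and d: "\<And>k. k \<in> K \<Longrightarrow> 0 \<le> d k \<and> d k \<le> 1 / 2"
    and contr: "\<And>c. (\<Sum>t\<in>T. (cmod (\<Sum>k\<in>K. c k * F k t))\<^sup>2) \<le> (\<Sum>k\<in>K. (cmod (c k))\<^sup>2)"
  shows "(\<integral>\<^sup>+\<omega>. ennreal (exp (\<Sum>k\<in>K. d k * (cmod (\<Sum>t\<in>T. F k t * \<xi> \<omega> t))\<^sup>2)) \<partial>M) \<le> ennreal (exp (2 * (\<Sum>k\<in>K. d k)))"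
proof -
  define g where "g = density (lborel :: complex measure) cgauss_density"
  have sets_g [measurable_cong]: "sets g = sets borel" by (simp add: g_def)
  interpret g: prob_space g
    by (rule prob_spaceI) (simp add: g_def emeasure_density cgauss_normalized)
  interpret P: product_sigma_finite "\<lambda>_::'c. g"
    by (rule product_sigma_finite.intro) (rule g.sigma_finite_measure_axioms)
  define G where "G = PiM K (\<lambda>_. g)"
  interpret G: prob_space G
    unfolding G_def by (rule prob_space_PiM) (rule g.prob_space_axioms)
  have T: "finite T" using assms finite_U finite_subset by auto
  have int_g: "(\<integral>\<^sup>+z. f z \<partial>g) = (\<integral>\<^sup>+z. cgauss_density z * f z \<partial>lborel)" if "f \<in> borel_measurable borel" for f
    using that by (simp add: g_def nn_integral_density)
  have [measurable]: "(\<lambda>\<omega>. \<xi> \<omega> t) \<in> borel_measurable M" if "t \<in> T" for t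
    using that assms(1) measurable_noise by auto
  have eval_G: "(\<lambda>x. x k) \<in> G \<rightarrow>\<^sub>M borel" if "k \<in> K" for k
    using measurable_component_singleton[OF that, of "\<lambda>_. g"] unfolding G_def
    by (simp cong: measurable_cong_sets add: sets_g)
  have [measurable]: "(\<lambda>p. fst p k) \<in> G \<Otimes>\<^sub>M M \<rightarrow>\<^sub>M borel" if "k \<in> K" for k
    by (rule measurable_compose[OF measurable_fst eval_G[OF that]])
  define a where "a k \<omega> = (\<Sum>t\<in>T. F k t * \<xi> \<omega> t)" for k \<omega>
  have [measurable]: "a k \<in> borel_measurable M" for k
    unfolding a_def by measurable
  interpret GM: pair_sigma_finite G M ..
  have "(\<integral>\<^sup>+\<omega>. ennreal (exp (\<Sum>k\<in>K. d k * (cmod (a k \<omega>))\<^sup>2)) \<partial>M)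
      = (\<integral>\<^sup>+\<omega>. \<integral>\<^sup>+x. ennreal (exp (2 * Re (\<Sum>k\<in>K. sqrt (d k) * x k * a k \<omega>))) \<partial>G \<partial>M)"
  proof (intro nn_integral_cong)
    fix \<omega>
    have "(\<integral>\<^sup>+x. ennreal (exp (2 * Re (\<Sum>k\<in>K. sqrt (d k) * x k * a k \<omega>))) \<partial>G)
       = (\<integral>\<^sup>+x. (\<Prod>k\<in>K. ennreal (exp (2 * Re (sqrt (d k) * a k \<omega> * x k)))) \<partial>G)"
      using K by (intro nn_integral_cong) (simp add: exp_sum[symmetric] sum_distrib_left prod_ennreal mult_ac)
    also have "\<dots> = (\<Prod>k\<in>K. \<integral>\<^sup>+z. ennreal (exp (2 * Re (sqrt (d k) * a k \<omega> * z))) \<partial>g)"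
      unfolding G_def by (rule P.product_nn_integral_prod[OF K]) measurable
    also have "\<dots> = (\<Prod>k\<in>K. ennreal (exp (d k * (cmod (a k \<omega>))\<^sup>2)))"
      using d by (intro prod.cong refl, subst int_g, measurable)
        (subst nn_integral_cgauss_exp_linear[OF cgauss_normalized], simp add: norm_mult power_mult_distrib)
    also have "\<dots> = ennreal (exp (\<Sum>k\<in>K. d k * (cmod (a k \<omega>))\<^sup>2))"
      using K by (simp add: exp_sum prod_ennreal)
    finally show "ennreal (exp (\<Sum>k\<in>K. d k * (cmod (a k \<omega>))\<^sup>2)) = 
       (\<integral>\<^sup>+x. ennreal (exp (2 * Re (\<Sum>k\<in>K. sqrt (d k) * x k * a k \<omega>))) \<partial>G)" by simp
  qed
  also have "\<dots> = (\<integral>\<^sup>+x. \<integral>\<^sup>+\<omega>. ennreal (exp (2 * Re (\<Sum>k\<in>K. sqrt (d k) * x k * a k \<omega>))) \<partial>M \<partial>G)"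
    by (rule GM.Fubini') (unfold case_prod_beta, measurable)
  also have "\<dots> \<le> (\<integral>\<^sup>+x. (\<Prod>k\<in>K. ennreal (exp (d k * (cmod (x k))\<^sup>2))) \<partial>G)"
  proof (intro nn_integral_mono)
    fix x :: "'c \<Rightarrow> complex"
    \<comment> \<open>For fixed auxiliary values the exponent is linear in the noise, and the
      contraction hypothesis bounds the energy of its coefficients by the diagonal form in
      \<open>x\<close>.\<close>
    have "(\<Sum>k\<in>K. sqrt (d k) * x k * a k \<omega>) = (\<Sum>t\<in>T. (\<Sum>k\<in>K. (sqrt (d k) * x k) * F k t) * \<xi> \<omega> t)" for \<omega>
      unfolding a_def sum_distrib_left sum_distrib_right
      by (subst sum.swap) (simp add: mult_ac)
    then have "(\<integral>\<^sup>+\<omega>. ennreal (exp (2 * Re (\<Sum>k\<in>K. sqrt (d k) * x k * a k \<omega>))) \<partial>M)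
       = ennreal (exp (\<Sum>t\<in>T. (cmod (\<Sum>k\<in>K. (sqrt (d k) * x k) * F k t))\<^sup>2))"
      using nn_integral_exp_linear[OF assms(1), of "\<lambda>t. \<Sum>k\<in>K. (sqrt (d k) * x k) * F k t"] by simp
    also have "\<dots> \<le> ennreal (exp (\<Sum>k\<in>K. (cmod (sqrt (d k) * x k))\<^sup>2))"
      using contr by (intro ennreal_leI) simp
    also have "\<dots> = (\<Prod>k\<in>K. ennreal (exp (d k * (cmod (x k))\<^sup>2)))"
      using K d by (simp add: exp_sum prod_ennreal norm_mult power_mult_distrib)
    finally show "(\<integral>\<^sup>+\<omega>. ennreal (exp (2 * Re (\<Sum>k\<in>K. sqrt (d k) * x k * a k \<omega>))) \<partial>M) \<le> \<dots>" .
  qed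
  also have "\<dots> = (\<Prod>k\<in>K. \<integral>\<^sup>+z. ennreal (exp (d k * (cmod z)\<^sup>2)) \<partial>g)"
    unfolding G_def by (rule P.product_nn_integral_prod[OF K]) measurable
  also have "\<dots> = (\<Prod>k\<in>K. ennreal (1 / (1 - d k)))"
  proof (intro prod.cong refl)
    fix k assume "k \<in> K"
    then have "d k < 1" using d[of k] by simp
    then show "(\<integral>\<^sup>+z. ennreal (exp (d k * (cmod z)\<^sup>2)) \<partial>g) = ennreal (1 / (1 - d k))"
      by (simp add: int_g nn_integral_cgauss_exp_square[OF cgauss_normalized])
  qed
  also have "\<dots> = ennreal (\<Prod>k\<in>K. 1 / (1 - d k))"
    using d by (intro prod_ennreal) force
  also have "\<dots> \<le> ennreal (\<Prod>k\<in>K. exp (2 * d k))"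
  proof (intro ennreal_leI prod_mono conjI)
    fix k assume "k \<in> K"
    then have dk: "0 \<le> d k" "d k \<le> 1 / 2" using d by auto
    then show "0 \<le> 1 / (1 - d k)" by simp
    \<comment> \<open>The cap 1/2 on the weights is spent here: up to it, 1/(1 - d) stays below
      exp(2d).\<close>
    have "0 \<le> d k * (1 - 2 * d k)" using dk by simp
    then have "1 \<le> (1 - d k) * (1 + 2 * d k)" by (simp add: algebra_simps)
    also have "\<dots> \<le> (1 - d k) * exp (2 * d k)"
      using dk by (intro mult_left_mono exp_ge_add_one_self) auto
    finally show "1 / (1 - d k) \<le> exp (2 * d k)"
      using dk by (simp add: divide_le_eq mult.commute)
  qed
  also have "\<dots> = ennreal (exp (2 * (\<Sum>k\<in>K. d k)))"
    using K by (simp add: exp_sum sum_distrib_left)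
  finally show ?thesis unfolding a_def .
qed

definition quad :: "'b set \<Rightarrow> 'c set \<Rightarrow> ('c \<Rightarrow> real) \<Rightarrow> ('c \<Rightarrow> 'b \<Rightarrow> complex) \<Rightarrow> 'a \<Rightarrow> real" where
  "quad T K d F \<omega> = (\<Sum>k\<in>K. d k * (cmod (\<Sum>t\<in>T. F k t * \<xi> \<omega> t))\<^sup>2)"

lemma measurable_quad:
  assumes "T \<subseteq> U"
  shows "quad T K d F \<in> borel_measurable M"
proof -
  have [measurable]: "(\<lambda>\<omega>. \<xi> \<omega> t) \<in> borel_measurable M" if "t \<in> T" for t
    using that assms measurable_noise by auto
  show ?thesis unfolding quad_def[abs_def] by measurable
qed

text \<open>Chernoff bound at the parameter 1/(2\<beta>), which brings all weights below the cap
  1/2. The bound consists of a trace part and a deviation governed by the largest weight alone;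
  hence the later estimates concern sums and maxima of weights.\<close>

lemma quad_tail:
  fixes d :: "'c \<Rightarrow> real" and F :: "'c \<Rightarrow> 'b \<Rightarrow> complex"
  assumes "T \<subseteq> U" and K: "finite K" and \<beta>: "0 < \<beta>" and d: "\<And>k. k \<in> K \<Longrightarrow> 0 \<le> d k \<and> d k \<le> \<beta>"
    and contr: "\<And>c. (\<Sum>t\<in>T. (cmod (\<Sum>k\<in>K. c k * F k t))\<^sup>2) \<le> (\<Sum>k\<in>K. (cmod (c k))\<^sup>2)"
    and B: "2 * (\<Sum>k\<in>K. d k) + 2 * \<beta> * L \<le> B"
  shows "prob {\<omega>\<in>space M. quad T K d F \<omega> \<ge> B} \<le> exp (- L)"
proof -
  note [measurable] = measurable_quad[OF assms(1)]
  have "emeasure M {\<omega>\<in>space M. quad T K d F \<omega> \<ge> B} 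
      \<le> ennreal (exp (- (1 / (2 * \<beta>)) * B)) * (\<integral>\<^sup>+\<omega>. ennreal (exp (1 / (2 * \<beta>) * quad T K d F \<omega>)) * indicator (space M) \<omega> \<partial>M)"
    by (rule Chernoff_ineq_nn_integral_ge) (use \<beta> in auto)
  also have "(\<integral>\<^sup>+\<omega>. ennreal (exp (1 / (2 * \<beta>) * quad T K d F \<omega>)) * indicator (space M) \<omega> \<partial>M)
      = (\<integral>\<^sup>+\<omega>. ennreal (exp (\<Sum>k\<in>K. d k / (2 * \<beta>) * (cmod (\<Sum>t\<in>T. F k t * \<xi> \<omega> t))\<^sup>2)) \<partial>M)"
    by (intro nn_integral_cong) (simp add: quad_def sum_divide_distrib)
  also have "\<dots> \<le> ennreal (exp (2 * (\<Sum>k\<in>K. d k / (2 * \<beta>))))"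
    using d \<beta> by (intro nn_integral_exp_quadratic[OF assms(1) K _ contr]) (auto simp: field_simps)
  also have "ennreal (exp (- (1 / (2 * \<beta>)) * B)) * \<dots> = ennreal (exp (- (1 / (2 * \<beta>)) * B + 2 * (\<Sum>k\<in>K. d k / (2 * \<beta>))))"
    by (simp add: ennreal_mult[symmetric] mult_exp_exp)
  also have "\<dots> \<le> ennreal (exp (- L))"
    using B \<beta> by (intro ennreal_leI) (simp add: sum_divide_distrib[symmetric] field_simps)
  finally show ?thesis
    by (simp add: emeasure_eq_measure mult_left_mono)
qed

end

section \<open>Reproducing filters with small spectrum\<close>

lemma foldr_factor_op_diff:
  "foldr factor_op ws (\<lambda>t. x t - c * z t) = (\<lambda>t. foldr factor_op ws x t - c * foldr factor_op ws z t)"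
  by (induction ws) (auto simp: factor_op_def algebra_simps)

lemma foldr_factor_op_shift:
  "foldr factor_op ws (\<lambda>t. x (t + h)) = (\<lambda>t. foldr factor_op ws x (t + h))"
  by (induction ws) (auto simp: factor_op_def add_diff_eq diff_add_eq fun_eq_iff)

lemma geometric_vanishes:
  fixes r :: "int \<Rightarrow> complex"
  assumes rec: "\<And>t. r t = w * r (t - 1)" and "w \<noteq> 0" and "r t0 = 0"
  shows "r t = 0"
proof (induction t rule: int_induct[of _ t0])
  case (step1 i)
  then show ?case using rec[of "i + 1"] by simp
next
  case (step2 i)
  then show ?case using rec[of i] \<open>w \<noteq> 0\<close> by simp
qed (fact assms)

text \<open>A first-order recursion has a one-dimensional solution space. A nonzero value of
  \<open>z\<close> forces \<open>w\<close> to be nonzero, so the recursion also runs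
  backwards.\<close>

lemma geometric_proportional:
  fixes y z :: "int \<Rightarrow> complex"
  assumes y: "\<And>t. y t = w * y (t - 1)" and z: "\<And>t. z t = w * z (t - 1)" and "z t0 \<noteq> 0"
  shows "y t = y t0 / z t0 * z t"
proof -
  have "w \<noteq> 0" using z[of t0] \<open>z t0 \<noteq> 0\<close> by auto
  define r where "r u = y u - y t0 / z t0 * z u" for u
  have "r u = w * r (u - 1)" for u
    unfolding r_def by (subst y[of u], subst z[of u]) (simp add: algebra_simps)
  moreover have "r t0 = 0" using \<open>z t0 \<noteq> 0\<close> by (simp add: r_def)
  ultimately have "r t = 0" by (rule geometric_vanishes[OF _ \<open>w \<noteq> 0\<close>])
  then show ?thesis by (simp add: r_def)
qed

section \<open>Orthonormal systems and the dimension of the kernel\<close>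

definition ip :: "'t set \<Rightarrow> ('t \<Rightarrow> complex) \<Rightarrow> ('t \<Rightarrow> complex) \<Rightarrow> complex" where
  "ip A f g = (\<Sum>t\<in>A. cnj (f t) * g t)"

lemma ip_diff_right: "ip A f (\<lambda>t. g t - h t) = ip A f g - ip A f h"
  by (simp add: ip_def right_diff_distrib sum_subtractf)

lemma ip_cmult_right: "ip A f (\<lambda>t. c * g t) = c * ip A f g"
  by (simp add: ip_def sum_distrib_left mult_ac)

lemma ip_sum_right: "ip A f (\<lambda>t. \<Sum>i\<in>I. g i t) = (\<Sum>i\<in>I. ip A f (g i))"
  by (simp add: ip_def sum_distrib_left) (rule sum.swap)

lemma cnj_ip: "cnj (ip A f g) = ip A g f"
  by (simp add: ip_def mult.commute)

lemma ip_self: "ip A f f = of_real (\<Sum>t\<in>A. (cmod (f t))\<^sup>2)"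
  unfolding of_real_sum complex_norm_square ip_def by (simp add: mult.commute)

definition orthonormal :: "'t set \<Rightarrow> nat \<Rightarrow> (nat \<Rightarrow> 't \<Rightarrow> complex) \<Rightarrow> bool" where
  "orthonormal A d u \<longleftrightarrow> (\<forall>i<d. \<forall>j<d. ip A (u i) (u j) = (if i = j then 1 else 0))"

definition proj :: "'t set \<Rightarrow> nat \<Rightarrow> (nat \<Rightarrow> 't \<Rightarrow> complex) \<Rightarrow> ('t \<Rightarrow> complex) \<Rightarrow> 't \<Rightarrow> complex" where
  "proj A d u x t = (\<Sum>i<d. ip A (u i) x * u i t)"

lemma ip_proj:
  assumes "orthonormal A d u" "i < d"
  shows "ip A (u i) (proj A d u x) = ip A (u i) x"
proof -
  have "ip A (u i) (proj A d u x) = (\<Sum>j<d. ip A (u j) x * ip A (u i) (u j))"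
    unfolding proj_def[abs_def] ip_sum_right ip_cmult_right ..
  also have "\<dots> = (\<Sum>j<d. if j = i then ip A (u j) x else 0)"
    using assms by (intro sum.cong refl) (auto simp: orthonormal_def)
  finally show ?thesis using assms by simp
qed

lemma bessel:
  assumes "finite A" "orthonormal A d u"
  shows "(\<Sum>i<d. (cmod (ip A (u i) x))\<^sup>2) \<le> (\<Sum>t\<in>A. (cmod (x t))\<^sup>2)"
proof -
  define v where "v t = x t - proj A d u x t" for t
  have uv: "ip A (u i) v = 0" if "i < d" for i
    using ip_proj[OF assms(2) that] by (simp add: v_def[abs_def] ip_diff_right)
  have vx: "ip A v x = ip A v v"
  proof -
    have "ip A v (proj A d u x) = (\<Sum>i<d. ip A (u i) x * ip A v (u i))"
      unfolding proj_def[abs_def] ip_sum_right ip_cmult_right ..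
    also have "\<dots> = 0"
      using uv by (intro sum.neutral) (metis cnj_ip complex_cnj_zero lessThan_iff mult_zero_right)
    finally show ?thesis by (subst (3) v_def[abs_def]) (simp add: ip_diff_right)
  qed
  have "ip A x v = ip A x x - ip A x (proj A d u x)"
    by (simp add: v_def[abs_def] ip_diff_right)
  also have "ip A x (proj A d u x) = (\<Sum>i<d. ip A (u i) x * cnj (ip A (u i) x))"
    unfolding proj_def[abs_def] ip_sum_right ip_cmult_right cnj_ip ..
  also have "\<dots> = of_real (\<Sum>i<d. (cmod (ip A (u i) x))\<^sup>2)"
    unfolding of_real_sum complex_norm_square ..
  finally have "cnj (ip A x v) = of_real ((\<Sum>t\<in>A. (cmod (x t))\<^sup>2) - (\<Sum>i<d. (cmod (ip A (u i) x))\<^sup>2))"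
    by (simp add: ip_self)
  then have "of_real (\<Sum>t\<in>A. (cmod (v t))\<^sup>2) = complex_of_real ((\<Sum>t\<in>A. (cmod (x t))\<^sup>2) - (\<Sum>i<d. (cmod (ip A (u i) x))\<^sup>2))"
    using vx by (simp only: cnj_ip ip_self)
  then have "(\<Sum>t\<in>A. (cmod (v t))\<^sup>2) = (\<Sum>t\<in>A. (cmod (x t))\<^sup>2) - (\<Sum>i<d. (cmod (ip A (u i) x))\<^sup>2)"
    using of_real_eq_iff by blast
  then show ?thesis
    using sum_nonneg[of A "\<lambda>t. (cmod (v t))\<^sup>2"] by simp
qed

text \<open>Each factor raises the dimension by at most one: applying the factors in
  \<open>ws\<close> to a solution leaves a geometric sequence, so subtracting a multiple of one
  fixed solution lands in the kernel of \<open>ws\<close>. No basis of exponential polynomials is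
  written down, so repeated and zero roots are covered uniformly.\<close>

lemma kernel_orthonormal_basis:
  assumes A: "finite A"
  shows "\<exists>d u. d \<le> length ws \<and> orthonormal A d u \<and>
     (\<forall>x. foldr factor_op ws x = (\<lambda>_. 0) \<longrightarrow> (\<forall>t\<in>A. x t = proj A d u x t))"
proof (induction ws)
  case Nil
  show ?case
    by (intro exI[of _ 0] exI[of _ "\<lambda>_ _. 0"]) (simp add: orthonormal_def proj_def)
next
  case (Cons w ws)
  then obtain d u where d: "d \<le> length ws" and on: "orthonormal A d u"
    and rep: "\<And>x t. foldr factor_op ws x = (\<lambda>_. 0) \<Longrightarrow> t \<in> A \<Longrightarrow> x t = proj A d u x t"
    by blast
  show ?case
  proof (cases "\<forall>x. foldr factor_op (w # ws) x = (\<lambda>_. 0) \<longrightarrow> (\<forall>t\<in>A. x t = proj A d u x t)")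
    case True
    then show ?thesis using d on by (intro exI[of _ d] exI[of _ u]) auto
  next
    case False
    then obtain z t0 where z: "foldr factor_op (w # ws) z = (\<lambda>_. 0)" and t0: "t0 \<in> A" "z t0 \<noteq> proj A d u z t0"
      by blast
    \<comment> \<open>Gram-Schmidt: the part of the missed solution \<open>z\<close> orthogonal to
      the old system becomes, after normalisation, the new basis vector.\<close>
    define v where "v t = z t - proj A d u z t" for t
    define n where "n = (\<Sum>t\<in>A. (cmod (v t))\<^sup>2)"
    have "0 < n"
      unfolding n_def by (rule sum_pos2[OF A t0(1)]) (use t0 in \<open>auto simp: v_def\<close>)
    have uv: "ip A (u i) v = 0" if "i < d" for i
      using ip_proj[OF on that] by (simp add: v_def[abs_def] ip_diff_right)
    have vu: "ip A v (u i) = 0" if "i < d" for i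
      using uv[OF that] by (metis cnj_ip complex_cnj_zero)
    have vproj: "ip A v (proj A d u x) = 0" for x
      unfolding proj_def[abs_def] ip_sum_right ip_cmult_right using vu by simp
    define u' where "u' i = (if i = d then (\<lambda>t. v t / sqrt n) else u i)" for i
    have ip_d: "ip A (u' d) x = ip A v x / sqrt n" for x
      by (simp add: u'_def ip_def sum_divide_distrib)
    have sq: "complex_of_real (sqrt n) * complex_of_real (sqrt n) = of_real n"
      using \<open>0 < n\<close> by (simp flip: of_real_mult)
    have on': "orthonormal A (Suc d) u'"
      unfolding orthonormal_def
    proof (intro allI impI)
      fix i j assume "i < Suc d" "j < Suc d"
      then consider "i < d" "j < d" | "i = d" "j < d" | "i < d" "j = d" | "i = d" "j = d" by linarith
      then show "ip A (u' i) (u' j) = (if i = j then 1 else 0)"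
      proof cases
        case 1 then show ?thesis using on by (simp add: u'_def orthonormal_def)
      next
        case 2 then show ?thesis using vu by (simp add: ip_d) (simp add: u'_def)
      next
        case 3
        then have "ip A (u' j) (u' i) = 0" using vu by (simp add: ip_d) (simp add: u'_def)
        then show ?thesis using 3 by (metis cnj_ip complex_cnj_zero less_irrefl)
      next
        case 4
        have "ip A v v = of_real n" by (simp add: ip_self n_def)
        then have "ip A v (u' d) = of_real n / sqrt n"
          using ip_cmult_right[of A v "1 / complex_of_real (sqrt n)" v] by (simp add: u'_def)
        then show ?thesis using 4 \<open>0 < n\<close> by (simp add: ip_d sq)
      qed
    qed
    have "x t = proj A (Suc d) u' x t" if x: "foldr factor_op (w # ws) x = (\<lambda>_. 0)" and t: "t \<in> A" for x t
    proof -
      let ?y = "foldr factor_op ws x" and ?yz = "foldr factor_op ws z"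
      have yr: "?y t = w * ?y (t - 1)" and yzr: "?yz t = w * ?yz (t - 1)" for t
        using fun_cong[OF x, of t] fun_cong[OF z, of t] by (auto simp: factor_op_def)
      \<comment> \<open>If this sequence vanished, \<open>z\<close> would lie in the kernel of
        \<open>ws\<close> and the induction hypothesis would reproduce it at
        \<open>t0\<close>.\<close>
      obtain t1 where t1: "?yz t1 \<noteq> 0" using rep[of z t0] t0 by blast
      define c where "c = ?y t1 / ?yz t1"
      have "foldr factor_op ws (\<lambda>t. x t - c * z t) = (\<lambda>_. 0)"
        unfolding foldr_factor_op_diff c_def
        using geometric_proportional[of ?y w ?yz, OF yr yzr t1] by (metis (no_types, opaque_lifting) diff_self)
      from rep[OF this] have xe: "x t = c * v t + proj A d u x t" if "t \<in> A" for t
        using that by (simp add: proj_def ip_diff_right ip_cmult_right left_diff_distrib sum_subtractf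
            v_def right_diff_distrib sum_distrib_left mult_ac algebra_simps)
      have "ip A v x = ip A v (\<lambda>t. c * v t - - 1 * proj A d u x t)"
        unfolding ip_def by (intro sum.cong refl) (simp add: xe)
      also have "\<dots> = c * of_real n"
        unfolding ip_diff_right ip_cmult_right vproj by (simp add: ip_self n_def)
      finally have "ip A (u' d) x * u' d t = c * v t"
        using \<open>0 < n\<close> by (simp only: ip_d) (simp add: u'_def sq)
      moreover have "proj A (Suc d) u' x t = proj A d u x t + ip A (u' d) x * u' d t"
        by (simp add: proj_def u'_def)
      ultimately show ?thesis using xe[OF t] by simp
    qed
    then show ?thesis using d on' by (intro exI[of _ "Suc d"] exI[of _ u']) auto
  qed
qed

lemma sum_window_reflect:
  fixes F :: "int \<Rightarrow> complex"
  assumes "t \<in> {0..int p}" "\<And>t'. t' \<notin> {0..int p} \<Longrightarrow> F t' = 0"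
  shows "(\<Sum>\<tau>\<in>{- int p..int p}. F (t - \<tau>)) = (\<Sum>t'\<in>{0..int p}. F t')"
proof -
  have "(\<Sum>\<tau>\<in>{- int p..int p}. F (t - \<tau>)) = (\<Sum>t'\<in>{t - int p..t + int p}. F t')"
    by (rule sum.reindex_bij_witness[of _ "\<lambda>t'. t - t'" "\<lambda>\<tau>. t - \<tau>"]) auto
  also have "\<dots> = (\<Sum>t'\<in>{0..int p}. F t')"
    by (rule sum.mono_neutral_right) (use assms in auto)
  finally show ?thesis .
qed

text \<open>Averaging the rows of the orthogonal projection \<open>\<Pi>\<close> onto the restrictions of the kernel to
  a window of length \<open>m = p + 1\<close> along diagonals gives a filter with frequency response
  \<open>\<langle>e, \<Pi> e\<rangle> / m\<close>, \<open>e\<close> being the sampled exponential: it lies in \<open>[0, 1]\<close>, and its mean over the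
  frequencies is the trace of \<open>\<Pi>\<close> divided by \<open>m\<close>.\<close>
lemma reproducing_filter:
  fixes ws :: "complex list" and p :: nat
  shows "\<exists>\<phi>. supp_in p \<phi> \<and> (\<forall>x t. foldr factor_op ws x = (\<lambda>_. 0) \<longrightarrow> conv \<phi> x t = x t) \<and>
    (\<forall>D j. cmod (fhat D p \<phi> j) \<le> 1) \<and>
    (\<forall>D. p < D \<longrightarrow> (\<Sum>j<D. cmod (fhat D p \<phi> j)) \<le> real D * real (length ws) / real (p + 1))"
proof -
  let ?A = "{0..int p}" and ?P = "{- int p..int p}"
  obtain d u where d: "d \<le> length ws" and on: "orthonormal ?A d u"
    and rep: "\<And>x t. foldr factor_op ws x = (\<lambda>_. 0) \<Longrightarrow> t \<in> ?A \<Longrightarrow> x t = proj ?A d u x t"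
    using kernel_orthonormal_basis[of ?A ws] by auto
  \<comment> \<open>Zero extension pads the shorter diagonals of the projection matrix, so that all
    of them are summed over the same range.\<close>
  define e where "e i t = (if t \<in> ?A then u i t else 0)" for i t
  have ip_e: "ip ?A (e i) x = ip ?A (u i) x" for i x
    by (simp add: ip_def e_def)
  define m where "m = real (p + 1)"
  have m: "m > 0" by (simp add: m_def)
  define \<phi> where "\<phi> \<tau> = (\<Sum>i<d. \<Sum>t\<in>?A. e i t * cnj (e i (t - \<tau>))) / of_real m" for \<tau>
  have supp: "supp_in p \<phi>"
    unfolding supp_in_def \<phi>_def by (auto simp: e_def intro!: sum.neutral)
  have conv: "conv \<phi> x t = x t" if x: "foldr factor_op ws x = (\<lambda>_. 0)" for x t
  proof -
    have "conv \<phi> x t = (\<Sum>\<tau>\<in>?P. \<Sum>i<d. \<Sum>r\<in>?A. e i r * cnj (e i (r - \<tau>)) * x (t - \<tau>)) / of_real m"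
      by (simp add: conv_finite[OF supp] \<phi>_def sum_distrib_right sum_divide_distrib)
    also have "(\<Sum>\<tau>\<in>?P. \<Sum>i<d. \<Sum>r\<in>?A. e i r * cnj (e i (r - \<tau>)) * x (t - \<tau>))
        = (\<Sum>i<d. \<Sum>r\<in>?A. \<Sum>\<tau>\<in>?P. e i r * cnj (e i (r - \<tau>)) * x (t - \<tau>))"
      by (rule sum_rotate)
    also have "\<dots> = (\<Sum>i<d. \<Sum>r\<in>?A. e i r * ip ?A (u i) (\<lambda>t'. x (t' + (t - r))))"
    proof (intro sum.cong refl)
      fix i r assume r: "r \<in> ?A"
      have "(\<Sum>\<tau>\<in>?P. cnj (e i (r - \<tau>)) * x (r - \<tau> + (t - r))) = (\<Sum>t'\<in>?A. cnj (e i t') * x (t' + (t - r)))"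
        by (rule sum_window_reflect[OF r]) (auto simp: e_def)
      then show "(\<Sum>\<tau>\<in>?P. e i r * cnj (e i (r - \<tau>)) * x (t - \<tau>)) = e i r * ip ?A (u i) (\<lambda>t'. x (t' + (t - r)))"
        unfolding ip_e[symmetric] by (simp add: ip_def sum_distrib_left[symmetric] mult.assoc)
    qed
    also have "\<dots> = (\<Sum>r\<in>?A. proj ?A d u (\<lambda>t'. x (t' + (t - r))) r)"
      by (subst sum.swap) (simp add: proj_def e_def mult.commute)
    \<comment> \<open>Translates of \<open>x\<close> stay in the kernel, so every row
      \<open>r\<close> of the projection returns the same value \<open>x t\<close>; the
      \<open>p + 1\<close> copies cancel the normalisation.\<close>
    also have "\<dots> = (\<Sum>r\<in>?A. x t)"
    proof (intro sum.cong refl)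
      fix r assume "r \<in> ?A"
      then show "proj ?A d u (\<lambda>t'. x (t' + (t - r))) r = x t"
        using rep[of "\<lambda>t'. x (t' + (t - r))" r] x by (simp add: foldr_factor_op_shift)
    qed
    also have "\<dots> = of_real m * x t" by (simp add: m_def)
    finally show ?thesis using m by simp
  qed
  have fh: "fhat D p \<phi> j = of_real ((\<Sum>i<d. (cmod (ip ?A (u i) (dchar D j)))\<^sup>2) / m)" for D j
  proof -
    have "fhat D p \<phi> j = (\<Sum>\<tau>\<in>?P. \<Sum>i<d. \<Sum>r\<in>?A. e i r * cnj (e i (r - \<tau>)) * cnj (dchar D j \<tau>)) / of_real m"
      by (simp add: fhat_def \<phi>_def sum_distrib_left sum_divide_distrib mult_ac)
    also have "(\<Sum>\<tau>\<in>?P. \<Sum>i<d. \<Sum>r\<in>?A. e i r * cnj (e i (r - \<tau>)) * cnj (dchar D j \<tau>))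
        = (\<Sum>i<d. \<Sum>r\<in>?A. \<Sum>\<tau>\<in>?P. e i r * cnj (e i (r - \<tau>)) * cnj (dchar D j \<tau>))"
      by (rule sum_rotate)
    also have "\<dots> = (\<Sum>i<d. \<Sum>r\<in>?A. cnj (dchar D j r) * e i r * ip ?A (u i) (dchar D j))"
    proof (intro sum.cong refl)
      fix i r assume r: "r \<in> ?A"
      have reflect: "(\<Sum>\<tau>\<in>?P. cnj (e i (r - \<tau>)) * dchar D j (r - \<tau>)) = (\<Sum>t'\<in>?A. cnj (e i t') * dchar D j t')"
        by (rule sum_window_reflect[OF r]) (auto simp: e_def)
      have shift: "cnj (dchar D j \<tau>) = cnj (dchar D j r) * dchar D j (r - \<tau>)" for \<tau>
        by (simp add: dchar_diff mult.assoc[symmetric] mult.commute[of "cnj _"])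
      have "(\<Sum>\<tau>\<in>?P. e i r * cnj (e i (r - \<tau>)) * cnj (dchar D j \<tau>))
          = (\<Sum>\<tau>\<in>?P. (cnj (dchar D j r) * e i r) * (cnj (e i (r - \<tau>)) * dchar D j (r - \<tau>)))"
        by (intro sum.cong refl, subst shift) (simp only: mult_ac)
      also have "\<dots> = cnj (dchar D j r) * e i r * (\<Sum>\<tau>\<in>?P. cnj (e i (r - \<tau>)) * dchar D j (r - \<tau>))"
        by (simp only: sum_distrib_left)
      also have "\<dots> = cnj (dchar D j r) * e i r * ip ?A (u i) (dchar D j)"
        unfolding reflect by (simp only: ip_e[symmetric]) (simp only: ip_def)
      finally show "(\<Sum>\<tau>\<in>?P. e i r * cnj (e i (r - \<tau>)) * cnj (dchar D j \<tau>))
          = cnj (dchar D j r) * e i r * ip ?A (u i) (dchar D j)" .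
    qed
    also have "\<dots> = (\<Sum>i<d. ip ?A (dchar D j) (u i) * ip ?A (u i) (dchar D j))"
      by (simp add: ip_def[of _ "dchar D j"] sum_distrib_right e_def)
    also have "\<dots> = (\<Sum>i<d. ip ?A (u i) (dchar D j) * cnj (ip ?A (u i) (dchar D j)))"
      by (simp add: cnj_ip mult.commute)
    also have "\<dots> = of_real (\<Sum>i<d. (cmod (ip ?A (u i) (dchar D j)))\<^sup>2)"
      unfolding of_real_sum complex_norm_square ..
    finally show ?thesis by simp
  qed
  have cm: "cmod (fhat D p \<phi> j) = (\<Sum>i<d. (cmod (ip ?A (u i) (dchar D j)))\<^sup>2) / m" for D j
    unfolding fh norm_of_real using m by (simp add: sum_nonneg)
  have "cmod (fhat D p \<phi> j) \<le> 1" for D j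
    using bessel[OF _ on, of "dchar D j"] m by (simp add: cm m_def)
  moreover have "(\<Sum>j<D. cmod (fhat D p \<phi> j)) \<le> real D * real (length ws) / real (p + 1)" if "p < D" for D
  proof -
    \<comment> \<open>By Parseval each unit vector of the basis contributes exactly
      \<open>D\<close>, so the total counts the dimension \<open>d\<close>.\<close>
    have "(\<Sum>j<D. (cmod (ip ?A (u i) (dchar D j)))\<^sup>2) = real D" if "i < d" for i
    proof -
      have noncong: "t = t'" if "t \<in> ?A" "t' \<in> ?A" "int D dvd t - t'" for t t'
        using that int_dvd_iff_zero[of "t - t'" D] \<open>p < D\<close> by auto
      have "cmod (ip ?A (u i) (dchar D j)) = cmod (\<Sum>t\<in>?A. u i t * cnj (dchar D j t))" for j
        using complex_mod_cnj[of "ip ?A (u i) (dchar D j)"] by (simp add: cnj_ip) (simp add: ip_def mult.commute)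
      then have "(\<Sum>j<D. (cmod (ip ?A (u i) (dchar D j)))\<^sup>2) = real D * (\<Sum>t\<in>?A. (cmod (u i t))\<^sup>2)"
        using parseval_coeffs[of D ?A "u i"] noncong \<open>p < D\<close> by simp
      moreover have "complex_of_real (\<Sum>t\<in>?A. (cmod (u i t))\<^sup>2) = of_real 1"
        using on that ip_self[of ?A "u i"] by (simp add: orthonormal_def)
      ultimately show ?thesis by (metis mult.right_neutral of_real_eq_iff)
    qed
    then have "(\<Sum>j<D. cmod (fhat D p \<phi> j)) = real d * real D / m"
      by (simp add: cm sum_divide_distrib[symmetric]) (subst sum.swap, simp)
    also have "\<dots> \<le> real D * real (length ws) / real (p + 1)"
      unfolding m_def using d by (intro divide_right_mono) (simp_all add: mult.commute mult_left_mono)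
    finally show ?thesis .
  qed
  ultimately show ?thesis using supp conv by blast
qed

lemma cstar_ge: "cstar \<ge> 6"
  by (simp add: cstar_def)

lemma feasible_if_spectrum_le:
  assumes "supp_in p \<phi>" "s \<ge> 1" "\<And>j. cmod (fhat (2 * p + 1) p \<phi> j) \<le> 1"
    and "(\<Sum>j<2 * p + 1. cmod (fhat (2 * p + 1) p \<phi> j)) \<le> 2 * real s"
  shows "feasible s p \<phi>"
proof -
  let ?N = "real (2 * p + 1)"
  have cm: "cmod (dft p \<phi> k) = cmod (fhat (2 * p + 1) p \<phi> k) / sqrt ?N" for k
    unfolding dft_conv_fhat by (simp add: norm_mult norm_divide)
  have "{0..2 * p} = {..<2 * p + 1}" by auto
  then have "dft_l1 p \<phi> \<le> 2 * real s / sqrt ?N"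
    using assms(4) by (simp add: dft_l1_def cm sum_divide_distrib[symmetric] divide_right_mono)
  also have "\<dots> \<le> 18 * cstar * real s / sqrt ?N"
    using cstar_ge by (intro divide_right_mono mult_right_mono) auto
  finally have l1: "dft_l1 p \<phi> \<le> 18 * cstar * real s / sqrt ?N" .
  have "dft_linf p \<phi> \<le> 1 / sqrt ?N"
    unfolding dft_linf_def cm using assms(3) by (subst Max_le_iff) (auto intro!: divide_right_mono)
  then have "18 * real s * dft_linf p \<phi> \<le> 18 * real s * (1 / sqrt ?N)"
    by (intro mult_left_mono) auto
  also have "\<dots> \<le> 18 * cstar * real s / sqrt ?N"
    using cstar_ge assms(2) by (simp add: divide_right_mono)
  finally show ?thesis
    using l1 assms(1) by (simp add: feasible_def)
qed

text \<open>Feasibility is tested on \<open>2p + 1\<close> frequencies, the noise is analysed on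
  \<open>4p + 1\<close>. On a grid of size \<open>D\<close> the spectral sum is at most
  \<open>D s / (p + 1)\<close>, hence at most \<open>2s\<close> and \<open>4s\<close>.\<close>

lemma feasible_reproducing_filter:
  assumes "in_Xs s x" "s \<ge> 1"
  obtains \<phi> where "feasible s p \<phi>" "\<And>t. conv \<phi> x t = x t"
    "\<And>j. cmod (fhat (4 * p + 1) p \<phi> j) \<le> 1"
    "(\<Sum>j<4 * p + 1. cmod (fhat (4 * p + 1) p \<phi> j)) \<le> 4 * real s"
proof -
  obtain ws where ws: "length ws = s" "foldr factor_op ws x = (\<lambda>_. 0)"
    using assms(1) by (auto simp: in_Xs_def)
  obtain \<phi> where \<phi>: "supp_in p \<phi>" "\<And>t. conv \<phi> x t = x t" "\<And>D j. cmod (fhat D p \<phi> j) \<le> 1"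
    "\<And>D. p < D \<Longrightarrow> (\<Sum>j<D. cmod (fhat D p \<phi> j)) \<le> real D * real s / real (p + 1)"
    using reproducing_filter[of p ws] ws by blast
  have bd: "(\<Sum>j<D. cmod (fhat D p \<phi> j)) \<le> real c * real s" if "p < D" "D \<le> c * (p + 1)" for D c
  proof -
    have "real D \<le> real (c * (p + 1))" using that(2) by (simp only: of_nat_le_iff)
    then have "real D \<le> real c * real (p + 1)" by (simp only: of_nat_mult)
    then have "real D * real s \<le> real c * real (p + 1) * real s" by (rule mult_right_mono) simp
    then have "real D * real s / real (p + 1) \<le> real c * real s"
      by (simp add: divide_le_eq mult_ac)
    then show ?thesis using \<phi>(4)[OF that(1)] by linarith
  qed
  show ?thesis
  proof
    show "feasible s p \<phi>"
      using bd[of "2 * p + 1" 2] \<phi> assms(2) by (intro feasible_if_spectrum_le) auto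
    show "(\<Sum>j<4 * p + 1. cmod (fhat (4 * p + 1) p \<phi> j)) \<le> 4 * real s"
      using bd[of "4 * p + 1" 4] by simp
  qed (use \<phi> in auto)
qed

section \<open>Dirichlet kernels\<close>

text \<open>Jordan's inequality has an extra factor 2 on the left. The constant 1 follows from the
  cubic Taylor bound and 3 < pi < 4.\<close>

lemma abs_sin_pi_ge:
  assumes "\<bar>x\<bar> \<le> 1 / 2"
  shows "\<bar>x\<bar> \<le> \<bar>sin (pi * x)\<bar>"
proof -
  define y where "y = pi * \<bar>x\<bar>"
  have y0: "0 \<le> y" by (simp add: y_def)
  have "y \<le> 2" using assms pi_less_4 unfolding y_def
    by (intro order_trans[OF mult_mono[of pi 4 "\<bar>x\<bar>" "1/2"]]) auto
  then have y2: "y\<^sup>2 \<le> 4" using power_mono[of y 2 2] y0 by simp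
  have "(\<Sum>m<3. sin_coeff m * y ^ m) = y"
    by (simp add: eval_nat_numeral sin_coeff_def)
  then have "\<bar>sin y - y\<bar> \<le> y ^ 3 / 6"
    using Maclaurin_sin_bound[of y 3] y0 by (simp add: eval_nat_numeral field_simps)
  moreover have "y ^ 3 \<le> y * 4"
    using mult_left_mono[OF y2 y0] by (simp add: power3_eq_cube power2_eq_square mult.assoc)
  ultimately have "sin y \<ge> y / 3" by linarith
  moreover have "3 * \<bar>x\<bar> \<le> y" unfolding y_def using pi_gt3 by (intro mult_right_mono) auto
  ultimately have "\<bar>x\<bar> \<le> sin y" by linarith
  moreover have "\<bar>sin y\<bar> = \<bar>sin (pi * x)\<bar>"
    by (cases "x \<ge> 0") (auto simp: y_def)
  ultimately show ?thesis by simp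
qed

definition dirich :: "nat \<Rightarrow> real \<Rightarrow> complex" where
  "dirich p x = (\<Sum>\<tau>\<in>{- int p..int p}. cis (2 * pi * x * real_of_int \<tau>))"

lemma dirich_add_int: "dirich p (x + of_int n) = dirich p x"
proof -
  have "cis (2 * pi * (x + of_int n) * real_of_int \<tau>) = cis (2 * pi * x * real_of_int \<tau>)" for \<tau>
  proof -
    have "2 * pi * (x + of_int n) * real_of_int \<tau> = 2 * pi * x * real_of_int \<tau> + 2 * pi * real_of_int (n * \<tau>)"
      by (simp add: algebra_simps)
    then show ?thesis by (simp only: cis_mult[symmetric] cis_multiple_2pi[OF Ints_of_int] mult_1_right)
  qed
  then show ?thesis by (simp add: dirich_def)
qed

lemma dirich_minus: "dirich p (- x) = dirich p x"
  unfolding dirich_def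
  by (rule sum.reindex_bij_witness[of _ uminus uminus]) auto

lemma norm_dirich_le: "cmod (dirich p x) \<le> real (2 * p + 1)"
  unfolding dirich_def by (rule order_trans[OF norm_sum]) simp

text \<open>The closed form sin((2p + 1) pi x) / sin(pi x) of the kernel, multiplied out so that it
  also holds at integers.\<close>

lemma dirich_telescope:
  "dirich p x * (cis (pi * x) - cis (- (pi * x))) = cis (pi * x * real (2 * p + 1)) - cis (- (pi * x * real (2 * p + 1)))"
proof -
  have split: "{- int (Suc p)..int (Suc p)} = insert (int (Suc p)) (insert (- int (Suc p)) {- int p..int p})" for p
    by auto
  show ?thesis
  proof (induction p)
    case 0
    then show ?case by (simp add: dirich_def)
  next
    case (Suc p)
    have "dirich (Suc p) x = cis (2 * pi * x * real (Suc p)) + cis (- (2 * pi * x * real (Suc p))) + dirich p x"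
      unfolding dirich_def split by (subst sum.insert; simp add: algebra_simps)+
    then show ?case
      by (simp add: distrib_right Suc.IH) (simp add: right_diff_distrib cis_mult algebra_simps)
  qed
qed

lemma norm_dirich_le_inverse:
  assumes "\<bar>x\<bar> \<le> 1 / 2" "x \<noteq> 0"
  shows "cmod (dirich p x) \<le> 1 / \<bar>x\<bar>"
proof -
  have "cmod (cis (pi * x) - cis (- (pi * x))) = 2 * \<bar>sin (pi * x)\<bar>"
  proof -
    have "cis (pi * x) - cis (- (pi * x)) = 2 * \<i> * of_real (sin (pi * x))"
      by (simp add: complex_eq_iff)
    then show ?thesis by (simp add: norm_mult)
  qed
  then have "cmod (dirich p x) * (2 * \<bar>sin (pi * x)\<bar>) = cmod (cis (pi * x * real (2 * p + 1)) - cis (- (pi * x * real (2 * p + 1))))"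
    by (metis dirich_telescope norm_mult)
  also have "\<dots> \<le> 2"
    by (rule order_trans[OF norm_triangle_ineq4]) simp
  finally have "cmod (dirich p x) * \<bar>sin (pi * x)\<bar> \<le> 1" by simp
  moreover have "cmod (dirich p x) * \<bar>x\<bar> \<le> cmod (dirich p x) * \<bar>sin (pi * x)\<bar>"
    using abs_sin_pi_ge[OF assms(1)] by (intro mult_left_mono) auto
  ultimately show ?thesis using assms(2) by (simp add: field_simps)
qed

section \<open>Sums over sparse frequency sets\<close>

lemma sum_antimono_le_initial:
  fixes f :: "nat \<Rightarrow> real"
  assumes "antimono f" "finite T" "card T \<le> m" "\<And>i. 0 \<le> f i"
  shows "sum f T \<le> (\<Sum>i<m. f i)"
  using assms(2,3)
proof (induction m arbitrary: T)
  case 0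
  then show ?case by simp
next
  case (Suc m)
  show ?case
  proof (cases "T \<subseteq> {..<m}")
    case True
    then have "sum f T \<le> (\<Sum>i<m. f i)" using assms(4) by (intro sum_mono2) auto
    then show ?thesis using assms(4)[of m] by simp
  next
    case False
    then obtain x where x: "x \<in> T" "m \<le> x" by (meson lessThan_iff linorder_not_less subsetI)
    have "sum f (T - {x}) \<le> (\<Sum>i<m. f i)" using Suc.prems x by (intro Suc.IH) auto
    moreover have "f x \<le> f m" using assms(1) x by (simp add: antimono_def)
    ultimately show ?thesis using Suc.prems x by (simp add: sum.remove[of T x])
  qed
qed

text \<open>A harmonic sum in which the index 0 counts as 1, hence the constant 2. The induction
  includes the term \<open>i = m\<close>, and each increment is compared with a difference of
  logarithms.\<close>

lemma sum_inverse_le_ln: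
  assumes "m \<ge> 1"
  shows "(\<Sum>i<m. 1 / real (max 1 i)) \<le> 2 + ln (real m)"
proof -
  have "(\<Sum>i<Suc m. 1 / real (max 1 i)) \<le> 2 + ln (real m)"
    using assms
  proof (induction m rule: nat_induct_at_least)
    case base
    then show ?case by (simp add: numeral_2_eq_2)
  next
    case (Suc m)
    have "ln (real m / real (Suc m)) \<le> real m / real (Suc m) - 1"
      using Suc by (intro ln_le_minus_one) auto
    also have "\<dots> = - 1 / real (Suc m)" by (simp add: field_simps)
    finally have "1 / real (Suc m) \<le> ln (real (Suc m)) - ln (real m)"
      using Suc by (simp add: ln_div)
    moreover have "(\<Sum>i<Suc (Suc m). 1 / real (max 1 i)) = (\<Sum>i<Suc m. 1 / real (max 1 i)) + 1 / real (Suc m)"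
      by (simp add: max_def)
    ultimately show ?case using Suc.IH by linarith
  qed
  moreover have "(\<Sum>i<m. 1 / real (max 1 i)) \<le> (\<Sum>i<Suc m. 1 / real (max 1 i))" by simp
  ultimately show ?thesis by linarith
qed

text \<open>The points \<open>k / M - \<alpha>\<close> have distinct integer parts once centred modulo 1 and scaled by \<open>M\<close>,
  so at most two of them have distance from the integers between \<open>i / M\<close> and \<open>(i + 1) / M\<close>.\<close>
lemma sum_periodic_le_ln:
  fixes g :: "real \<Rightarrow> real"
  assumes S: "S \<subseteq> {..<M}" "card S \<le> m" "m \<ge> 1" and C: "C \<ge> 1"
    and per: "\<And>x n. g (x + of_int n) = g x" and g1: "\<And>x. g x \<le> 1"
    and gC: "\<And>x. \<bar>x\<bar> \<le> 1 / 2 \<Longrightarrow> x \<noteq> 0 \<Longrightarrow> g x \<le> C / (real M * \<bar>x\<bar>)"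
  shows "(\<Sum>k\<in>S. g (real k / real M - \<alpha>)) \<le> 2 * C * (2 + ln (real m))"
proof -
  have finS: "finite S" using S finite_subset by auto
  define z where "z k = round (real k / real M - \<alpha>)" for k
  define x where "x k = real k / real M - \<alpha> - of_int (z k)" for k
  define \<iota> where "\<iota> k = \<lfloor>real M * x k\<rfloor>" for k
  define f where "f i = C / real (max 1 i)" for i :: nat
  have f0: "0 \<le> f i" for i using C by (simp add: f_def)
  have anti: "antimono f"
    unfolding antimono_def f_def using C by (auto intro!: divide_left_mono)
  have x_half: "\<bar>x k\<bar> \<le> 1 / 2" for k
    using of_int_round_abs_le[of "real k / real M - \<alpha>"] by (simp add: x_def z_def abs_minus_commute)
  have gx: "g (real k / real M - \<alpha>) = g (x k)" for k
    using per[of "x k" "z k"] by (simp add: x_def)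
  have inj: "inj_on \<iota> S"
  proof (rule inj_onI)
    fix k k' assume k: "k \<in> S" "k' \<in> S" and eq: "\<iota> k = \<iota> k'"
    have M: "M > 0" using k S by auto
    have e: "real M * x k = real_of_int (int k - int M * z k) - real M * \<alpha>" for k
      using M by (simp add: x_def field_simps)
    have "\<bar>real M * x k - real M * x k'\<bar> < 1"
      using eq unfolding \<iota>_def by linarith
    then have "\<bar>real_of_int ((int k - int M * z k) - (int k' - int M * z k'))\<bar> < 1"
      unfolding e by simp
    then have "int k - int k' = int M * (z k - z k')" 
      unfolding of_int_abs[symmetric] of_int_less_1_iff by (simp add: right_diff_distrib)
    then have "int M dvd int k - int k'" by simp
    moreover have "k < M" "k' < M" using k S by auto
    then have "\<bar>int k - int k'\<bar> < int M" by linarith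
    ultimately show "k = k'" by (simp add: int_dvd_iff_zero)
  qed
  \<comment> \<open>Any integer whose modulus does not exceed the scaled distance will do, so both
    signs of \<open>x k\<close> share one estimate.\<close>
  have bound: "g (x k) \<le> f (nat \<bar>r\<bar>)" if r: "\<bar>real_of_int r\<bar> \<le> real M * \<bar>x k\<bar>" and M: "M > 0" for k r
  proof (cases "r = 0")
    case True
    then show ?thesis using g1[of "x k"] C by (simp add: f_def)
  next
    case False
    then have 1: "real_of_int \<bar>r\<bar> \<ge> 1" by linarith
    then have "x k \<noteq> 0" using r by auto
    then have "g (x k) \<le> C / (real M * \<bar>x k\<bar>)" using gC x_half by auto
    also have "\<dots> \<le> C / real_of_int \<bar>r\<bar>" using 1 r C by (intro divide_left_mono) (auto intro!: mult_pos_pos)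
    also have "real_of_int \<bar>r\<bar> = real (max 1 (nat \<bar>r\<bar>))" using 1 by (simp add: max_def)
    finally show ?thesis by (simp add: f_def)
  qed
  define P Q where "P = {k\<in>S. 0 \<le> \<iota> k}" and "Q = {k\<in>S. \<iota> k < 0}"
  have fin: "finite P" "finite Q" and S_eq: "S = P \<union> Q" "P \<inter> Q = {}"
    using finS by (auto simp: P_def Q_def)
  have cards: "card P \<le> m" "card Q \<le> m"
    using S(2) card_mono[OF finS, of P] card_mono[OF finS, of Q] by (auto simp: P_def Q_def)
  have one_side: "(\<Sum>k\<in>T. g (x k)) \<le> (\<Sum>i<m. f i)"
    if T: "T \<subseteq> S" "card T \<le> m" and inj_h: "inj_on h (\<iota> ` T)" and h: "\<And>k. k \<in> T \<Longrightarrow> \<bar>real_of_int (h (\<iota> k))\<bar> \<le> real M * \<bar>x k\<bar> \<and> 0 \<le> h (\<iota> k)" for T h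
  proof -
    have finT: "finite T" using T finS finite_subset by auto
    have inj_T: "inj_on (\<lambda>k. nat (h (\<iota> k))) T"
    proof (rule inj_onI)
      fix k k' assume k: "k \<in> T" "k' \<in> T" "nat (h (\<iota> k)) = nat (h (\<iota> k'))"
      then have "h (\<iota> k) = h (\<iota> k')" using h by (metis nat_eq_iff2 int_nat_eq)
      then have "\<iota> k = \<iota> k'" using inj_h k by (auto dest: inj_onD)
      then show "k = k'" using inj T(1) k by (auto dest: inj_onD)
    qed
    have "(\<Sum>k\<in>T. g (x k)) \<le> (\<Sum>k\<in>T. f (nat (h (\<iota> k))))"
    proof (intro sum_mono)
      fix k assume k: "k \<in> T"
      then have "M > 0" using T S by auto
      then show "g (x k) \<le> f (nat (h (\<iota> k)))" using bound[of "h (\<iota> k)" k] h[OF k] by (metis abs_of_nonneg)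
    qed
    also have "\<dots> = sum f ((\<lambda>k. nat (h (\<iota> k))) ` T)"
      using inj_T by (simp add: sum.reindex)
    also have "\<dots> \<le> (\<Sum>i<m. f i)"
      using T inj_T finT f0 by (intro sum_antimono_le_initial[OF anti]) (auto simp: card_image)
    finally show ?thesis .
  qed
  have "(\<Sum>k\<in>P. g (x k)) \<le> (\<Sum>i<m. f i)"
  proof (rule one_side[where h = "\<lambda>i. i"])
    show "\<bar>real_of_int (\<iota> k)\<bar> \<le> real M * \<bar>x k\<bar> \<and> 0 \<le> \<iota> k" if "k \<in> P" for k
    proof -
      have 0: "0 \<le> \<iota> k" using that by (simp add: P_def)
      then have "0 \<le> real M * x k" by (simp add: \<iota>_def)
      moreover have "real M * \<bar>x k\<bar> = \<bar>real M * x k\<bar>" by (simp add: abs_mult)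
      moreover have "real_of_int (\<iota> k) \<le> real M * x k" by (simp add: \<iota>_def)
      ultimately show ?thesis using 0 by linarith
    qed
  qed (use cards in \<open>auto simp: P_def\<close>)
  moreover have "(\<Sum>k\<in>Q. g (x k)) \<le> (\<Sum>i<m. f i)"
  \<comment> \<open>For negative \<open>x k\<close> the floor \<open>i\<close> may exceed
    \<open>M |x k|\<close> in modulus. The integer \<open>-i - 1\<close> lies below
    \<open>M |x k|\<close> and starts at 0, as on the other side.\<close>
  proof (rule one_side[where h = "\<lambda>i. - i - 1"])
    show "\<bar>real_of_int (- \<iota> k - 1)\<bar> \<le> real M * \<bar>x k\<bar> \<and> 0 \<le> - \<iota> k - 1" if "k \<in> Q" for k
    proof -
      have 0: "\<iota> k < 0" using that by (simp add: Q_def)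
      have 1: "real M * x k < real_of_int (\<iota> k) + 1" unfolding \<iota>_def by linarith
      moreover have "real M * \<bar>x k\<bar> = \<bar>real M * x k\<bar>" by (simp add: abs_mult)
      moreover have "real_of_int (- \<iota> k - 1) \<ge> 0" using 0 by linarith
      ultimately show ?thesis using 0 by (auto simp: abs_if)
    qed
  qed (use cards in \<open>auto simp: Q_def inj_on_def\<close>)
  moreover have "(\<Sum>k\<in>S. g (real k / real M - \<alpha>)) = (\<Sum>k\<in>P. g (x k)) + (\<Sum>k\<in>Q. g (x k))"
    unfolding gx S_eq(1) using fin S_eq(2) by (rule sum.union_disjoint)
  moreover have "(\<Sum>i<m. f i) \<le> C * (2 + ln (real m))"
    using mult_left_mono[OF sum_inverse_le_ln[OF S(3)], of C] C by (simp add: f_def sum_distrib_left)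
  ultimately show ?thesis by linarith
qed

lemma exists_top_subset:
  fixes Z :: "'k \<Rightarrow> real"
  assumes "finite A" "m \<le> card A"
  shows "\<exists>S \<subseteq> A. card S = m \<and> (\<forall>i\<in>S. \<forall>j\<in>A - S. Z j \<le> Z i)"
  using assms(2)
proof (induction m)
  case 0
  then show ?case by (intro exI[of _ "{}"]) auto
next
  case (Suc m)
  then obtain S where S: "S \<subseteq> A" "card S = m" "\<forall>i\<in>S. \<forall>j\<in>A - S. Z j \<le> Z i" by auto
  have finS: "finite S" using S assms finite_subset by auto
  have "A - S \<noteq> {}" using Suc.prems S(2) card_mono[OF finS, of A] by auto
  then have "Max (Z ` (A - S)) \<in> Z ` (A - S)" using assms(1) by (intro Max_in) auto
  then obtain a where a: "a \<in> A - S" "Z a = Max (Z ` (A - S))" by (metis imageE)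
  then have top: "Z j \<le> Z a" if "j \<in> A - S" for j using assms(1) that by simp
  have "\<forall>i\<in>insert a S. \<forall>j\<in>A - insert a S. Z j \<le> Z i" using S(3) top by blast
  moreover have "card (insert a S) = Suc m" using a(1) S(2) finS by simp
  moreover have "insert a S \<subseteq> A" using S(1) a(1) by blast
  ultimately show ?case by blast
qed

text \<open>The extreme points of the intersection of an \<open>\<ell>\<^sub>1\<close>-ball with an \<open>\<ell>\<^sub>\<infinity>\<close>-ball are sparse.\<close>
lemma sum_le_sup_sparse:
  fixes c Z :: "'k \<Rightarrow> real"
  assumes "finite A" "m \<le> card A" "m \<ge> 1"
    and c: "\<And>k. k \<in> A \<Longrightarrow> 0 \<le> c k \<and> c k \<le> C" and sum_c: "(\<Sum>k\<in>A. c k) \<le> real m * C"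
    and Z: "\<And>k. k \<in> A \<Longrightarrow> 0 \<le> Z k" and B: "\<And>S. S \<subseteq> A \<Longrightarrow> card S = m \<Longrightarrow> (\<Sum>k\<in>S. Z k) \<le> B"
    and "C \<ge> 0"
  shows "(\<Sum>k\<in>A. c k * Z k) \<le> C * B"
proof -
  obtain S where S: "S \<subseteq> A" "card S = m" "\<forall>i\<in>S. \<forall>j\<in>A - S. Z j \<le> Z i"
    using exists_top_subset[OF assms(1,2)] by blast
  have finS: "finite S" and ne: "S \<noteq> {}" using S assms finite_subset by auto
  \<comment> \<open>The least of the top weights is the exchange rate: mass of \<open>c\<close>
    outside \<open>S\<close> is worth at most \<open>v\<close> per unit, and the bound on the total
    allows moving it into the free capacity \<open>C - c k\<close> inside \<open>S\<close>.\<close>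
  define v where "v = Min (Z ` S)"
  have v1: "v \<le> Z i" if "i \<in> S" for i using that finS by (simp add: v_def)
  have v2: "Z j \<le> v" if "j \<in> A - S" for j using that finS ne S(3) by (auto simp: v_def)
  have v0: "0 \<le> v" using Z S(1) finS ne by (auto simp: v_def)
  have dec: "sum h A = sum h S + sum h (A - S)" for h :: "'k \<Rightarrow> real"
    using sum.subset_diff[OF S(1) assms(1)] by (simp add: add.commute)
  have "(\<Sum>k\<in>A - S. c k * Z k) \<le> (\<Sum>k\<in>A - S. c k * v)"
    using c v2 by (intro sum_mono mult_left_mono) auto
  also have "\<dots> = v * (\<Sum>k\<in>A - S. c k)" by (simp add: sum_distrib_left mult.commute)
  also have "\<dots> \<le> v * (real m * C - (\<Sum>k\<in>S. c k))"
    using sum_c dec[of c] v0 by (intro mult_left_mono) auto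
  also have "\<dots> = (\<Sum>k\<in>S. (C - c k) * v)"
    by (simp only: sum_distrib_right[symmetric] sum_subtractf sum_constant S(2)) (simp add: mult.commute)
  also have "\<dots> \<le> (\<Sum>k\<in>S. (C - c k) * Z k)"
    using v1 c S(1) by (intro sum_mono mult_left_mono) auto
  finally have "(\<Sum>k\<in>A. c k * Z k) \<le> (\<Sum>k\<in>S. C * Z k)"
    using dec[of "\<lambda>k. c k * Z k"] by (simp add: left_diff_distrib sum_subtractf)
  also have "\<dots> \<le> C * B" using B[OF S(1,2)] assms(8) by (simp add: sum_distrib_left[symmetric] mult_left_mono)
  finally show ?thesis .
qed

section \<open>Spectral bounds on one window\<close>

text \<open>Modulus of the interpolation weight between frequency \<open>k\<close> of the coarse
  grid and frequency \<open>j\<close> of the fine grid, scaled to be at most 1.\<close>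

definition kappa :: "nat \<Rightarrow> nat \<Rightarrow> nat \<Rightarrow> real" where
  "kappa p j k = cmod (dirich p (real k / real (2 * p + 1) - real j / real (4 * p + 1))) / real (2 * p + 1)"

lemma kappa_nonneg [simp]: "0 \<le> kappa p j k"
  by (simp add: kappa_def)

lemma fourier_inversion:
  assumes "\<tau> \<in> {- int p..int p}"
  shows "u \<tau> = (\<Sum>k<2 * p + 1. fhat (2 * p + 1) p u k * dchar (2 * p + 1) k \<tau>) / of_nat (2 * p + 1)"
proof -
  let ?N = "2 * p + 1" and ?P = "{- int p..int p}"
  have N0: "0 < ?N" by simp
  have "(\<Sum>k<?N. fhat ?N p u k * dchar ?N k \<tau>) = (\<Sum>k<?N. \<Sum>r\<in>?P. u r * dchar ?N k (\<tau> - r))"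
    unfolding fhat_def sum_distrib_right dchar_diff by (intro sum.cong refl) (simp only: mult_ac)
  also have "\<dots> = (\<Sum>r\<in>?P. u r * (if int ?N dvd \<tau> - r then of_nat ?N else 0))"
    by (subst sum.swap) (simp only: sum_distrib_left[symmetric] sum_dchar[OF N0])
  also have "\<dots> = (\<Sum>r\<in>?P. if r = \<tau> then u r * of_nat ?N else 0)"
  proof (intro sum.cong refl)
    fix r assume "r \<in> ?P"
    then have "int ?N dvd \<tau> - r \<longleftrightarrow> r = \<tau>" using assms int_dvd_iff_zero[of "\<tau> - r" ?N] by auto
    then show "u r * (if int ?N dvd \<tau> - r then of_nat ?N else 0) = (if r = \<tau> then u r * of_nat ?N else 0)"
      by simp
  qed
  also have "\<dots> = u \<tau> * of_nat ?N"
    using assms by (simp add: sum.delta')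
  finally show ?thesis by (simp del: of_nat_add of_nat_Suc of_nat_mult)
qed

text \<open>A filter on \<open>2p + 1\<close> points is determined by as many frequencies, so
  inserting the inversion formula interpolates the finer grid with Dirichlet kernels. The triangle
  inequality then discards the phases.\<close>

lemma norm_fhat_le_kappa:
  "cmod (fhat (4 * p + 1) p u j) \<le> (\<Sum>k<2 * p + 1. cmod (fhat (2 * p + 1) p u k) * kappa p j k)"
proof -
  let ?N = "2 * p + 1" and ?D = "4 * p + 1" and ?P = "{- int p..int p}"
  have "fhat ?D p u j = (\<Sum>\<tau>\<in>?P. \<Sum>k<?N. fhat ?N p u k * (dchar ?N k \<tau> * cnj (dchar ?D j \<tau>)) / of_nat ?N)"
    unfolding fhat_def[of ?D]
  proof (intro sum.cong refl)
    fix \<tau> assume "\<tau> \<in> ?P"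
    show "cnj (dchar ?D j \<tau>) * u \<tau> = (\<Sum>k<?N. fhat ?N p u k * (dchar ?N k \<tau> * cnj (dchar ?D j \<tau>)) / of_nat ?N)"
      by (subst fourier_inversion[OF \<open>\<tau> \<in> ?P\<close>]) (simp only: sum_divide_distrib sum_distrib_left mult_ac times_divide_eq_right)
  qed
  also have "\<dots> = (\<Sum>k<?N. fhat ?N p u k * (dirich p (real k / real ?N - real j / real ?D) / of_nat ?N))"
  proof (subst sum.swap, intro sum.cong refl)
    fix k
    have "dchar ?N k \<tau> * cnj (dchar ?D j \<tau>) = cis (2 * pi * (real k / real ?N - real j / real ?D) * real_of_int \<tau>)" for \<tau>
      unfolding dchar_def cis_cnj cis_mult by (intro arg_cong[where f = cis]) (simp only: divide_inverse algebra_simps)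
    then show "(\<Sum>\<tau>\<in>?P. fhat ?N p u k * (dchar ?N k \<tau> * cnj (dchar ?D j \<tau>)) / of_nat ?N)
        = fhat ?N p u k * (dirich p (real k / real ?N - real j / real ?D) / of_nat ?N)"
      by (simp only: dirich_def sum_divide_distrib sum_distrib_left times_divide_eq_right)
  qed
  finally have "cmod (fhat ?D p u j) \<le> (\<Sum>k<?N. cmod (fhat ?N p u k * (dirich p (real k / real ?N - real j / real ?D) / of_nat ?N)))"
    by (simp only: norm_sum)
  then show ?thesis
    by (simp only: norm_mult norm_divide norm_of_nat kappa_def)
qed

text \<open>Without the DFT normalisation the two radii become \<open>cstar\<close> and
  \<open>18 s cstar\<close>; their ratio \<open>18 s\<close> is the sparsity of the extreme
  points.\<close>

lemma feasible_spectrum: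
  assumes "feasible s p \<phi>" "s \<ge> 1"
  shows "k \<le> 2 * p \<Longrightarrow> cmod (fhat (2 * p + 1) p \<phi> k) \<le> cstar"
    and "(\<Sum>k<2 * p + 1. cmod (fhat (2 * p + 1) p \<phi> k)) \<le> real (18 * s) * cstar"
proof -
  define q where "q = sqrt (real (2 * p + 1))"
  have q: "q > 0" by (simp add: q_def)
  have f: "dft_l1 p \<phi> \<le> 18 * cstar * real s / q" "18 * real s * dft_linf p \<phi> \<le> 18 * cstar * real s / q"
    using assms(1) unfolding feasible_def q_def by auto
  have cm: "cmod (dft p \<phi> k) = cmod (fhat (2 * p + 1) p \<phi> k) / q" for k
    unfolding dft_conv_fhat q_def by (simp add: norm_mult norm_divide)
  have "{0..2 * p} = {..<2 * p + 1}" by auto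
  then show "(\<Sum>k<2 * p + 1. cmod (fhat (2 * p + 1) p \<phi> k)) \<le> real (18 * s) * cstar"
    using f(1) q by (simp add: dft_l1_def cm sum_divide_distrib[symmetric] divide_le_cancel mult_ac)
  have "18 * real s * dft_linf p \<phi> \<le> 18 * real s * (cstar / q)"
    using f(2) by (simp add: mult_ac)
  then have linf: "dft_linf p \<phi> \<le> cstar / q"
    using assms(2) by (subst (asm) mult_le_cancel_left_pos) auto
  show "cmod (fhat (2 * p + 1) p \<phi> k) \<le> cstar" if "k \<le> 2 * p"
  proof -
    have "cmod (dft p \<phi> k) \<le> dft_linf p \<phi>"
      unfolding dft_linf_def using that by (intro Max_ge) auto
    then have "cmod (fhat (2 * p + 1) p \<phi> k) / q \<le> cstar / q"
      unfolding cm using linf by (rule order_trans)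
    then show ?thesis using q by (simp add: divide_le_cancel)
  qed
qed

lemma dirich_le:
  assumes "\<bar>x\<bar> \<le> 1 / 2" "x \<noteq> 0"
  shows "cmod (dirich p x) / real (2 * p + 1) \<le> 1 / (real (2 * p + 1) * \<bar>x\<bar>)"
  using divide_right_mono[OF norm_dirich_le_inverse[OF assms], of "real (2 * p + 1)" p]
  by (simp add: mult.commute)

text \<open>Controls the largest weight of the noise forms and is the source of the factor
  \<open>ln (9 * exp 4 * real s)\<close> in \<open>r0sq\<close>: here 2 + ln(18 s) is enlarged to 4
  + ln(9 s).\<close>

lemma sum_kappa_sparse:
  assumes "S \<subseteq> {..<2 * p + 1}" "card S = 18 * s" "s \<ge> 1"
  shows "(\<Sum>k\<in>S. kappa p j k) \<le> 2 * ln (9 * exp 4 * real s)"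
proof -
  have "(\<Sum>k\<in>S. kappa p j k) \<le> 2 * 1 * (2 + ln (real (18 * s)))"
    unfolding kappa_def
  proof (rule sum_periodic_le_ln[where g = "\<lambda>x. cmod (dirich p x) / real (2 * p + 1)"])
    show "cmod (dirich p x) / real (2 * p + 1) \<le> 1" for x
      using norm_dirich_le[of p x] by (simp add: divide_le_eq)
    show "cmod (dirich p x) / real (2 * p + 1) \<le> 1 / (real (2 * p + 1) * \<bar>x\<bar>)" if "\<bar>x\<bar> \<le> 1 / 2" "x \<noteq> 0" for x
      using dirich_le[OF that] .
  qed (use assms in \<open>auto simp: dirich_add_int\<close>)
  moreover have "ln (real (18 * s)) = ln 9 + ln 2 + ln (real s)"
    using assms(3) ln_mult[of 9 2] ln_mult[of 18 "real s"] by simp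
  moreover have "ln (9 * exp 4 * real s) = ln 9 + 4 + ln (real s)"
    using assms(3) by (simp add: ln_mult)
  moreover have "ln 2 \<le> (1::real)" using ln_le_minus_one[of 2] by simp
  ultimately show ?thesis by simp
qed

text \<open>Controls the trace of the noise forms. The kernel decays on the scale 1/(2p + 1) while
  the frequencies are spaced by 1/(4p + 1); the factor \<open>C = 2\<close> covers the
  mismatch.\<close>

lemma sum_kappa_frequencies:
  "(\<Sum>j<4 * p + 1. kappa p j k) \<le> 12 + 4 * ln (real (2 * p + 1))"
proof -
  let ?N = "2 * p + 1" and ?D = "4 * p + 1"
  have "(\<Sum>j<?D. kappa p j k) = (\<Sum>j<?D. cmod (dirich p (real j / real ?D - real k / real ?N)) / real ?N)"
    unfolding kappa_def by (intro sum.cong refl) (metis dirich_minus minus_diff_eq)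
  also have "\<dots> \<le> 2 * 2 * (2 + ln (real ?D))"
  proof (rule sum_periodic_le_ln[where g = "\<lambda>x. cmod (dirich p x) / real ?N"])
    show "cmod (dirich p x) / real ?N \<le> 1" for x
      using norm_dirich_le[of p x] by (simp add: divide_le_eq)
    show "cmod (dirich p x) / real ?N \<le> 2 / (real ?D * \<bar>x\<bar>)" if "\<bar>x\<bar> \<le> 1 / 2" "x \<noteq> 0" for x
    proof -
      have "real ?D * \<bar>x\<bar> \<le> 2 * (real ?N * \<bar>x\<bar>)"
        using mult_right_mono[of "real ?D" "2 * real ?N" "\<bar>x\<bar>"] by (simp add: algebra_simps)
      then have "2 / (2 * (real ?N * \<bar>x\<bar>)) \<le> 2 / (real ?D * \<bar>x\<bar>)"
        using that(2) by (intro divide_left_mono mult_pos_pos) auto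
      then have "1 / (real ?N * \<bar>x\<bar>) \<le> 2 / (real ?D * \<bar>x\<bar>)" by simp
      then show ?thesis using dirich_le[OF that, of p] by linarith
    qed
  qed (auto simp: dirich_add_int)
  also have "ln (real ?D) \<le> ln (2 * real ?N)" by (subst ln_le_cancel_iff) auto
  also have "ln (2 * real ?N) = ln 2 + ln (real ?N)" by (subst ln_mult) auto
  also have "ln 2 \<le> (1::real)" using ln_le_minus_one[of 2] by simp
  finally show ?thesis by simp
qed

section \<open>Gain and loss on a block as quadratic forms\<close>

lemma cross_term_spectral:
  assumes "supp_in p u" "I \<subseteq> {h - int p..h + int p}"
  shows "(\<Sum>t\<in>I. cnj (v t) * conv u v t)
    = (\<Sum>j<4 * p + 1. fhat (4 * p + 1) p u j * wdft (4 * p + 1) {h - 2 * int p..h + 2 * int p} v j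
         * cnj (wdft (4 * p + 1) I v j))"
proof -
  let ?D = "4 * p + 1"
  let ?a = "wdft ?D {h - 2 * int p..h + 2 * int p} v"
  have "(\<Sum>t\<in>I. cnj (v t) * conv u v t)
     = (\<Sum>t\<in>I. cnj (v t) * (\<Sum>j<?D. fhat ?D p u j * ?a j * (dchar ?D j t / sqrt (real ?D))))"
    using assms by (intro sum.cong refl) (subst conv_window_spectral[where h = h], auto)
  also have "\<dots> = (\<Sum>j<?D. \<Sum>t\<in>I. fhat ?D p u j * ?a j * (cnj (v t) * (dchar ?D j t / sqrt (real ?D))))"
    unfolding sum_distrib_left by (subst sum.swap) (simp only: mult_ac)
  also have "\<dots> = (\<Sum>j<?D. fhat ?D p u j * ?a j * cnj (wdft ?D I v j))"
    unfolding sum_distrib_left[symmetric]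
    by (intro sum.cong refl arg_cong2[where f = "(*)"])
       (simp only: wdft_def cnj_sum complex_cnj_mult complex_cnj_divide complex_cnj_cnj complex_cnj_complex_of_real mult.commute)
  finally show ?thesis .
qed

text \<open>The convolution sees the large window and the pairing only \<open>I\<close>, so two
  different transforms meet. The inequality 2ab \<le> a^2 + b^2 separates them into two forms with
  the same weights, each with its own tail bound.\<close>

lemma cross_term_bound:
  assumes "supp_in p u" "I \<subseteq> {h - int p..h + int p}"
  shows "2 * \<bar>Re (\<Sum>t\<in>I. cnj (v t) * conv u v t)\<bar>
    \<le> (\<Sum>j<4 * p + 1. cmod (fhat (4 * p + 1) p u j) *
        ((cmod (wdft (4 * p + 1) {h - 2 * int p..h + 2 * int p} v j))\<^sup>2 + (cmod (wdft (4 * p + 1) I v j))\<^sup>2))"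
proof -
  let ?D = "4 * p + 1"
  let ?a = "wdft ?D {h - 2 * int p..h + 2 * int p} v" and ?b = "wdft ?D I v"
  have "\<bar>Re (\<Sum>t\<in>I. cnj (v t) * conv u v t)\<bar> \<le> cmod (\<Sum>j<?D. fhat ?D p u j * ?a j * cnj (?b j))"
    unfolding cross_term_spectral[OF assms] by (rule abs_Re_le_cmod)
  also have "\<dots> \<le> (\<Sum>j<?D. cmod (fhat ?D p u j) * (cmod (?a j) * cmod (?b j)))"
    by (rule order_trans[OF norm_sum]) (simp add: norm_mult mult.assoc)
  finally have "2 * \<bar>Re (\<Sum>t\<in>I. cnj (v t) * conv u v t)\<bar> \<le> (\<Sum>j<?D. 2 * (cmod (fhat ?D p u j) * (cmod (?a j) * cmod (?b j))))"
    by (simp add: sum_distrib_left[symmetric])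
  also have "\<dots> \<le> (\<Sum>j<?D. cmod (fhat ?D p u j) * ((cmod (?a j))\<^sup>2 + (cmod (?b j))\<^sup>2))"
  proof (rule sum_mono)
    fix j
    have "2 * (cmod (?a j) * cmod (?b j)) \<le> (cmod (?a j))\<^sup>2 + (cmod (?b j))\<^sup>2"
      using sum_squares_bound[of "cmod (?a j)" "cmod (?b j)"] by simp
    from mult_left_mono[OF this, of "cmod (fhat ?D p u j)"]
    show "2 * (cmod (fhat ?D p u j) * (cmod (?a j) * cmod (?b j))) \<le> cmod (fhat ?D p u j) * ((cmod (?a j))\<^sup>2 + (cmod (?b j))\<^sup>2)"
      by (simp only: mult_ac norm_ge_zero)
  qed
  finally show ?thesis .
qed

text \<open>Bessel produces the squared moduli of the spectrum. These are at most the moduli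
  themselves, so the bound on the spectral sum applies again.\<close>

lemma conv_energy_bound:
  assumes "supp_in p u" "\<And>j. cmod (fhat (4 * p + 1) p u j) \<le> 1"
  shows "(\<Sum>t\<in>{h - int p..h + int p}. (cmod (conv u v t))\<^sup>2)
    \<le> (\<Sum>j<4 * p + 1. cmod (fhat (4 * p + 1) p u j) * (cmod (wdft (4 * p + 1) {h - 2 * int p..h + 2 * int p} v j))\<^sup>2)"
proof -
  let ?D = "4 * p + 1"
  let ?a = "wdft ?D {h - 2 * int p..h + 2 * int p} v"
  have "(\<Sum>t\<in>{h - int p..h + int p}. (cmod (conv u v t))\<^sup>2)
     = (\<Sum>t\<in>{h - int p..h + int p}. (cmod (\<Sum>j<?D. fhat ?D p u j * ?a j * (dchar ?D j t / sqrt (real ?D))))\<^sup>2)"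
    using assms(1) by (intro sum.cong refl) (subst conv_window_spectral[where h = h], auto)
  also have "\<dots> \<le> (\<Sum>j<?D. (cmod (fhat ?D p u j * ?a j))\<^sup>2)"
    by (rule bessel_window[where c = "h - int p"]) auto
  also have "\<dots> \<le> (\<Sum>j<?D. cmod (fhat ?D p u j) * (cmod (?a j))\<^sup>2)"
  proof (rule sum_mono)
    fix j
    have "(cmod (fhat ?D p u j))\<^sup>2 \<le> cmod (fhat ?D p u j)"
      using assms(2)[of j] mult_left_mono[of "cmod (fhat ?D p u j)" 1 "cmod (fhat ?D p u j)"] by (simp add: power2_eq_square)
    then show "(cmod (fhat ?D p u j * ?a j))\<^sup>2 \<le> cmod (fhat ?D p u j) * (cmod (?a j))\<^sup>2"
      by (simp only: norm_mult power_mult_distrib) (rule mult_right_mono, auto)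
  qed
  finally show ?thesis .
qed

lemma cmod_diff_squared: "(cmod (z - w))\<^sup>2 = (cmod z)\<^sup>2 - 2 * Re (cnj z * w) + (cmod w)\<^sup>2"
  by (simp add: cmod_power2) (simp add: power2_eq_square algebra_simps)

text \<open>The hypothesis on \<open>B\<close> speaks of the data and of all supports, never of
  \<open>\<phi>\<close>, so \<open>\<phi>\<close> may be selected from the data. The negative term
  |\<phi> * y|^2 is dropped, and \<open>9 * s \<le> p\<close> guarantees that supports of size
  \<open>18 * s\<close> exist.\<close>

lemma block_gain_le:
  assumes "feasible s p \<phi>" "s \<ge> 1" "9 * s \<le> p" "I \<subseteq> {h - int p..h + int p}"
    and B: "\<And>S. S \<subseteq> {..<2 * p + 1} \<Longrightarrow> card S = 18 * s \<Longrightarrow>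
      (\<Sum>j<4 * p + 1. (\<Sum>k\<in>S. kappa p j k) * (cmod (wdft (4 * p + 1) {h - 2 * int p..h + 2 * int p} y j))\<^sup>2)
      + (\<Sum>j<4 * p + 1. (\<Sum>k\<in>S. kappa p j k) * (cmod (wdft (4 * p + 1) I y j))\<^sup>2) \<le> B"
  shows "(\<Sum>t\<in>I. (cmod (y t))\<^sup>2 - (cmod (y t - conv \<phi> y t))\<^sup>2) \<le> cstar * B"
proof -
  let ?D = "4 * p + 1"
  define e where "e j = (cmod (wdft ?D {h - 2 * int p..h + 2 * int p} y j))\<^sup>2 + (cmod (wdft ?D I y j))\<^sup>2" for j
  have e0: "0 \<le> e j" for j by (simp add: e_def)
  have supp: "supp_in p \<phi>" using assms(1) by (simp add: feasible_def)
  define c where "c k = cmod (fhat (2 * p + 1) p \<phi> k)" for k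
  have "(\<Sum>t\<in>I. (cmod (y t))\<^sup>2 - (cmod (y t - conv \<phi> y t))\<^sup>2) \<le> (\<Sum>t\<in>I. 2 * Re (cnj (y t) * conv \<phi> y t))"
    by (intro sum_mono) (simp add: cmod_diff_squared)
  also have "\<dots> = 2 * Re (\<Sum>t\<in>I. cnj (y t) * conv \<phi> y t)"
    by (simp only: Re_sum sum_distrib_left)
  also have "\<dots> \<le> (\<Sum>j<?D. cmod (fhat ?D p \<phi> j) * e j)"
    using cross_term_bound[OF supp assms(4), of y] unfolding e_def by linarith
  also have "\<dots> \<le> (\<Sum>j<?D. (\<Sum>k<2 * p + 1. c k * kappa p j k) * e j)"
    unfolding c_def by (intro sum_mono mult_right_mono norm_fhat_le_kappa e0)
  also have "\<dots> = (\<Sum>k<2 * p + 1. c k * (\<Sum>j<?D. kappa p j k * e j))"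
    unfolding sum_distrib_left sum_distrib_right by (subst sum.swap) (simp only: mult_ac)
  also have "\<dots> \<le> cstar * B"
  proof (rule sum_le_sup_sparse[where m = "18 * s"])
    show "0 \<le> c k \<and> c k \<le> cstar" if "k \<in> {..<2 * p + 1}" for k
      using feasible_spectrum(1)[OF assms(1,2), of k] that by (auto simp: c_def)
    show "(\<Sum>k<2 * p + 1. c k) \<le> real (18 * s) * cstar"
      unfolding c_def by (rule feasible_spectrum(2)[OF assms(1,2)])
    show "(\<Sum>k\<in>S. \<Sum>j<?D. kappa p j k * e j) \<le> B" if "S \<subseteq> {..<2 * p + 1}" "card S = 18 * s" for S
    proof -
      have "(\<Sum>k\<in>S. \<Sum>j<?D. kappa p j k * e j) = (\<Sum>j<?D. (\<Sum>k\<in>S. kappa p j k) * e j)"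
        unfolding sum_distrib_right by (rule sum.swap)
      also have "\<dots> \<le> B"
        using B[OF that] unfolding e_def distrib_left sum.distrib .
      finally show ?thesis .
    qed
    show "0 \<le> (\<Sum>j<?D. kappa p j k * e j)" for k
      by (intro sum_nonneg mult_nonneg_nonneg kappa_nonneg e0)
  qed (use assms(2,3) cstar_ge in auto)
  finally show ?thesis .
qed

text \<open>The large window counts twice, once from the cross term and once from the energy of the
  filtered sequence.\<close>

lemma block_loss_le:
  assumes "supp_in p \<phi>" "\<And>j. cmod (fhat (4 * p + 1) p \<phi> j) \<le> 1"
  shows "(\<Sum>t\<in>{h - int p..h + int p}. (cmod (v t - conv \<phi> v t))\<^sup>2)
    \<le> (\<Sum>t\<in>{h - int p..h + int p}. (cmod (v t))\<^sup>2)
     + 2 * (\<Sum>j<4 * p + 1. cmod (fhat (4 * p + 1) p \<phi> j) * (cmod (wdft (4 * p + 1) {h - 2 * int p..h + 2 * int p} v j))\<^sup>2)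
     + (\<Sum>j<4 * p + 1. cmod (fhat (4 * p + 1) p \<phi> j) * (cmod (wdft (4 * p + 1) {h - int p..h + int p} v j))\<^sup>2)"
proof -
  let ?J = "{h - int p..h + int p}"
  have "(\<Sum>t\<in>?J. (cmod (v t - conv \<phi> v t))\<^sup>2)
     = (\<Sum>t\<in>?J. (cmod (v t))\<^sup>2) - 2 * Re (\<Sum>t\<in>?J. cnj (v t) * conv \<phi> v t) + (\<Sum>t\<in>?J. (cmod (conv \<phi> v t))\<^sup>2)"
    by (simp only: cmod_diff_squared sum.distrib sum_subtractf Re_sum sum_distrib_left)
  then show ?thesis
    using cross_term_bound[OF assms(1) order_refl, where h = h and v = v] conv_energy_bound[OF assms, where h = h and v = v]
    unfolding distrib_left sum.distrib by linarith
qed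

section \<open>Noise events of high probability\<close>

context prob_space begin

text \<open>Only the exceptional set is measurable, not necessarily \<open>Q\<close>. This suits a
  statistic built from arbitrarily chosen minimizers and keeps union bounds free of measurability
  conditions.\<close>

definition whp :: "real \<Rightarrow> ('a \<Rightarrow> bool) \<Rightarrow> bool" where
  "whp e Q \<longleftrightarrow> (\<exists>A\<in>events. prob A \<le> e \<and> (\<forall>\<omega>\<in>space M - A. Q \<omega>))"

lemma whp_mono:
  assumes "whp e Q" "e \<le> e'" "\<And>\<omega>. \<omega> \<in> space M \<Longrightarrow> Q \<omega> \<Longrightarrow> Q' \<omega>"
  shows "whp e' Q'"
  using assms unfolding whp_def by (metis DiffD1 order_trans)

lemma whp_conj:
  assumes "whp e Q" "whp e' Q'"
  shows "whp (e + e') (\<lambda>\<omega>. Q \<omega> \<and> Q' \<omega>)"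
proof -
  obtain A A' where A: "A \<in> events" "prob A \<le> e" "\<forall>\<omega>\<in>space M - A. Q \<omega>"
    and A': "A' \<in> events" "prob A' \<le> e'" "\<forall>\<omega>\<in>space M - A'. Q' \<omega>"
    using assms unfolding whp_def by blast
  have "prob (A \<union> A') \<le> e + e'"
    using measure_Un_le[OF A(1) A'(1)] A(2) A'(2) by linarith
  then show ?thesis
    unfolding whp_def using A A' by (intro bexI[of _ "A \<union> A'"]) auto
qed

lemma whp_ball:
  assumes "finite I" "\<And>i. i \<in> I \<Longrightarrow> whp e (Q i)"
  shows "whp (real (card I) * e) (\<lambda>\<omega>. \<forall>i\<in>I. Q i \<omega>)"
  using assms
proof (induction I rule: finite_induct)
  case empty
  show ?case unfolding whp_def by (intro bexI[of _ "{}"]) auto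
next
  case (insert i I)
  have "whp (e + real (card I) * e) (\<lambda>\<omega>. Q i \<omega> \<and> (\<forall>i\<in>I. Q i \<omega>))"
    using insert by (intro whp_conj) auto
  then show ?case
    by (rule whp_mono) (use insert in \<open>auto simp: algebra_simps\<close>)
qed

lemma outer_prob_le_if_whp:
  assumes "whp e Q" "e \<le> \<delta>" "\<And>\<omega>. \<omega> \<in> space M \<Longrightarrow> Q \<omega> \<Longrightarrow> \<not> P \<omega>"
  shows "outer_prob_le M P \<delta>"
proof -
  obtain A where A: "A \<in> events" "prob A \<le> e" "\<forall>\<omega>\<in>space M - A. Q \<omega>"
    using assms(1) unfolding whp_def by blast
  then have "{\<omega> \<in> space M. P \<omega>} \<subseteq> A" using assms(3) by auto
  then show ?thesis
    unfolding outer_prob_le_def using A assms(2) by (intro bexI[of _ A]) auto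
qed

end

context cgauss_family begin

lemma whp_quad:
  fixes d :: "'c \<Rightarrow> real" and F :: "'c \<Rightarrow> 'b \<Rightarrow> complex"
  assumes "T \<subseteq> U" and "finite K" and "0 < \<beta>" and "\<And>k. k \<in> K \<Longrightarrow> 0 \<le> d k \<and> d k \<le> \<beta>"
    and "\<And>c. (\<Sum>t\<in>T. (cmod (\<Sum>k\<in>K. c k * F k t))\<^sup>2) \<le> (\<Sum>k\<in>K. (cmod (c k))\<^sup>2)"
  shows "whp (exp (- L)) (\<lambda>\<omega>. quad T K d F \<omega> \<le> 2 * (\<Sum>k\<in>K. d k) + 2 * \<beta> * L)"
proof -
  note [measurable] = measurable_quad[OF assms(1)]
  let ?B = "2 * (\<Sum>k\<in>K. d k) + 2 * \<beta> * L"
  have "{\<omega>\<in>space M. quad T K d F \<omega> \<ge> ?B} \<in> events" by measurable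
  moreover have "prob {\<omega>\<in>space M. quad T K d F \<omega> \<ge> ?B} \<le> exp (- L)"
    by (rule quad_tail[OF assms order_refl])
  ultimately show ?thesis unfolding whp_def by (intro bexI) auto
qed

lemma whp_noise_energy:
  assumes "T \<subseteq> U"
  shows "whp (exp (- L)) (\<lambda>\<omega>. (\<Sum>t\<in>T. (cmod (\<xi> \<omega> t))\<^sup>2) \<le> 2 * real (card T) + 2 * L)"
proof -
  have T: "finite T" using assms finite_U finite_subset by auto
  have "whp (exp (- L)) (\<lambda>\<omega>. quad T T (\<lambda>_. 1) (\<lambda>k t. of_bool (k = t)) \<omega> \<le> 2 * (\<Sum>k\<in>T. 1) + 2 * 1 * L)"
    using T by (intro whp_quad[OF assms]) (auto simp: sum.delta of_bool_def if_distrib cong: if_cong)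
  moreover have "quad T T (\<lambda>_. 1) (\<lambda>k t. of_bool (k = t)) \<omega> = (\<Sum>t\<in>T. (cmod (\<xi> \<omega> t))\<^sup>2)" for \<omega>
  proof -
    have "(\<Sum>t\<in>T. of_bool (k = t) * \<xi> \<omega> t) = \<xi> \<omega> k" if "k \<in> T" for k
    proof -
      have "(\<Sum>t\<in>T. of_bool (k = t) * \<xi> \<omega> t) = (\<Sum>t\<in>T. if k = t then \<xi> \<omega> t else 0)"
        by (intro sum.cong) auto
      then show ?thesis using T that by simp
    qed
    then show ?thesis by (simp add: quad_def)
  qed
  ultimately show ?thesis by simp
qed

text \<open>Rank-one case of the quadratic bound: dividing by \<open>N\<close> yields a unit vector,
  hence a contraction.\<close>

lemma whp_noise_linear:
  assumes "T \<subseteq> U" and "N > 0" and N: "N\<^sup>2 = (\<Sum>t\<in>T. (cmod (x t))\<^sup>2)"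
  shows "whp (exp (- L)) (\<lambda>\<omega>. (cmod (\<Sum>t\<in>T. cnj (x t) * \<xi> \<omega> t))\<^sup>2 \<le> N\<^sup>2 * (2 + 2 * L))"
proof -
  have "whp (exp (- L)) (\<lambda>\<omega>. quad T {()} (\<lambda>_. 1) (\<lambda>_ t. cnj (x t) / N) \<omega> \<le> 2 * (\<Sum>k\<in>{()}. 1) + 2 * 1 * L)"
  proof (rule whp_quad[OF assms(1)])
    fix c :: "unit \<Rightarrow> complex"
    have "(\<Sum>t\<in>T. (cmod (\<Sum>k\<in>{()}. c k * (cnj (x t) / N)))\<^sup>2) = (\<Sum>t\<in>T. (cmod (x t))\<^sup>2) * ((cmod (c ()))\<^sup>2 / N\<^sup>2)"
      by (simp add: norm_mult norm_divide power_mult_distrib power_divide sum_distrib_left sum_divide_distrib mult_ac)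
    then show "(\<Sum>t\<in>T. (cmod (\<Sum>k\<in>{()}. c k * (cnj (x t) / N)))\<^sup>2) \<le> (\<Sum>k\<in>{()}. (cmod (c k))\<^sup>2)"
      using assms(2) by (simp add: N[symmetric])
  qed auto
  then show ?thesis
  proof (rule whp_mono)
    fix \<omega> assume "quad T {()} (\<lambda>_. 1) (\<lambda>_ t. cnj (x t) / N) \<omega> \<le> 2 * (\<Sum>k\<in>{()}. 1) + 2 * 1 * L"
    moreover have "quad T {()} (\<lambda>_. 1) (\<lambda>_ t. cnj (x t) / N) \<omega> = (cmod (\<Sum>t\<in>T. cnj (x t) * \<xi> \<omega> t))\<^sup>2 / N\<^sup>2"
      by (simp add: quad_def sum_divide_distrib[symmetric] norm_divide power_divide)
    ultimately show "(cmod (\<Sum>t\<in>T. cnj (x t) * \<xi> \<omega> t))\<^sup>2 \<le> N\<^sup>2 * (2 + 2 * L)"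
      using assms(2) by (simp add: field_simps)
  qed simp
qed

end

locale cgauss_noise = cgauss_family M \<xi> U for M :: "'a measure" and \<xi> :: "'a \<Rightarrow> int \<Rightarrow> complex" and U
begin

lemma whp_wdft:
  assumes "T \<subseteq> U" "T \<subseteq> {c..<c + int D}" "0 < D" "0 < \<beta>" "\<And>j. j < D \<Longrightarrow> 0 \<le> d j \<and> d j \<le> \<beta>"
  shows "whp (exp (- L)) (\<lambda>\<omega>. (\<Sum>j<D. d j * (cmod (wdft D T (\<xi> \<omega>) j))\<^sup>2) \<le> 2 * (\<Sum>j<D. d j) + 2 * \<beta> * L)"
proof -
  have "whp (exp (- L)) (\<lambda>\<omega>. quad T {..<D} d (\<lambda>j t. cnj (dchar D j t) / sqrt (real D)) \<omega> \<le> 2 * (\<Sum>j<D. d j) + 2 * \<beta> * L)"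
    using assms by (intro whp_quad bessel_window_cnj[OF assms(2,3)]) auto
  then show ?thesis by (simp add: quad_def wdft_def)
qed

lemma whp_block_gain:
  assumes "{h - 2 * int p..h + 2 * int p} \<subseteq> U" "I \<subseteq> {h - int p..h + int p}" "s \<ge> 1" "9 * s \<le> p" "p \<le> n"
    and b: "b = ln (9 * exp 4 * real s)" and l: "l = ln (real (2 * n + 1))"
  shows "whp (2 * exp (- L)) (\<lambda>\<omega>. \<forall>S. S \<subseteq> {..<2 * p + 1} \<longrightarrow> card S = 18 * s \<longrightarrow>
     (\<Sum>j<4 * p + 1. (\<Sum>k\<in>S. kappa p j k) * (cmod (wdft (4 * p + 1) {h - 2 * int p..h + 2 * int p} (\<xi> \<omega>) j))\<^sup>2)
      + (\<Sum>j<4 * p + 1. (\<Sum>k\<in>S. kappa p j k) * (cmod (wdft (4 * p + 1) I (\<xi> \<omega>) j))\<^sup>2)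
     \<le> 72 * real s * (12 + 4 * l) + 8 * b * (18 * real s * l + L))"
proof -
  let ?D = "4 * p + 1" and ?W = "{h - 2 * int p..h + 2 * int p}" and ?m = "18 * s"
  \<comment> \<open>The additional \<open>18 s l\<close> pays for the union over supports, whose
    number is at most (2n + 1)^(18 s).\<close>
  define L' where "L' = L + 18 * real s * l"
  define F where "F = {S. S \<subseteq> {..<2 * p + 1} \<and> card S = ?m}"
  define Q where "Q T S \<omega> \<longleftrightarrow> (\<Sum>j<?D. (\<Sum>k\<in>S. kappa p j k) * (cmod (wdft ?D T (\<xi> \<omega>) j))\<^sup>2)
     \<le> 36 * real s * (12 + 4 * l) + 2 * (2 * b) * L'" for T S \<omega>
  have finF: "finite F" unfolding F_def by simp
  have b0: "b > 0"
  proof -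
    have "1 < 9 * exp 4 * real s"
      using assms(3) by (intro less_le_trans[OF _ mult_mono[of 9 "9 * exp 4" 1 "real s"]]) auto
    then show ?thesis unfolding b by (rule ln_gt_zero)
  qed
  have Q: "whp (exp (- L')) (Q T S)" if T: "T \<subseteq> ?W" and S: "S \<in> F" for T S
  proof -
    have "whp (exp (- L')) (\<lambda>\<omega>. (\<Sum>j<?D. (\<Sum>k\<in>S. kappa p j k) * (cmod (wdft ?D T (\<xi> \<omega>) j))\<^sup>2)
        \<le> 2 * (\<Sum>j<?D. \<Sum>k\<in>S. kappa p j k) + 2 * (2 * b) * L')"
    proof (rule whp_wdft[where c = "h - 2 * int p"])
      show "0 \<le> (\<Sum>k\<in>S. kappa p j k) \<and> (\<Sum>k\<in>S. kappa p j k) \<le> 2 * b" for j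
        using S assms(3) sum_kappa_sparse[of S p s j] by (auto simp: F_def b intro!: sum_nonneg)
    qed (use T assms(1) b0 in auto)
    moreover have "2 * (\<Sum>j<?D. \<Sum>k\<in>S. kappa p j k) \<le> 36 * real s * (12 + 4 * l)"
    proof -
      have "(\<Sum>j<?D. \<Sum>k\<in>S. kappa p j k) = (\<Sum>k\<in>S. \<Sum>j<?D. kappa p j k)" by (rule sum.swap)
      also have "\<dots> \<le> (\<Sum>k\<in>S. 12 + 4 * l)"
      proof (rule sum_mono)
        fix k
        have "ln (real (2 * p + 1)) \<le> l" using assms(5) by (simp add: l)
        then show "(\<Sum>j<?D. kappa p j k) \<le> 12 + 4 * l"
          using sum_kappa_frequencies[of p k] by linarith
      qed
      also have "\<dots> = 18 * real s * (12 + 4 * l)" using S by (simp add: F_def)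
      finally show ?thesis by linarith
    qed
    ultimately show ?thesis unfolding Q_def by (elim whp_mono) auto
  qed
  have IW: "I \<subseteq> ?W" using assms(2) by (rule order_trans) auto
  have card_F: "real (card F) * exp (- L') \<le> exp (- L)"
  proof -
    have "card F = (2 * p + 1) choose ?m"
      unfolding F_def by (subst n_subsets) auto
    also have "\<dots> \<le> (2 * p + 1) ^ ?m" using assms(4) by (intro binomial_le_pow) auto
    also have "\<dots> \<le> (2 * n + 1) ^ ?m" using assms(5) by (intro power_mono) auto
    finally have "real (card F) \<le> real (2 * n + 1) ^ ?m"
      by (metis of_nat_le_iff of_nat_power)
    also have "\<dots> = exp (real ?m * l)" unfolding l by (subst exp_of_nat_mult) simp
    finally have "real (card F) * exp (- L') \<le> exp (real ?m * l) * exp (- L')"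
      by (rule mult_right_mono) simp
    then show ?thesis by (simp add: mult_exp_exp L'_def)
  qed
  have "whp (exp (- L)) (\<lambda>\<omega>. \<forall>S\<in>F. Q T S \<omega>)" if "T \<subseteq> ?W" for T
    by (rule whp_mono[OF whp_ball[OF finF Q[OF that]] card_F])
  from whp_conj[OF this[OF order_refl] this[OF IW]] show ?thesis
  proof (rule whp_mono)
    fix \<omega> assume q: "(\<forall>S\<in>F. Q ?W S \<omega>) \<and> (\<forall>S\<in>F. Q I S \<omega>)"
    have "(\<Sum>j<?D. (\<Sum>k\<in>S. kappa p j k) * (cmod (wdft ?D ?W (\<xi> \<omega>) j))\<^sup>2)
      + (\<Sum>j<?D. (\<Sum>k\<in>S. kappa p j k) * (cmod (wdft ?D I (\<xi> \<omega>) j))\<^sup>2)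
      \<le> 72 * real s * (12 + 4 * l) + 8 * b * (18 * real s * l + L)" if "S \<subseteq> {..<2 * p + 1}" "card S = ?m" for S
    proof -
      have "S \<in> F" using that by (simp add: F_def)
      then have "Q ?W S \<omega>" "Q I S \<omega>" using q by auto
      moreover have "8 * b * (18 * real s * l + L) = 2 * (2 * (2 * b) * L')"
        by (simp add: L'_def algebra_simps)
      ultimately show ?thesis unfolding Q_def by linarith
    qed
    then show "\<forall>S. S \<subseteq> {..<2 * p + 1} \<longrightarrow> card S = ?m \<longrightarrow>
      (\<Sum>j<?D. (\<Sum>k\<in>S. kappa p j k) * (cmod (wdft ?D ?W (\<xi> \<omega>) j))\<^sup>2)
      + (\<Sum>j<?D. (\<Sum>k\<in>S. kappa p j k) * (cmod (wdft ?D I (\<xi> \<omega>) j))\<^sup>2)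
      \<le> 72 * real s * (12 + 4 * l) + 8 * b * (18 * real s * l + L)" by blast
  qed simp
qed

text \<open>The filter is deterministic, so there is no union over supports. The three events are
  the forms on the two windows and the energy at the endpoint that a half-open block lacks. The
  noise energy of the block keeps coefficient one, ready to cancel.\<close>

lemma whp_block_loss:
  assumes W: "{h - 2 * int p..h + 2 * int p} \<subseteq> U" and I: "I \<subseteq> {h - int p..h + int p}"
    and card: "card ({h - int p..h + int p} - I) \<le> 1"
    and \<phi>: "supp_in p \<phi>" "\<And>j. cmod (fhat (4 * p + 1) p \<phi> j) \<le> 1"
      "(\<Sum>j<4 * p + 1. cmod (fhat (4 * p + 1) p \<phi> j)) \<le> 4 * real s"
  shows "whp (3 * exp (- L)) (\<lambda>\<omega>. (\<Sum>t\<in>{h - int p..h + int p}. (cmod (\<xi> \<omega> t - conv \<phi> (\<xi> \<omega>) t))\<^sup>2)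
     \<le> (\<Sum>t\<in>I. (cmod (\<xi> \<omega> t))\<^sup>2) + 24 * real s + 8 * L + 2)"
proof -
  let ?D = "4 * p + 1" and ?W = "{h - 2 * int p..h + 2 * int p}" and ?J = "{h - int p..h + int p}"
  let ?q = "\<lambda>T \<omega>. \<Sum>j<?D. cmod (fhat ?D p \<phi> j) * (cmod (wdft ?D T (\<xi> \<omega>) j))\<^sup>2"
  have q: "whp (exp (- L)) (\<lambda>\<omega>. ?q T \<omega> \<le> 8 * real s + 2 * L)" if T: "T \<subseteq> ?W" for T
  proof -
    have "whp (exp (- L)) (\<lambda>\<omega>. ?q T \<omega> \<le> 2 * (\<Sum>j<?D. cmod (fhat ?D p \<phi> j)) + 2 * 1 * L)"
      by (rule whp_wdft[where c = "h - 2 * int p"]) (use T W \<phi>(2) in auto)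
    then show ?thesis by (rule whp_mono) (use \<phi>(3) in linarith)+
  qed
  have JW: "?J \<subseteq> ?W" by auto
  have e: "whp (exp (- L)) (\<lambda>\<omega>. (\<Sum>t\<in>?J - I. (cmod (\<xi> \<omega> t))\<^sup>2) \<le> 2 + 2 * L)"
  proof (rule whp_mono[OF whp_noise_energy[of "?J - I"]])
    have "2 * real (card (?J - I)) \<le> 2" using card by simp
    then show "(\<Sum>t\<in>?J - I. (cmod (\<xi> \<omega> t))\<^sup>2) \<le> 2 + 2 * L"
      if "(\<Sum>t\<in>?J - I. (cmod (\<xi> \<omega> t))\<^sup>2) \<le> 2 * real (card (?J - I)) + 2 * L" for \<omega>
      using that by linarith
  qed (use JW W in auto)
  have "whp (exp (- L) + (exp (- L) + exp (- L))) (\<lambda>\<omega>. ?q ?W \<omega> \<le> 8 * real s + 2 * L \<and>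
      ?q ?J \<omega> \<le> 8 * real s + 2 * L \<and> (\<Sum>t\<in>?J - I. (cmod (\<xi> \<omega> t))\<^sup>2) \<le> 2 + 2 * L)"
    by (intro whp_conj q e JW order_refl)
  then show ?thesis
  proof (rule whp_mono)
    fix \<omega> assume *: "?q ?W \<omega> \<le> 8 * real s + 2 * L \<and> ?q ?J \<omega> \<le> 8 * real s + 2 * L \<and>
      (\<Sum>t\<in>?J - I. (cmod (\<xi> \<omega> t))\<^sup>2) \<le> 2 + 2 * L"
    have "(\<Sum>t\<in>?J. (cmod (\<xi> \<omega> t))\<^sup>2) = (\<Sum>t\<in>?J - I. (cmod (\<xi> \<omega> t))\<^sup>2) + (\<Sum>t\<in>I. (cmod (\<xi> \<omega> t))\<^sup>2)"
      by (rule sum.subset_diff[OF I]) simp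
    then show "(\<Sum>t\<in>?J. (cmod (\<xi> \<omega> t - conv \<phi> (\<xi> \<omega>) t))\<^sup>2) \<le> (\<Sum>t\<in>I. (cmod (\<xi> \<omega> t))\<^sup>2) + 24 * real s + 8 * L + 2"
      using * block_loss_le[OF \<phi>(1,2), where h = h and v = "\<xi> \<omega>"] by linarith
  qed simp
qed

end

section \<open>The triadic covering of the domain\<close>

text \<open>Signed block indices: \<open>0\<close> is the central window, \<open>k\<close> and \<open>-k\<close> stand for \<open>(k, +)\<close> and \<open>(k, -)\<close>.\<close>

definition half_width :: "nat \<Rightarrow> int \<Rightarrow> nat" where
  "half_width n i = nk n (nat \<bar>i\<bar>)"

definition centre :: "nat \<Rightarrow> int \<Rightarrow> int" where
  "centre n i = (if i < 0 then - hk n (nat \<bar>i\<bar>) else hk n (nat \<bar>i\<bar>))"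

definition block :: "nat \<Rightarrow> int \<Rightarrow> int set" where
  "block n i = (if i = 0 then {- int n..int n} else if i < 0 then Ineg n (nat \<bar>i\<bar>) else Ipos n (nat \<bar>i\<bar>))"

definition block_filter :: "((int \<Rightarrow> complex) \<Rightarrow> (int \<Rightarrow> complex)) \<Rightarrow> (nat \<Rightarrow> (int \<Rightarrow> complex) \<Rightarrow> (int \<Rightarrow> complex))
    \<Rightarrow> (nat \<Rightarrow> (int \<Rightarrow> complex) \<Rightarrow> (int \<Rightarrow> complex)) \<Rightarrow> int \<Rightarrow> (int \<Rightarrow> complex) \<Rightarrow> int \<Rightarrow> complex" where
  "block_filter \<Phi>0 \<Phi>p \<Phi>m i y = (if i = 0 then \<Phi>0 y else if i < 0 then \<Phi>m (nat \<bar>i\<bar>) y else \<Phi>p (nat \<bar>i\<bar>) y)"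

lemma norm2_sq: "(norm2 p u)\<^sup>2 = (\<Sum>t\<in>{- int p..int p}. (cmod (u t))\<^sup>2)"
  unfolding norm2_def by (simp add: sum_nonneg)

lemma norm2_nonneg: "0 \<le> norm2 p u"
  unfolding norm2_def by (simp add: sum_nonneg)

text \<open>Isolates the arithmetic of powers of 3: the covering argument rests on half-widths that
  shrink by exact thirds from \<open>n\<close> down to \<open>9 * s\<close>.\<close>

locale triadic =
  fixes n s K :: nat
  assumes nk_0: "nk n 0 = n" and nk_Suc: "k < K \<Longrightarrow> nk n k = 3 * nk n (Suc k)"
    and nk_K: "nk n K = 9 * s" and Kidx_K: "Kidx n s = K"
begin

lemma nk_antimono: "k \<le> k' \<Longrightarrow> k' \<le> K \<Longrightarrow> nk n k' \<le> nk n k"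
proof (induction k' rule: dec_induct)
  case (step m)
  then show ?case using nk_Suc[of m] by simp
qed simp

lemma nk_bounds: "k \<le> K \<Longrightarrow> 9 * s \<le> nk n k \<and> nk n k \<le> n"
  using nk_antimono[of k K] nk_antimono[of 0 k] nk_K nk_0 by simp

lemma half_width_bounds: "\<bar>i\<bar> \<le> int K \<Longrightarrow> 9 * s \<le> half_width n i \<and> half_width n i \<le> n"
  unfolding half_width_def by (rule nk_bounds) simp

text \<open>Because the half-width is a third of the previous one, the left end of this block is the
  right end of the preceding one; the half-open blocks tile without overlap.\<close>

lemma Ipos_eq: "k < K \<Longrightarrow> Ipos n (Suc k) = {2 * int n - int (nk n k) <.. 2 * int n - int (nk n (Suc k))}"
  using nk_Suc[of k] by (auto simp: Ipos_def hk_def)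

lemma Ineg_eq: "k < K \<Longrightarrow> Ineg n (Suc k) = {- (2 * int n - int (nk n (Suc k))) ..< - (2 * int n - int (nk n k))}"
  using nk_Suc[of k] by (auto simp: Ineg_def hk_def)

text \<open>Makes the \<open>SOME\<close> in \<open>xfull\<close> select the intended block.\<close>

lemma Ipos_unique:
  assumes "k \<in> {1..K}" "k' \<in> {1..K}" "t \<in> Ipos n k" "t \<in> Ipos n k'"
  shows "k = k'"
proof -
  have "\<not> k < k'" if kk: "k \<in> {1..K}" "k' \<in> {1..K}" "t \<in> Ipos n k" "t \<in> Ipos n k'" for k k'
  proof
    assume lt: "k < k'"
    obtain l l' where l: "k = Suc l" "k' = Suc l'" using kk by (cases k; cases k') auto
    then have "nk n l' \<le> nk n k" using lt kk by (intro nk_antimono) auto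
    then show False using kk l Ipos_eq[of l] Ipos_eq[of l'] by auto
  qed
  from this[OF assms] this[OF assms(2,1,4,3)] show ?thesis by linarith
qed

lemma Ineg_reflect: "t \<in> Ineg n k \<longleftrightarrow> - t \<in> Ipos n k"
  by (auto simp: Ineg_def Ipos_def)

lemma Ipos_range:
  assumes "k \<in> {1..K}" "t \<in> Ipos n k"
  shows "int n < t \<and> t \<le> 2 * int n - 9 * int s"
proof -
  obtain l where l: "k = Suc l" using assms(1) by (cases k) auto
  have "t > 2 * int n - int (nk n l)" "t \<le> 2 * int n - int (nk n k)"
    using assms l Ipos_eq[of l] by auto
  moreover have "nk n l \<le> n" "9 * s \<le> nk n k" using assms l nk_bounds[of l] nk_bounds[of k] by auto
  ultimately show ?thesis by linarith
qed

lemma xfull_block: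
  assumes "\<bar>i\<bar> \<le> int K" "t \<in> block n i"
  shows "xfull n s \<Phi>0 \<Phi>p \<Phi>m y t = conv (block_filter \<Phi>0 \<Phi>p \<Phi>m i y) y t"
proof -
  define k where "k = nat \<bar>i\<bar>"
  consider "i = 0" | "i > 0" | "i < 0" by linarith
  then show ?thesis
  proof cases
    case 1
    then show ?thesis using assms(2) by (auto simp: block_def xfull_def block_filter_def)
  next
    case 2
    then have k: "k \<in> {1..Kidx n s}" "t \<in> Ipos n k" using assms by (auto simp: k_def block_def Kidx_K)
    have "(SOME k. k \<in> {1..Kidx n s} \<and> t \<in> Ipos n k) = k"
      using k Ipos_unique Kidx_K by (intro some_equality) auto
    then show ?thesis
      using Ipos_range[of k t] k 2 unfolding xfull_def block_filter_def Kidx_K k_def by auto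
  next
    case 3
    then have k: "k \<in> {1..Kidx n s}" "t \<in> Ineg n k" using assms by (auto simp: k_def block_def Kidx_K)
    have some: "(SOME k. k \<in> {1..Kidx n s} \<and> t \<in> Ineg n k) = k"
      using k Ipos_unique Kidx_K by (intro some_equality) (auto simp: Ineg_reflect)
    have r: "int n < - t" "- t \<le> 2 * int n - 9 * int s"
      using Ipos_range[of k "- t"] k Kidx_K by (auto simp: Ineg_reflect)
    have "\<not> (\<exists>k\<in>{1..Kidx n s}. t \<in> Ipos n k)"
      using Ipos_range[of _ t] r Kidx_K by fastforce
    moreover have "\<exists>k\<in>{1..Kidx n s}. t \<in> Ineg n k" using k by blast
    ultimately show ?thesis
      using r 3 some by (simp add: xfull_def block_filter_def k_def)
  qed
qed

lemma xfull_edge: "n < \<bar>t\<bar> \<Longrightarrow> 2 * int n - 9 * int s < \<bar>t\<bar> \<Longrightarrow> xfull n s \<Phi>0 \<Phi>p \<Phi>m y t = y t"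
  by (simp add: xfull_def)

lemma sum_blocks:
  fixes f :: "int \<Rightarrow> real"
  assumes "k \<le> K"
  shows "(\<Sum>t\<in>{- (2 * int n - int (nk n k))..2 * int n - int (nk n k)}. f t) = (\<Sum>i\<in>{- int k..int k}. \<Sum>t\<in>block n i. f t)"
  using assms
proof (induction k)
  case 0
  then show ?case by (simp add: block_def nk_0)
next
  case (Suc k)
  let ?C = "\<lambda>k. {- (2 * int n - int (nk n k))..2 * int n - int (nk n k)}"
  have le: "nk n (Suc k) \<le> nk n k" "nk n k \<le> n" using Suc.prems nk_antimono[of k "Suc k"] nk_bounds[of k] by auto
  have k: "k < K" using Suc.prems by simp
  have C: "?C (Suc k) = ?C k \<union> (Ineg n (Suc k) \<union> Ipos n (Suc k))"
    unfolding Ipos_eq[OF k] Ineg_eq[OF k] using le by auto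
  have disj: "?C k \<inter> (Ineg n (Suc k) \<union> Ipos n (Suc k)) = {}" "Ineg n (Suc k) \<inter> Ipos n (Suc k) = {}"
    unfolding Ipos_eq[OF k] Ineg_eq[OF k] using le by auto
  have fin: "finite (Ineg n (Suc k))" "finite (Ipos n (Suc k))" by (auto simp: Ineg_def Ipos_def)
  have "sum f (?C (Suc k)) = sum f (?C k) + (sum f (Ineg n (Suc k)) + sum f (Ipos n (Suc k)))"
    unfolding C using fin disj by (simp add: sum.union_disjoint)
  also have "sum f (?C k) = (\<Sum>i\<in>{- int k..int k}. \<Sum>t\<in>block n i. f t)" using Suc by simp
  also have "{- int (Suc k)..int (Suc k)} = insert (- int (Suc k)) (insert (int (Suc k)) {- int k..int k})" by auto
  then have "(\<Sum>i\<in>{- int k..int k}. \<Sum>t\<in>block n i. f t) + (sum f (Ineg n (Suc k)) + sum f (Ipos n (Suc k)))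
      = (\<Sum>i\<in>{- int (Suc k)..int (Suc k)}. \<Sum>t\<in>block n i. f t)"
    by (simp add: block_def nat_add_distrib)
  finally show ?case .
qed

text \<open>Here the estimate equals the data, so the residual is zero and the statistic retains the
  full energy of these few points.\<close>

definition edge :: "int set" where
  "edge = {t. 2 * int n - 9 * int s < \<bar>t\<bar> \<and> \<bar>t\<bar> \<le> 2 * int n}"

lemma card_edge: "card edge = 18 * s" and edge_subset: "edge \<subseteq> {- int (2 * n)..int (2 * n)}"
  and finite_edge: "finite edge"
proof -
  have le: "9 * s \<le> n" using nk_bounds[of K] nk_K by simp
  have e: "edge = {- 2 * int n..< - 2 * int n + 9 * int s} \<union> {2 * int n - 9 * int s<..2 * int n}"
    using le unfolding edge_def by auto
  show "finite edge" unfolding e by simp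
  show "card edge = 18 * s" unfolding e using le by (subst card_Un_disjoint) auto
  show "edge \<subseteq> {- int (2 * n)..int (2 * n)}" by (auto simp: edge_def)
qed

lemma sum_decompose:
  fixes f :: "int \<Rightarrow> real"
  shows "(\<Sum>t\<in>{- int (2 * n)..int (2 * n)}. f t) = (\<Sum>i\<in>{- int K..int K}. \<Sum>t\<in>block n i. f t) + (\<Sum>t\<in>edge. f t)"
proof -
  have le: "9 * s \<le> n" using nk_bounds[of K] nk_K by simp
  let ?C = "{- (2 * int n - int (nk n K))..2 * int n - int (nk n K)}"
  have "{- int (2 * n)..int (2 * n)} = ?C \<union> edge" "?C \<inter> edge = {}"
    using le by (auto simp: edge_def nk_K)
  then have "(\<Sum>t\<in>{- int (2 * n)..int (2 * n)}. f t) = sum f ?C + sum f edge"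
    using finite_edge by (simp add: sum.union_disjoint)
  then show ?thesis using sum_blocks[OF order_refl, of f] by simp
qed

lemma Tstat_decompose:
  "Tstat n s \<Phi>0 \<Phi>p \<Phi>m y =
     (\<Sum>i\<in>{- int K..int K}. \<Sum>t\<in>block n i. (cmod (y t))\<^sup>2 - (cmod (y t - conv (block_filter \<Phi>0 \<Phi>p \<Phi>m i y) y t))\<^sup>2)
     + (\<Sum>t\<in>edge. (cmod (y t))\<^sup>2)"
proof -
  let ?x = "xfull n s \<Phi>0 \<Phi>p \<Phi>m y"
  have le: "9 * s \<le> n" using nk_bounds[of K] nk_K by simp
  have "Tstat n s \<Phi>0 \<Phi>p \<Phi>m y = (\<Sum>t\<in>{- int (2 * n)..int (2 * n)}. (cmod (y t))\<^sup>2 - (cmod (y t - ?x t))\<^sup>2)"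
    unfolding Tstat_def norm2_sq by (simp add: sum_subtractf)
  also have "\<dots> = (\<Sum>i\<in>{- int K..int K}. \<Sum>t\<in>block n i. (cmod (y t))\<^sup>2 - (cmod (y t - ?x t))\<^sup>2)
      + (\<Sum>t\<in>edge. (cmod (y t))\<^sup>2 - (cmod (y t - ?x t))\<^sup>2)"
    by (rule sum_decompose)
  also have "(\<Sum>i\<in>{- int K..int K}. \<Sum>t\<in>block n i. (cmod (y t))\<^sup>2 - (cmod (y t - ?x t))\<^sup>2)
     = (\<Sum>i\<in>{- int K..int K}. \<Sum>t\<in>block n i. (cmod (y t))\<^sup>2 - (cmod (y t - conv (block_filter \<Phi>0 \<Phi>p \<Phi>m i y) y t))\<^sup>2)"
    by (intro sum.cong refl, subst xfull_block) auto
  also have "(\<Sum>t\<in>edge. (cmod (y t))\<^sup>2 - (cmod (y t - ?x t))\<^sup>2) = (\<Sum>t\<in>edge. (cmod (y t))\<^sup>2)"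
    using le by (intro sum.cong refl, subst xfull_edge) (auto simp: edge_def)
  finally show ?thesis .
qed

text \<open>The centre has distance \<open>2p\<close> from the nearer end of the domain, so the
  window seen by the convolution ends exactly there and no unobserved sample enters.\<close>

lemma block_geometry:
  assumes "\<bar>i\<bar> \<le> int K"
  defines "p \<equiv> int (half_width n i)" and "h \<equiv> centre n i"
  shows "{h - 2 * p..h + 2 * p} \<subseteq> {- int (2 * n)..int (2 * n)}"
    and "block n i \<subseteq> {h - p..h + p}" and "card ({h - p..h + p} - block n i) \<le> 1"
proof -
  have pn: "p \<le> int n" using half_width_bounds[OF assms(1)] by (simp add: p_def)
  have h: "h = (if i < 0 then - (2 * int n - 2 * p) else 2 * int n - 2 * p)"
    by (simp add: h_def p_def centre_def half_width_def hk_def)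
  show "{h - 2 * p..h + 2 * p} \<subseteq> {- int (2 * n)..int (2 * n)}" using pn h by auto
  have b: "block n i = (if i = 0 then {h - p..h + p} else if i < 0 then {h - p..<h + p} else {h - p<..h + p})"
    using nk_0 by (simp add: block_def h_def p_def centre_def half_width_def Ineg_def Ipos_def hk_def)
  then show "block n i \<subseteq> {h - p..h + p}" by auto
  have "{h - p..h + p} - block n i \<subseteq> (if i < 0 then {h + p} else {h - p})"
    using b by auto
  then have "card ({h - p..h + p} - block n i) \<le> card (if i < 0 then {h + p} else {h - p})"
    by (intro card_mono) auto
  then show "card ({h - p..h + p} - block n i) \<le> 1" by (simp split: if_splits)
qed

lemma block_filter_feasible:
  assumes "\<bar>i\<bar> \<le> int K" "is_min0 n s y (\<Phi>0 y)"
    and "\<And>k. k \<in> {1..K} \<Longrightarrow> is_mink n s k True y (\<Phi>p k y)"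
    and "\<And>k. k \<in> {1..K} \<Longrightarrow> is_mink n s k False y (\<Phi>m k y)"
  shows "feasible s (half_width n i) (block_filter \<Phi>0 \<Phi>p \<Phi>m i y)"
proof -
  have "nat \<bar>i\<bar> \<in> {1..K}" if "i \<noteq> 0" using that assms(1) by auto
  then show ?thesis
    using assms(2) assms(3,4)[of "nat \<bar>i\<bar>"] nk_0
    by (auto simp: half_width_def block_filter_def is_min0_def is_mink_def Let_def)
qed

text \<open>The comparison is made on the closed window over which the filter was fitted; the block
  may lack one of its endpoints.\<close>

lemma block_filter_optimal:
  assumes "\<bar>i\<bar> \<le> int K" "is_min0 n s y (\<Phi>0 y)"
    and "\<And>k. k \<in> {1..K} \<Longrightarrow> is_mink n s k True y (\<Phi>p k y)"
    and "\<And>k. k \<in> {1..K} \<Longrightarrow> is_mink n s k False y (\<Phi>m k y)"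
    and "feasible s (half_width n i) \<psi>"
  defines "p \<equiv> int (half_width n i)" and "h \<equiv> centre n i"
  shows "(\<Sum>t\<in>{h - p..h + p}. (cmod (y t - conv (block_filter \<Phi>0 \<Phi>p \<Phi>m i y) y t))\<^sup>2)
     \<le> (\<Sum>t\<in>{h - p..h + p}. (cmod (y t - conv \<psi> y t))\<^sup>2)"
proof -
  define \<phi> where "\<phi> = block_filter \<Phi>0 \<Phi>p \<Phi>m i y"
  have i: "nat \<bar>i\<bar> \<in> {1..K}" if "i \<noteq> 0" using that assms(1) by auto
  have "norm2 (half_width n i) (\<lambda>t. resid \<phi> y (t + h)) \<le> norm2 (half_width n i) (\<lambda>t. resid \<psi> y (t + h))"
  proof (cases "i = 0")
    case True
    then show ?thesis using assms(2,5) nk_0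
      by (simp add: \<phi>_def half_width_def block_filter_def is_min0_def h_def centre_def hk_def)
  next
    case False
    then show ?thesis using assms(5) assms(3,4)[OF i[OF False]]
      by (auto simp: \<phi>_def half_width_def block_filter_def is_mink_def Let_def h_def centre_def)
  qed
  then have "(norm2 (half_width n i) (\<lambda>t. resid \<phi> y (t + h)))\<^sup>2 \<le> (norm2 (half_width n i) (\<lambda>t. resid \<psi> y (t + h)))\<^sup>2"
    by (intro power_mono norm2_nonneg)
  moreover have "(norm2 (half_width n i) (\<lambda>t. resid f y (t + h)))\<^sup>2 = (\<Sum>t\<in>{h - p..h + p}. (cmod (y t - conv f y t))\<^sup>2)" for f
    unfolding norm2_sq resid_def
    by (rule sum.reindex_bij_witness[of _ "\<lambda>t. t - h" "\<lambda>t. t + h"]) (auto simp: p_def norm_minus_commute)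
  ultimately show ?thesis by (simp add: \<phi>_def)
qed

end

lemma triadic_of_powers:
  assumes "n = 3 ^ a" "s = 3 ^ b" "n \<ge> 9 * s"
  shows "triadic n s (a - b - 2)" and "log 3 (real n / real s) = real (a - b - 2) + 2"
proof -
  have "(3::nat) ^ (b + 2) \<le> 3 ^ a" using assms by simp
  then have ab: "b + 2 \<le> a" by (simp only: power_increasing_iff)
  define K where "K = a - b - 2"
  have a: "a = K + (b + 2)" using ab by (simp add: K_def)
  have nk: "nk n k = 3 ^ (a - k)" if "k \<le> a" for k
    using that by (simp add: nk_def assms(1) power_diff)
  have "real n / (9 * real s) = 3 ^ K"
    unfolding assms a by (simp add: power_add field_simps)
  then have "log 3 (real n / (9 * real s)) = real K"
    by (simp add: log_nat_power)
  then have "Kidx n s = K" by (simp add: Kidx_def)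
  moreover have "nk n k = 3 * nk n (Suc k)" if "k < K" for k
    using that nk[of k] nk[of "Suc k"] by (simp add: a Suc_diff_le power_add flip: power_Suc)
  ultimately show "triadic n s (a - b - 2)"
    using nk[of 0] nk[of K] assms unfolding K_def[symmetric] by unfold_locales (auto simp: a)
  have "real n / real s = 3 ^ (K + 2)"
    unfolding assms a by (simp add: power_add field_simps)
  then have "log 3 (real n / real s) = real (K + 2)"
    using log_nat_power[of 3 3 "K + 2"] by simp
  then show "log 3 (real n / real s) = real (a - b - 2) + 2" by (simp add: K_def)
qed

section \<open>Error probabilities of the test\<close>

lemma conv_add_scaled:
  assumes "supp_in p u"
  shows "conv u (\<lambda>t. x t + c * v t) t = conv u x t + c * conv u v t"
  unfolding conv_finite[OF assms] by (simp add: distrib_left sum.distrib sum_distrib_left mult_ac)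

lemma wdft_scaled:
  assumes "\<And>t. t \<in> W \<Longrightarrow> y t = c * v t"
  shows "wdft D W y j = c * wdft D W v j"
  unfolding wdft_def sum_distrib_left using assms by (intro sum.cong refl) (simp add: mult_ac)

text \<open>Young's inequality in squared form: (A - B)^2 \<ge> 0 with A = N^2/8 and B = 8
  \<sigma>^2 q.\<close>

lemma twice_product_le:
  fixes w N q \<sigma> :: real
  assumes "w\<^sup>2 \<le> N\<^sup>2 * q" "0 \<le> q"
  shows "2 * \<sigma> * w \<le> N\<^sup>2 / 8 + 8 * \<sigma>\<^sup>2 * q"
proof -
  have "(2 * \<sigma> * w)\<^sup>2 \<le> 4 * \<sigma>\<^sup>2 * (N\<^sup>2 * q)"
    using mult_left_mono[OF assms(1), of "4 * \<sigma>\<^sup>2"] by (simp add: power_mult_distrib)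
  also have "\<dots> \<le> 4 * \<sigma>\<^sup>2 * (N\<^sup>2 * q) + (N\<^sup>2 / 8 - 8 * \<sigma>\<^sup>2 * q)\<^sup>2" by simp
  also have "\<dots> = (N\<^sup>2 / 8 + 8 * \<sigma>\<^sup>2 * q)\<^sup>2" by (simp add: power2_eq_square algebra_simps)
  finally have "(2 * \<sigma> * w)\<^sup>2 \<le> (N\<^sup>2 / 8 + 8 * \<sigma>\<^sup>2 * q)\<^sup>2" .
  then show ?thesis
    by (rule power2_le_imp_le) (use assms(2) in simp)
qed

locale detection = cgauss_noise M \<xi> "{- 2 * int n..2 * int n}" + triadic n s K
  for M :: "'a measure" and \<xi> and n s K :: nat +
  fixes \<Phi>0 :: "(int \<Rightarrow> complex) \<Rightarrow> (int \<Rightarrow> complex)" and \<Phi>p \<Phi>m :: "nat \<Rightarrow> (int \<Rightarrow> complex) \<Rightarrow> (int \<Rightarrow> complex)"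
    and \<sigma> \<delta> :: real
  assumes s_pos: "s \<ge> 1" and \<sigma>_pos: "\<sigma> > 0" and \<delta>_pos: "0 < \<delta>" and \<delta>_less: "\<delta> < 1"
    and levels: "log 3 (real n / real s) = real K + 2"
    and min0: "\<And>y. is_min0 n s y (\<Phi>0 y)"
    and minp: "\<And>k y. k \<in> {1..K} \<Longrightarrow> is_mink n s k True y (\<Phi>p k y)"
    and minm: "\<And>k y. k \<in> {1..K} \<Longrightarrow> is_mink n s k False y (\<Phi>m k y)"
begin

definition \<Lambda> where "\<Lambda> = real K + 2"
definition L where "L = ln (6 * \<Lambda> / \<delta>)"
definition l where "l = ln (real (2 * n + 1))"
definition b where "b = ln (9 * exp 4 * real s)"
definition lam where "lam = ln (9 * exp 3 * real s)"
definition R where "R = 6 * real s + 3 * real s * l + lam * L"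

lemma r0sq_eq: "r0sq n s \<sigma> \<delta> = 128 * cstar\<^sup>2 * \<sigma>\<^sup>2 * R * b * \<Lambda>"
  unfolding r0sq_def levels R_def L_def l_def b_def lam_def \<Lambda>_def by simp

lemma b_ge: "b \<ge> 1" and lam_ge: "lam \<ge> 1" and l_ge: "l \<ge> 0" and L_ge: "L \<ge> 0"
proof -
  have "ln 9 \<ge> (0::real)" "ln (real s) \<ge> 0" using s_pos by auto
  moreover have "b = ln 9 + 4 + ln (real s)" "lam = ln 9 + 3 + ln (real s)"
    unfolding b_def lam_def using s_pos by (simp_all add: ln_mult)
  ultimately show "b \<ge> 1" "lam \<ge> 1" by simp_all
  show "l \<ge> 0" by (simp add: l_def)
  have "\<delta> \<le> 6 * \<Lambda>" using \<delta>_less by (simp add: \<Lambda>_def)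
  then show "L \<ge> 0" unfolding L_def using \<delta>_pos by (intro ln_ge_zero) (simp add: \<Lambda>_def)
qed

lemma R_bounds: "6 * real s + L \<le> R" "R > 0"
proof -
  have "1 * L \<le> lam * L" using lam_ge L_ge by (intro mult_right_mono) auto
  moreover have "0 \<le> 3 * real s * l" using l_ge by simp
  ultimately show "6 * real s + L \<le> R" unfolding R_def by linarith
  then show "R > 0" using s_pos L_ge by linarith
qed

lemma exp_L: "exp (- L) = \<delta> / (6 * \<Lambda>)"
proof -
  have "6 * \<Lambda> / \<delta> > 0" using \<delta>_pos by (simp add: \<Lambda>_def)
  then show ?thesis unfolding L_def exp_minus by (simp add: field_simps)
qed

lemma error_budget:
  assumes "c \<le> 6 * \<Lambda>"
  shows "c * exp (- L) \<le> \<delta>"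
proof -
  have "\<Lambda> > 0" by (simp add: \<Lambda>_def)
  have "c * exp (- L) \<le> 6 * \<Lambda> * (\<delta> / (6 * \<Lambda>))"
    unfolding exp_L using assms \<delta>_pos \<open>\<Lambda> > 0\<close> by (intro mult_right_mono) auto
  then show ?thesis using \<open>\<Lambda> > 0\<close> by simp
qed

lemma card_blocks: "real (card {- int K..int K}) = 2 * \<Lambda> - 3"
  by (simp add: \<Lambda>_def)

lemma window_le: "{- 2 * int n..2 * int n} = {- int (2 * n)..int (2 * n)}"
  by simp

lemma type_I_error:
  assumes x: "norm2 (2 * n) x = 0"
  shows "outer_prob_le M (\<lambda>\<omega>. Tstat n s \<Phi>0 \<Phi>p \<Phi>m (\<lambda>t. x t + complex_of_real \<sigma> * \<xi> \<omega> t) > 5 / 8 * r0sq n s \<sigma> \<delta>) \<delta>"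
proof -
  let ?N = "{- int K..int K}"
  define B where "B = 72 * real s * (12 + 4 * l) + 8 * b * (18 * real s * l + L)"
  let ?W = "\<lambda>i. {centre n i - 2 * int (half_width n i)..centre n i + 2 * int (half_width n i)}"
  let ?D = "\<lambda>i. 4 * half_width n i + 1"
  let ?G = "\<lambda>i \<omega>. \<forall>S. S \<subseteq> {..<2 * half_width n i + 1} \<longrightarrow> card S = 18 * s \<longrightarrow>
     (\<Sum>j<?D i. (\<Sum>k\<in>S. kappa (half_width n i) j k) * (cmod (wdft (?D i) (?W i) (\<xi> \<omega>) j))\<^sup>2)
      + (\<Sum>j<?D i. (\<Sum>k\<in>S. kappa (half_width n i) j k) * (cmod (wdft (?D i) (block n i) (\<xi> \<omega>) j))\<^sup>2) \<le> B"
  have x0: "x t = 0" if "t \<in> {- int (2 * n)..int (2 * n)}" for t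
  proof -
    have "(\<Sum>t\<in>{- int (2 * n)..int (2 * n)}. (cmod (x t))\<^sup>2) = 0"
      using x norm2_sq[of "2 * n" x] by simp
    then show ?thesis using that by (subst (asm) sum_nonneg_eq_0_iff) auto
  qed
  have G: "whp (2 * exp (- L)) (?G i)" if "i \<in> ?N" for i
  proof -
    have i: "\<bar>i\<bar> \<le> int K" using that by auto
    show ?thesis unfolding B_def
      using half_width_bounds[OF i] block_geometry(1,2)[OF i] s_pos
      by (intro whp_block_gain[where n = n]) (auto simp: b_def l_def)
  qed
  have E: "whp (exp (- L)) (\<lambda>\<omega>. (\<Sum>t\<in>edge. (cmod (\<xi> \<omega> t))\<^sup>2) \<le> 2 * real (card edge) + 2 * L)"
    using edge_subset by (intro whp_noise_energy) simp
  have "whp (real (card ?N) * (2 * exp (- L)) + exp (- L))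
     (\<lambda>\<omega>. (\<forall>i\<in>?N. ?G i \<omega>) \<and> (\<Sum>t\<in>edge. (cmod (\<xi> \<omega> t))\<^sup>2) \<le> 2 * real (card edge) + 2 * L)"
    by (rule whp_conj[OF whp_ball[OF _ G] E]) simp
  then show ?thesis
  proof (rule outer_prob_le_if_whp)
    have "(2 * (2 * \<Lambda> - 3) + 1) * exp (- L) \<le> \<delta>"
      by (rule error_budget) (simp add: \<Lambda>_def)
    then show "real (card ?N) * (2 * exp (- L)) + exp (- L) \<le> \<delta>"
      unfolding card_blocks by (simp add: algebra_simps)
  next
    fix \<omega> assume good: "(\<forall>i\<in>?N. ?G i \<omega>) \<and> (\<Sum>t\<in>edge. (cmod (\<xi> \<omega> t))\<^sup>2) \<le> 2 * real (card edge) + 2 * L"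
    define y where "y t = x t + complex_of_real \<sigma> * \<xi> \<omega> t" for t
    have y: "y t = of_real \<sigma> * \<xi> \<omega> t" if "t \<in> {- int (2 * n)..int (2 * n)}" for t
      using x0[OF that] by (simp add: y_def)
    have gain: "(\<Sum>t\<in>block n i. (cmod (y t))\<^sup>2 - (cmod (y t - conv (block_filter \<Phi>0 \<Phi>p \<Phi>m i y) y t))\<^sup>2) \<le> cstar * (\<sigma>\<^sup>2 * B)"
      if i': "i \<in> ?N" for i
    proof -
      have i: "\<bar>i\<bar> \<le> int K" using i' by auto
      note geo = block_geometry[OF i]
      have sub: "block n i \<subseteq> ?W i" using geo(2) by (rule order_trans) auto
      \<comment> \<open>The signal is known to vanish only for |t| \<le> 2n. The windows stay in
        that range, so there the transform of \<open>y\<close> is \<sigma> times that of the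
        noise.\<close>
      have w: "(cmod (wdft (?D i) W y j))\<^sup>2 = \<sigma>\<^sup>2 * (cmod (wdft (?D i) W (\<xi> \<omega>) j))\<^sup>2" if "W \<subseteq> ?W i" for W j
        using wdft_scaled[of W y "of_real \<sigma>" "\<xi> \<omega>" "?D i" j] y that geo(1)
        by (auto simp: norm_mult power_mult_distrib subset_iff)
      show ?thesis
      proof (rule block_gain_le[where h = "centre n i" and p = "half_width n i" and s = s])
        show "feasible s (half_width n i) (block_filter \<Phi>0 \<Phi>p \<Phi>m i y)"
          by (rule block_filter_feasible[where ?\<Phi>0.0 = \<Phi>0 and \<Phi>p = \<Phi>p and \<Phi>m = \<Phi>m and y = y, OF i min0 minp minm])
        fix S assume S: "S \<subseteq> {..<2 * half_width n i + 1}" "card S = 18 * s"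
        have "(\<Sum>j<?D i. (\<Sum>k\<in>S. kappa (half_width n i) j k) * (cmod (wdft (?D i) (?W i) (\<xi> \<omega>) j))\<^sup>2)
            + (\<Sum>j<?D i. (\<Sum>k\<in>S. kappa (half_width n i) j k) * (cmod (wdft (?D i) (block n i) (\<xi> \<omega>) j))\<^sup>2) \<le> B"
          using good i' S by blast
        from mult_left_mono[OF this, of "\<sigma>\<^sup>2"]
        show "(\<Sum>j<?D i. (\<Sum>k\<in>S. kappa (half_width n i) j k) * (cmod (wdft (?D i) (?W i) y j))\<^sup>2)
            + (\<Sum>j<?D i. (\<Sum>k\<in>S. kappa (half_width n i) j k) * (cmod (wdft (?D i) (block n i) y j))\<^sup>2) \<le> \<sigma>\<^sup>2 * B"
          unfolding w[OF order_refl] w[OF sub] by (simp only: distrib_left sum_distrib_left mult_ac zero_le_power2)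
      qed (use s_pos half_width_bounds[OF i] geo(2) in auto)
    qed
    have "(\<Sum>t\<in>edge. (cmod (y t))\<^sup>2) = \<sigma>\<^sup>2 * (\<Sum>t\<in>edge. (cmod (\<xi> \<omega> t))\<^sup>2)"
      unfolding sum_distrib_left using y edge_subset
      by (intro sum.cong refl) (auto simp: norm_mult power_mult_distrib subset_iff)
    also have "\<dots> \<le> \<sigma>\<^sup>2 * (36 * real s + 2 * L)"
      using good by (intro mult_left_mono) (auto simp: card_edge)
    finally have edge: "(\<Sum>t\<in>edge. (cmod (y t))\<^sup>2) \<le> \<sigma>\<^sup>2 * (36 * real s + 2 * L)" .
    have "Tstat n s \<Phi>0 \<Phi>p \<Phi>m y \<le> (\<Sum>i\<in>?N. cstar * (\<sigma>\<^sup>2 * B)) + \<sigma>\<^sup>2 * (36 * real s + 2 * L)"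
      unfolding Tstat_decompose by (intro add_mono sum_mono gain edge)
    also have "\<dots> = \<sigma>\<^sup>2 * ((2 * \<Lambda> - 3) * cstar * B + (36 * real s + 2 * L))"
      unfolding sum_constant card_blocks by (simp add: algebra_simps)
    also have "\<dots> \<le> \<sigma>\<^sup>2 * (80 * cstar\<^sup>2 * R * b * \<Lambda>)"
    proof (intro mult_left_mono)
      \<comment> \<open>The terms 864 s + 288 s l + 144 b s l are at most 144 b (6 s + 3 s l),
        matching the first two terms of \<open>R\<close>; the deviation 8 b L is absorbed by the
        term \<open>lam * L\<close>.\<close>
      have "B \<le> 144 * (b * R)"
      proof -
        have "864 * real s + 288 * (real s * l) \<le> b * (864 * real s + 288 * (real s * l))"
          using b_ge l_ge mult_right_mono[of 1 b "864 * real s + 288 * (real s * l)"] by simp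
        moreover have "b * (8 * L) \<le> b * (144 * (lam * L))"
        proof (rule mult_left_mono)
          have "1 * L \<le> lam * L" using lam_ge L_ge by (intro mult_right_mono) auto
          then show "8 * L \<le> 144 * (lam * L)" using L_ge by linarith
        qed (use b_ge in simp)
        ultimately show ?thesis by (simp add: B_def R_def algebra_simps)
      qed
      then have "cstar * B \<le> 144 * (cstar * (b * R))" using cstar_ge by simp
      then have "(2 * \<Lambda> - 3) * (cstar * B) \<le> (2 * \<Lambda> - 3) * (144 * (cstar * (b * R)))"
        by (intro mult_left_mono) (auto simp: \<Lambda>_def)
      moreover have "36 * real s + 2 * L \<le> 144 * (cstar * (b * R))"
      proof -
        have "1 * (1 * R) \<le> cstar * (b * R)"
          using cstar_ge b_ge R_bounds by (intro mult_mono) auto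
        then show ?thesis using R_bounds(1) L_ge by linarith
      qed
      ultimately have "(2 * \<Lambda> - 3) * cstar * B + (36 * real s + 2 * L) \<le> (2 * \<Lambda> - 2) * (144 * (cstar * (b * R)))"
        by (simp add: algebra_simps)
      also have "\<dots> \<le> 2 * \<Lambda> * (144 * (cstar * (b * R)))"
        using cstar_ge b_ge R_bounds by (intro mult_right_mono) auto
      \<comment> \<open>The target is 80 = 5/8 of 128, and one factor \<open>cstar\<close>, being at
        least 6, absorbs the constant 288.\<close>
      also have "\<dots> \<le> 80 * cstar\<^sup>2 * R * b * \<Lambda>"
      proof -
        have "6 * (cstar * (R * b * \<Lambda>)) \<le> cstar * (cstar * (R * b * \<Lambda>))"
          using cstar_ge b_ge R_bounds by (intro mult_right_mono) (auto simp: \<Lambda>_def)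
        moreover have "0 \<le> cstar * (R * b * \<Lambda>)"
          using cstar_ge b_ge R_bounds by (simp add: \<Lambda>_def)
        ultimately show ?thesis by (simp add: power2_eq_square mult_ac)
      qed
      finally show "(2 * \<Lambda> - 3) * cstar * B + (36 * real s + 2 * L) \<le> 80 * cstar\<^sup>2 * R * b * \<Lambda>" .
    qed simp
    finally have "Tstat n s \<Phi>0 \<Phi>p \<Phi>m y \<le> 5 / 8 * r0sq n s \<sigma> \<delta>"
      by (simp add: r0sq_eq mult_ac)
    then show "\<not> 5 / 8 * r0sq n s \<sigma> \<delta> < Tstat n s \<Phi>0 \<Phi>p \<Phi>m (\<lambda>t. x t + complex_of_real \<sigma> * \<xi> \<omega> t)"
      by (simp add: y_def[abs_def])
  qed
qed

lemma r0sq_pos: "r0sq n s \<sigma> \<delta> > 0"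
  unfolding r0sq_eq using \<sigma>_pos cstar_ge b_ge R_bounds by (simp add: \<Lambda>_def)

lemma type_II_error:
  assumes x: "in_Xs s x" and r: "(norm2 (2 * n) x)\<^sup>2 \<ge> r0sq n s \<sigma> \<delta>"
  shows "outer_prob_le M (\<lambda>\<omega>. Tstat n s \<Phi>0 \<Phi>p \<Phi>m (\<lambda>t. x t + complex_of_real \<sigma> * \<xi> \<omega> t) \<le> 5 / 8 * r0sq n s \<sigma> \<delta>) \<delta>"
proof -
  let ?N = "{- int K..int K}" and ?U = "{- int (2 * n)..int (2 * n)}"
  let ?J = "\<lambda>i. {centre n i - int (half_width n i)..centre n i + int (half_width n i)}"
  define N where "N = norm2 (2 * n) x"
  have N2: "N\<^sup>2 = (\<Sum>t\<in>?U. (cmod (x t))\<^sup>2)" unfolding N_def norm2_sq ..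
  have "N \<noteq> 0" using r r0sq_pos unfolding N_def[symmetric] by auto
  then have N_pos: "N > 0" using norm2_nonneg[of "2 * n" x] by (simp add: N_def)
  have "\<exists>\<phi>. feasible s p \<phi> \<and> (\<forall>t. conv \<phi> x t = x t) \<and> (\<forall>j. cmod (fhat (4 * p + 1) p \<phi> j) \<le> 1) \<and>
    (\<Sum>j<4 * p + 1. cmod (fhat (4 * p + 1) p \<phi> j)) \<le> 4 * real s" for p
    using feasible_reproducing_filter[OF x s_pos, of p] by metis
  then obtain \<phi> where \<phi>: "\<And>p. feasible s p (\<phi> p)" "\<And>p t. conv (\<phi> p) x t = x t"
    "\<And>p j. cmod (fhat (4 * p + 1) p (\<phi> p) j) \<le> 1"
    "\<And>p. (\<Sum>j<4 * p + 1. cmod (fhat (4 * p + 1) p (\<phi> p) j)) \<le> 4 * real s"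
    by metis
  have supp: "supp_in p (\<phi> p)" for p using \<phi>(1)[of p] by (simp add: feasible_def)
  define f where "f i = \<phi> (half_width n i)" for i
  define C where "C = 24 * real s + 8 * L + 2"
  let ?G = "\<lambda>i \<omega>. (\<Sum>t\<in>?J i. (cmod (\<xi> \<omega> t - conv (f i) (\<xi> \<omega>) t))\<^sup>2) \<le> (\<Sum>t\<in>block n i. (cmod (\<xi> \<omega> t))\<^sup>2) + C"
  have G: "whp (3 * exp (- L)) (?G i)" if "i \<in> ?N" for i
  proof -
    have i: "\<bar>i\<bar> \<le> int K" using that by auto
    have "whp (3 * exp (- L)) (\<lambda>\<omega>. (\<Sum>t\<in>?J i. (cmod (\<xi> \<omega> t - conv (f i) (\<xi> \<omega>) t))\<^sup>2)
       \<le> (\<Sum>t\<in>block n i. (cmod (\<xi> \<omega> t))\<^sup>2) + 24 * real s + 8 * L + 2)"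
      unfolding f_def using block_geometry[OF i] supp \<phi>(3,4)
      by (intro whp_block_loss) (auto simp: window_le)
    then show ?thesis by (simp only: C_def add.assoc)
  qed
  let ?z = "\<lambda>\<omega>. \<Sum>t\<in>?U. cnj (x t) * \<xi> \<omega> t"
  have Z: "whp (exp (- L)) (\<lambda>\<omega>. (cmod (?z \<omega>))\<^sup>2 \<le> N\<^sup>2 * (2 + 2 * L))"
    by (rule whp_noise_linear[OF _ N_pos N2]) simp
  have "whp (real (card ?N) * (3 * exp (- L)) + exp (- L))
     (\<lambda>\<omega>. (\<forall>i\<in>?N. ?G i \<omega>) \<and> (cmod (?z \<omega>))\<^sup>2 \<le> N\<^sup>2 * (2 + 2 * L))"
    by (rule whp_conj[OF whp_ball[OF _ G] Z]) simp
  then show ?thesis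
  proof (rule outer_prob_le_if_whp)
    have "(3 * (2 * \<Lambda> - 3) + 1) * exp (- L) \<le> \<delta>"
      by (rule error_budget) simp
    then show "real (card ?N) * (3 * exp (- L)) + exp (- L) \<le> \<delta>"
      unfolding card_blocks by (simp add: algebra_simps)
  next
    fix \<omega> assume good: "(\<forall>i\<in>?N. ?G i \<omega>) \<and> (cmod (?z \<omega>))\<^sup>2 \<le> N\<^sup>2 * (2 + 2 * L)"
    define y where "y t = x t + complex_of_real \<sigma> * \<xi> \<omega> t" for t
    \<comment> \<open>The block is enlarged to the closed window, where optimality compares the
      fitted filter with the reproducing one; in the residual of the latter the signal
      cancels.\<close>
    have loss: "(\<Sum>t\<in>block n i. (cmod (y t - conv (block_filter \<Phi>0 \<Phi>p \<Phi>m i y) y t))\<^sup>2)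
        \<le> \<sigma>\<^sup>2 * ((\<Sum>t\<in>block n i. (cmod (\<xi> \<omega> t))\<^sup>2) + C)" if i': "i \<in> ?N" for i
    proof -
      have i: "\<bar>i\<bar> \<le> int K" using i' by auto
      have "(\<Sum>t\<in>block n i. (cmod (y t - conv (block_filter \<Phi>0 \<Phi>p \<Phi>m i y) y t))\<^sup>2)
         \<le> (\<Sum>t\<in>?J i. (cmod (y t - conv (block_filter \<Phi>0 \<Phi>p \<Phi>m i y) y t))\<^sup>2)"
        using block_geometry(2)[OF i] by (intro sum_mono2) auto
      also have "\<dots> \<le> (\<Sum>t\<in>?J i. (cmod (y t - conv (f i) y t))\<^sup>2)"
        unfolding f_def by (rule block_filter_optimal[where ?\<Phi>0.0 = \<Phi>0 and \<Phi>p = \<Phi>p and \<Phi>m = \<Phi>m and y = y, OF i min0 minp minm \<phi>(1)])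
      also have "\<dots> = (\<Sum>t\<in>?J i. \<sigma>\<^sup>2 * (cmod (\<xi> \<omega> t - conv (f i) (\<xi> \<omega>) t))\<^sup>2)"
      proof (intro sum.cong refl)
        fix t
        have "conv (f i) y t = x t + of_real \<sigma> * conv (f i) (\<xi> \<omega>) t"
          unfolding y_def[abs_def] f_def conv_add_scaled[OF supp] \<phi>(2) ..
        then have "y t - conv (f i) y t = of_real \<sigma> * (\<xi> \<omega> t - conv (f i) (\<xi> \<omega>) t)"
          by (simp add: y_def right_diff_distrib)
        then show "(cmod (y t - conv (f i) y t))\<^sup>2 = \<sigma>\<^sup>2 * (cmod (\<xi> \<omega> t - conv (f i) (\<xi> \<omega>) t))\<^sup>2"
          by (simp add: norm_mult power_mult_distrib)
      qed
      also have "\<dots> = \<sigma>\<^sup>2 * (\<Sum>t\<in>?J i. (cmod (\<xi> \<omega> t - conv (f i) (\<xi> \<omega>) t))\<^sup>2)"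
        by (simp add: sum_distrib_left)
      also have "\<dots> \<le> \<sigma>\<^sup>2 * ((\<Sum>t\<in>block n i. (cmod (\<xi> \<omega> t))\<^sup>2) + C)"
        using good i' by (intro mult_left_mono) auto
      finally show ?thesis .
    qed
    have energy: "(\<Sum>t\<in>?U. (cmod (y t))\<^sup>2) = N\<^sup>2 + 2 * \<sigma> * Re (?z \<omega>) + \<sigma>\<^sup>2 * (\<Sum>t\<in>?U. (cmod (\<xi> \<omega> t))\<^sup>2)"
    proof -
      have "(cmod (y t))\<^sup>2 = (cmod (x t))\<^sup>2 + 2 * \<sigma> * Re (cnj (x t) * \<xi> \<omega> t) + \<sigma>\<^sup>2 * (cmod (\<xi> \<omega> t))\<^sup>2" for t
        unfolding y_def by (simp add: cmod_power2) (simp add: power2_eq_square algebra_simps)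
      then show ?thesis
        unfolding N2 Re_sum sum_distrib_left by (simp only: sum.distrib)
    qed
    \<comment> \<open>The noise energy charged to the blocks is at most the one contained in |y|^2,
      so after cancellation no noise energy of order n remains.\<close>
    have "(\<Sum>i\<in>?N. \<Sum>t\<in>block n i. (cmod (\<xi> \<omega> t))\<^sup>2) \<le> (\<Sum>t\<in>?U. (cmod (\<xi> \<omega> t))\<^sup>2)"
      unfolding sum_decompose by (simp add: sum_nonneg)
    then have noise: "\<sigma>\<^sup>2 * (\<Sum>i\<in>?N. \<Sum>t\<in>block n i. (cmod (\<xi> \<omega> t))\<^sup>2) \<le> \<sigma>\<^sup>2 * (\<Sum>t\<in>?U. (cmod (\<xi> \<omega> t))\<^sup>2)"
      by (rule mult_left_mono) simp
    have "(\<Sum>i\<in>?N. \<Sum>t\<in>block n i. (cmod (y t - conv (block_filter \<Phi>0 \<Phi>p \<Phi>m i y) y t))\<^sup>2)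
       \<le> (\<Sum>i\<in>?N. \<sigma>\<^sup>2 * ((\<Sum>t\<in>block n i. (cmod (\<xi> \<omega> t))\<^sup>2) + C))"
      by (intro sum_mono loss)
    also have "\<dots> = \<sigma>\<^sup>2 * (\<Sum>i\<in>?N. \<Sum>t\<in>block n i. (cmod (\<xi> \<omega> t))\<^sup>2) + (2 * \<Lambda> - 3) * (\<sigma>\<^sup>2 * C)"
      unfolding sum_distrib_left[symmetric] sum.distrib distrib_left sum_constant card_blocks by simp
    finally have total_loss: "(\<Sum>i\<in>?N. \<Sum>t\<in>block n i. (cmod (y t - conv (block_filter \<Phi>0 \<Phi>p \<Phi>m i y) y t))\<^sup>2)
       \<le> \<sigma>\<^sup>2 * (\<Sum>i\<in>?N. \<Sum>t\<in>block n i. (cmod (\<xi> \<omega> t))\<^sup>2) + (2 * \<Lambda> - 3) * (\<sigma>\<^sup>2 * C)" .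
    have "Tstat n s \<Phi>0 \<Phi>p \<Phi>m y = (\<Sum>t\<in>?U. (cmod (y t))\<^sup>2)
       - (\<Sum>i\<in>?N. \<Sum>t\<in>block n i. (cmod (y t - conv (block_filter \<Phi>0 \<Phi>p \<Phi>m i y) y t))\<^sup>2)"
      unfolding Tstat_decompose sum_decompose by (simp add: sum_subtractf)
    moreover have "2 * \<sigma> * (- Re (?z \<omega>)) \<le> N\<^sup>2 / 8 + 8 * \<sigma>\<^sup>2 * (2 + 2 * L)"
    proof (rule twice_product_le)
      have "(- Re z)\<^sup>2 \<le> (cmod z)\<^sup>2" for z
        by (simp add: cmod_power2)
      then show "(- Re (?z \<omega>))\<^sup>2 \<le> N\<^sup>2 * (2 + 2 * L)" using good by (blast intro: order_trans)
    qed (use L_ge in simp)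
    \<comment> \<open>A quarter of 128 is 32, whereas the errors amount to at most 16 R \<Lambda>;
      the spare factor gives the strict inequality that rejection requires.\<close>
    moreover have "8 * \<sigma>\<^sup>2 * (2 + 2 * L) + (2 * \<Lambda> - 3) * (\<sigma>\<^sup>2 * C) < 1 / 4 * r0sq n s \<sigma> \<delta>"
    proof -
      have "C \<le> 8 * R" unfolding C_def using R_bounds s_pos by simp
      then have "(2 * \<Lambda> - 3) * C \<le> (2 * \<Lambda> - 3) * (8 * R)"
        by (intro mult_left_mono) (auto simp: \<Lambda>_def)
      moreover have "2 + 2 * L \<le> 2 * R" using R_bounds s_pos by simp
      ultimately have "8 * (2 + 2 * L) + (2 * \<Lambda> - 3) * C \<le> 16 * (R * \<Lambda>)"
        using R_bounds(2) by (simp add: algebra_simps)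
      also have "\<dots> < 32 * (R * \<Lambda>)" using R_bounds(2) by (simp add: \<Lambda>_def)
      also have "\<dots> \<le> 32 * (cstar\<^sup>2 * b * (R * \<Lambda>))"
      proof -
        have "1 * 1 \<le> cstar\<^sup>2 * b"
          using cstar_ge b_ge by (intro mult_mono) (auto simp: one_le_power)
        then have "1 * (R * \<Lambda>) \<le> cstar\<^sup>2 * b * (R * \<Lambda>)"
          using R_bounds(2) by (intro mult_right_mono) (auto simp: \<Lambda>_def)
        then show ?thesis by simp
      qed
      finally have "\<sigma>\<^sup>2 * (8 * (2 + 2 * L) + (2 * \<Lambda> - 3) * C) < \<sigma>\<^sup>2 * (32 * (cstar\<^sup>2 * b * (R * \<Lambda>)))"
        using \<sigma>_pos by (intro mult_strict_left_mono) auto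
      then show ?thesis unfolding r0sq_eq by (simp add: algebra_simps)
    qed
    ultimately have "Tstat n s \<Phi>0 \<Phi>p \<Phi>m y > 5 / 8 * r0sq n s \<sigma> \<delta>"
      using total_loss noise energy r unfolding N_def[symmetric] by (simp add: algebra_simps)
    then show "\<not> Tstat n s \<Phi>0 \<Phi>p \<Phi>m (\<lambda>t. x t + complex_of_real \<sigma> * \<xi> \<omega> t) \<le> 5 / 8 * r0sq n s \<sigma> \<delta>"
      by (simp add: y_def[abs_def])
  qed
qed

end

theorem theorem5:
  fixes n s :: nat and \<sigma> \<delta> r :: real
    and M :: "'a measure" and \<xi> :: "'a \<Rightarrow> int \<Rightarrow> complex"
    and \<Phi>0 :: "(int \<Rightarrow> complex) \<Rightarrow> (int \<Rightarrow> complex)"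
    and \<Phi>p \<Phi>m :: "nat \<Rightarrow> (int \<Rightarrow> complex) \<Rightarrow> (int \<Rightarrow> complex)"
  assumes "\<exists>a. n = 3 ^ a" and "\<exists>b. s = 3 ^ b" and "n \<ge> 9 * s"
    and "\<sigma> > 0" and "0 < \<delta>" and "\<delta> < 1"
    and "prob_space M"
    and "prob_space.indep_vars M (\<lambda>_. borel) (\<lambda>t \<omega>. \<xi> \<omega> t) {- 2 * int n .. 2 * int n}"
    and "\<And>t. \<bar>t\<bar> \<le> 2 * int n \<Longrightarrow> distributed M lborel (\<lambda>\<omega>. \<xi> \<omega> t) cgauss_density"
    and "\<And>y. is_min0 n s y (\<Phi>0 y)"
    and "\<And>k y. k \<in> {1..Kidx n s} \<Longrightarrow> is_mink n s k True y (\<Phi>p k y)"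
    and "\<And>k y. k \<in> {1..Kidx n s} \<Longrightarrow> is_mink n s k False y (\<Phi>m k y)"
    and "r \<ge> 0" and "r\<^sup>2 \<ge> r0sq n s \<sigma> \<delta>"
  shows "(\<forall>x. norm2 (2 * n) x = 0 \<longrightarrow>
            outer_prob_le M (\<lambda>\<omega>. Tstat n s \<Phi>0 \<Phi>p \<Phi>m
                 (\<lambda>t. x t + complex_of_real \<sigma> * \<xi> \<omega> t) > 5 / 8 * r0sq n s \<sigma> \<delta>) \<delta>)
       \<and> (\<forall>x. in_Xs s x \<and> norm2 (2 * n) x \<ge> r \<longrightarrow>
            outer_prob_le M (\<lambda>\<omega>. Tstat n s \<Phi>0 \<Phi>p \<Phi>m
                 (\<lambda>t. x t + complex_of_real \<sigma> * \<xi> \<omega> t) \<le> 5 / 8 * r0sq n s \<sigma> \<delta>) \<delta>)"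
proof -
  obtain a b where ab: "n = 3 ^ a" "s = 3 ^ b" using assms(1,2) by blast
  define K where "K = a - b - 2"
  interpret prob_space M by fact
  interpret triadic n s K
    unfolding K_def by (rule triadic_of_powers(1)[OF ab assms(3)])
  interpret cgauss_family M \<xi> "{- 2 * int n..2 * int n}"
    using assms(8,9) by unfold_locales auto
  interpret cgauss_noise M \<xi> "{- 2 * int n..2 * int n}" ..
  interpret detection M \<xi> n s K \<Phi>0 \<Phi>p \<Phi>m \<sigma> \<delta>
  proof
    show "log 3 (real n / real s) = real K + 2"
      unfolding K_def by (rule triadic_of_powers(2)[OF ab assms(3)])
    show "s \<ge> 1" by (simp add: ab(2))
    show "is_mink n s k True y (\<Phi>p k y)" "is_mink n s k False y (\<Phi>m k y)" if "k \<in> {1..K}" for k y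
      using assms(11,12)[of k y] that Kidx_K by auto
  qed (use assms(4-6,10) in auto)
  have "(norm2 (2 * n) x)\<^sup>2 \<ge> r0sq n s \<sigma> \<delta>" if "norm2 (2 * n) x \<ge> r" for x
    using power_mono[OF that assms(13), of 2] assms(14) by linarith
  then show ?thesis using type_I_error type_II_error by blast
qed

end
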